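(* Let $G$ be a compact Lie group with Lie algebra $\mathfrak{g}$, let $X\in\mathfrak{g}$ with $X\neq 0$, let $a_0\in\mathbb{R}$, let $b\in C^\infty(\mathbb{T}^1;\mathbb{R})$, and let $q\in\mathbb{C}$. Assume that $b\not\equiv 0$. If the operator $$L=\partial_t+(a_0+ib(t))X+q$$ acting on $\mathcal{D}'(\mathbb{T}^1\times G)$ is globally hypoelliptic, then $b$ does not change sign.
   Context: $\mathbb{T}^1=\mathbb{R}/2\pi\mathbb{Z}$. An element $X\in\mathfrak{g}$ is identified with the left-invariant vector field on $G$ acting by $(Xf)(x)=\frac{d}{ds}f(x\exp(sX))\big|_{s=0}$ for $f\in C^\infty(G)$; it acts on functions and distributions on $\mathbb{T}^1\times G$ in the $G$-variable (on distributions in the usual way, extending the action on smooth functions). $\mathcal{D}'(\mathbb{T}^1\times G)$ is the space of distributions on $\mathbb{T}^1\times G$, and $q$ acts by multiplication. An operator $P:\mathcal{D}'(\mathbb{T}^1\times G)\to\mathcal{D}'(\mathbb{T}^1\times G)$ is globally hypoelliptic if, for every $u\in\mathcal{D}'(\mathbb{T}^1\times G)$, $Pu\in C^\infty(\mathbb{T}^1\times G)$ implies $u\in C^\infty(\mathbb{T}^1\times G)$. "$b$ does not change sign" means that either $b(t)\ge 0$ for all $t\in\mathbb{T}^1$ or $b(t)\le 0$ for all $t\in\mathbb{T}^1$. *)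

theory Defs
  imports "HOL-Analysis.Analysis" "HOL-Probability.Probability_Measure" "HOL-Algebra.Group"
begin

section \<open>Smooth maps\<close>

primrec dir_deriv ::
  "'a list \<Rightarrow> ('a::real_normed_vector \<Rightarrow> 'b::real_normed_vector) \<Rightarrow> 'a \<Rightarrow> 'b" where
  "dir_deriv [] f = f"
| "dir_deriv (v # vs) f = (\<lambda>x. frechet_derivative (dir_deriv vs f) (at x) v)"

text \<open>Only used for open \<open>S\<close>: all iterated directional derivatives exist and are
  again (totally) differentiable on \<open>S\<close>, that is, \<open>f\<close> is of class \<open>C\<^sup>\<infinity>\<close> on \<open>S\<close>.\<close>

definition smooth_on :: "'a set \<Rightarrow> ('a::real_normed_vector \<Rightarrow> 'b::real_normed_vector) \<Rightarrow> bool" where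
  "smooth_on S f \<longleftrightarrow> (\<forall>vs. \<forall>x\<in>S. dir_deriv vs f differentiable at x)"

text \<open>A chart is a pair \<open>(U, \<phi>)\<close>; \<open>\<phi>\<close> is only meaningful on \<open>U\<close>, and its inverse is
  \<open>inv_into U \<phi>\<close>. A smooth structure on the whole type \<open>'m\<close> is given by an atlas, which need not
  be maximal.\<close>

type_synonym ('m, 'e) chart = "'m set \<times> ('m \<Rightarrow> 'e)"

definition is_chart :: "('m::topological_space, 'e::euclidean_space) chart \<Rightarrow> bool" where
  "is_chart = (\<lambda>(U, \<phi>). open U \<and> open (\<phi> ` U) \<and> homeomorphism U (\<phi> ` U) \<phi> (inv_into U \<phi>))"

definition smooth_atlas :: "('m::topological_space, 'e::euclidean_space) chart set \<Rightarrow> bool" where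
  "smooth_atlas A \<longleftrightarrow>
     (\<forall>c\<in>A. is_chart c) \<and> (\<Union>(U, \<phi>)\<in>A. U) = UNIV \<and>
     (\<forall>(U, \<phi>)\<in>A. \<forall>(V, \<psi>)\<in>A. smooth_on (\<phi> ` (U \<inter> V)) (\<psi> \<circ> inv_into U \<phi>))"

definition euclidean_atlas :: "('e::euclidean_space, 'e) chart set" where
  "euclidean_atlas = {(UNIV, id)}"

definition prod_atlas ::
  "('m, 'e) chart set \<Rightarrow> ('n, 'f) chart set \<Rightarrow> ('m \<times> 'n, 'e \<times> 'f) chart set" where
  "prod_atlas A B = {(U \<times> V, map_prod \<phi> \<psi>) |U \<phi> V \<psi>. (U, \<phi>) \<in> A \<and> (V, \<psi>) \<in> B}"

definition smooth_map ::
  "('m::topological_space, 'e::euclidean_space) chart set \<Rightarrow>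
   ('n::topological_space, 'f::euclidean_space) chart set \<Rightarrow> ('m \<Rightarrow> 'n) \<Rightarrow> bool" where
  "smooth_map A B f \<longleftrightarrow> continuous_on UNIV f \<and>
     (\<forall>(U, \<phi>)\<in>A. \<forall>(V, \<psi>)\<in>B. smooth_on (\<phi> ` (U \<inter> f -` V)) (\<psi> \<circ> f \<circ> inv_into U \<phi>))"

definition smooth_fun ::
  "('m::topological_space, 'e::euclidean_space) chart set \<Rightarrow> ('m \<Rightarrow> 'b::euclidean_space) \<Rightarrow> bool" where
  "smooth_fun A f \<longleftrightarrow> smooth_map A euclidean_atlas f"

text \<open>Convergence in the Frechet space of smooth functions: locally uniform convergence, in every
  chart, of all derivatives.\<close>

definition smooth_converges ::
  "('m::topological_space, 'e::euclidean_space) chart set \<Rightarrow>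
   (nat \<Rightarrow> 'm \<Rightarrow> 'b::euclidean_space) \<Rightarrow> ('m \<Rightarrow> 'b) \<Rightarrow> bool" where
  "smooth_converges A F f \<longleftrightarrow>
     (\<forall>(U, \<phi>)\<in>A. \<forall>K vs. compact K \<and> K \<subseteq> \<phi> ` U \<longrightarrow>
        uniform_limit K (\<lambda>n. dir_deriv vs (F n \<circ> inv_into U \<phi>))
          (dir_deriv vs (f \<circ> inv_into U \<phi>)) sequentially)"

section \<open>Lie groups\<close>

locale lie_group = group G for G :: "('g::t2_space, 'x) monoid_scheme" (structure) +
  fixes A :: "('g, 'e::euclidean_space) chart set"
  assumes carrier_eq_UNIV: "carrier G = UNIV"
    and atlas: "smooth_atlas A"
    and smooth_mult: "smooth_map (prod_atlas A A) A (\<lambda>(x, y). x \<otimes> y)"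
    and smooth_inv: "smooth_map A A (\<lambda>x. inv x)"

text \<open>The Lie algebra as a vector space, namely the tangent space at the identity: derivations at
  \<open>\<one>\<close> of the algebra of smooth real functions on \<open>G\<close>. They are made to vanish outside that algebra, so
  that the zero vector is the zero function.\<close>

definition lie_algebra ::
  "('g::t2_space, 'x) monoid_scheme \<Rightarrow> ('g, 'e::euclidean_space) chart set \<Rightarrow> (('g \<Rightarrow> real) \<Rightarrow> real) set" where
  "lie_algebra G A = {X.
     (\<forall>f. \<not> smooth_fun A f \<longrightarrow> X f = 0) \<and>
     (\<forall>f g. smooth_fun A f \<longrightarrow> smooth_fun A g \<longrightarrow> X (\<lambda>x. f x + g x) = X f + X g) \<and>
     (\<forall>c f. smooth_fun A f \<longrightarrow> X (\<lambda>x. c * f x) = c * X f) \<and>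
     (\<forall>f g. smooth_fun A f \<longrightarrow> smooth_fun A g \<longrightarrow>
        X (\<lambda>x. f x * g x) = f \<one>\<^bsub>G\<^esub> * X g + g \<one>\<^bsub>G\<^esub> * X f)}"

definition one_parameter_subgroup ::
  "('g::t2_space, 'x) monoid_scheme \<Rightarrow> ('g, 'e::euclidean_space) chart set \<Rightarrow>
   (('g \<Rightarrow> real) \<Rightarrow> real) \<Rightarrow> (real \<Rightarrow> 'g) \<Rightarrow> bool" where
  "one_parameter_subgroup G A X \<gamma> \<longleftrightarrow>
     smooth_map euclidean_atlas A \<gamma> \<and>
     (\<forall>s t. \<gamma> (s + t) = \<gamma> s \<otimes>\<^bsub>G\<^esub> \<gamma> t) \<and>
     (\<forall>f. smooth_fun A f \<longrightarrow> ((\<lambda>s. f (\<gamma> s)) has_real_derivative X f) (at 0))"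

text \<open>Every \<open>X\<close> in the Lie algebra is the velocity at \<open>0\<close> of exactly one one-parameter subgroup.\<close>

definition lie_exp ::
  "('g::t2_space, 'x) monoid_scheme \<Rightarrow> ('g, 'e::euclidean_space) chart set \<Rightarrow>
   (('g \<Rightarrow> real) \<Rightarrow> real) \<Rightarrow> 'g" where
  "lie_exp G A X = (THE \<gamma>. one_parameter_subgroup G A X \<gamma>) 1"

definition left_inv_field ::
  "('g::t2_space, 'x) monoid_scheme \<Rightarrow> ('g, 'e::euclidean_space) chart set \<Rightarrow>
   (('g \<Rightarrow> real) \<Rightarrow> real) \<Rightarrow> ('g \<Rightarrow> 'b::real_normed_vector) \<Rightarrow> 'g \<Rightarrow> 'b" where
  "left_inv_field G A X f x =
     vector_derivative (\<lambda>s. f (x \<otimes>\<^bsub>G\<^esub> lie_exp G A (\<lambda>g. s * X g))) (at 0)"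

text \<open>On a compact Lie group there is exactly one such measure.\<close>

definition haar_measure :: "('g::t2_space, 'x) monoid_scheme \<Rightarrow> 'g measure \<Rightarrow> bool" where
  "haar_measure G \<mu> \<longleftrightarrow> prob_space \<mu> \<and> sets \<mu> = sets borel \<and>
     (\<forall>g. distr \<mu> borel (\<lambda>x. g \<otimes>\<^bsub>G\<^esub> x) = \<mu>) \<and>
     (\<forall>g. distr \<mu> borel (\<lambda>x. x \<otimes>\<^bsub>G\<^esub> g) = \<mu>)"

section \<open>Functions and distributions on the product of the circle and \<open>G\<close>\<close>

text \<open>Functions on the circle (the reals modulo \<open>2\<pi>\<close>) are represented by \<open>2\<pi>\<close>-periodic functions
  of a real variable.\<close>

definition circle_smooth :: "(real \<Rightarrow> 'b::real_normed_vector) \<Rightarrow> bool" where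
  "circle_smooth b \<longleftrightarrow> smooth_on UNIV b \<and> (\<forall>t. b (t + 2 * pi) = b t)"

definition TG_smooth ::
  "('g::t2_space, 'e::euclidean_space) chart set \<Rightarrow> (real \<times> 'g \<Rightarrow> complex) set" where
  "TG_smooth A = {f. smooth_fun (prod_atlas euclidean_atlas A) f \<and>
                     (\<forall>t x. f (t + 2 * pi, x) = f (t, x))}"

text \<open>Distributions are the continuous linear functionals on the Frechet space \<open>TG_smooth A\<close>
  (metrizable, so sequential continuity is continuity). The value of a functional outside
  \<open>TG_smooth A\<close> carries no information: two functionals that agree on \<open>TG_smooth A\<close> are the same
  distribution.\<close>

type_synonym 'g functional = "(real \<times> 'g \<Rightarrow> complex) \<Rightarrow> complex"

definition distributions :: "('g::t2_space, 'e::euclidean_space) chart set \<Rightarrow> 'g functional set" where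
  "distributions A = {u.
     (\<forall>f\<in>TG_smooth A. \<forall>g\<in>TG_smooth A. u (\<lambda>p. f p + g p) = u f + u g) \<and>
     (\<forall>c. \<forall>f\<in>TG_smooth A. u (\<lambda>p. c * f p) = c * u f) \<and>
     (\<forall>F f. (\<forall>n. F n \<in> TG_smooth A) \<longrightarrow> f \<in> TG_smooth A \<longrightarrow>
        smooth_converges (prod_atlas euclidean_atlas A) F f \<longrightarrow> (\<lambda>n. u (F n)) \<longlonglongrightarrow> u f)}"

text \<open>The distribution \<open>u\<close> is (given by integration against) a smooth function.\<close>

definition is_smooth_distribution ::
  "('g::t2_space, 'e::euclidean_space) chart set \<Rightarrow> 'g measure \<Rightarrow> 'g functional \<Rightarrow> bool" where
  "is_smooth_distribution A \<mu> u \<longleftrightarrow> (\<exists>f\<in>TG_smooth A. \<forall>\<phi>\<in>TG_smooth A.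
     u \<phi> = (LINT t:{0..2 * pi}|lborel. (LINT x|\<mu>. f (t, x) * \<phi> (t, x))))"

definition globally_hypoelliptic ::
  "('g::t2_space, 'e::euclidean_space) chart set \<Rightarrow> 'g measure \<Rightarrow>
   ('g functional \<Rightarrow> 'g functional) \<Rightarrow> bool" where
  "globally_hypoelliptic A \<mu> P \<longleftrightarrow> (\<forall>u\<in>distributions A.
     is_smooth_distribution A \<mu> (P u) \<longrightarrow> is_smooth_distribution A \<mu> u)"

definition dist_dt :: "'g functional \<Rightarrow> 'g functional" where
  "dist_dt u = (\<lambda>\<phi>. - u (\<lambda>(t, x). vector_derivative (\<lambda>s. \<phi> (s, x)) (at t)))"

text \<open>The sign comes from integration by parts: the flow \<open>x \<mapsto> x \<otimes> exp (sX)\<close> preserves the Haar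
  measure.\<close>

definition dist_field ::
  "('g::t2_space, 'x) monoid_scheme \<Rightarrow> ('g, 'e::euclidean_space) chart set \<Rightarrow>
   (('g \<Rightarrow> real) \<Rightarrow> real) \<Rightarrow> 'g functional \<Rightarrow> 'g functional" where
  "dist_field G A X u = (\<lambda>\<phi>. - u (\<lambda>(t, x). left_inv_field G A X (\<lambda>y. \<phi> (t, y)) x))"

definition dist_mult :: "(real \<Rightarrow> complex) \<Rightarrow> 'g functional \<Rightarrow> 'g functional" where
  "dist_mult c u = (\<lambda>\<phi>. u (\<lambda>(t, x). c t * \<phi> (t, x)))"

definition L_op ::
  "('g::t2_space, 'x) monoid_scheme \<Rightarrow> ('g, 'e::euclidean_space) chart set \<Rightarrow>
   (('g \<Rightarrow> real) \<Rightarrow> real) \<Rightarrow> real \<Rightarrow> (real \<Rightarrow> real) \<Rightarrow> complex \<Rightarrow> 'g functional \<Rightarrow> 'g functional" where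
  "L_op G A X a0 b q u = (\<lambda>\<phi>.
     dist_dt u \<phi> +
     dist_mult (\<lambda>t. complex_of_real a0 + \<i> * complex_of_real (b t)) (dist_field G A X u) \<phi> +
     q * u \<phi>)"

end

theory Submission
  imports Defs
begin

text \<open>Suppose that \<open>b\<close> changes sign. Then a primitive \<open>B\<close> of \<open>b\<close> has, on some interval
  \<open>[s\<^sub>1, s\<^sub>2]\<close> of length less than \<open>2\<pi>\<close>, an interior minimum \<open>t\<^sub>0\<close> with \<open>B > B(t\<^sub>0)\<close> near both ends.
  Choose a smooth \<open>f : G \<rightarrow> \<real>\<close> with \<open>f(1) = 0\<close> and \<open>X f = 1\<close> at the identity, and put, for a small
  \<open>\<kappa> > 0\<close>,
  \<open>Z(t, x, s) = \<i> f(x exp(sX)) + \<zeta>(s + a\<^sub>0 (t - t\<^sub>0) + \<i> (B(t) - B(t\<^sub>0)))\<close> with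
  \<open>\<zeta>(w) = - \<i> w + \<kappa> w\<^sup>2\<close>. Then \<open>Re Z \<ge> 0\<close>, with equality only if \<open>B(t) = B(t\<^sub>0)\<close> and
  \<open>s + a\<^sub>0 (t - t\<^sub>0) = 0\<close>, and \<open>(\<partial>\<^sub>t + (a\<^sub>0 + \<i> b) X) h(Z) = (a\<^sub>0 + \<i> b) \<partial>\<^sub>s h(Z)\<close> for every
  holomorphic \<open>h\<close>. Let \<open>\<chi>\<close> be a cutoff supported in \<open>[s\<^sub>1, s\<^sub>2]\<close> whose derivative lives where
  \<open>B > B(t\<^sub>0)\<close>, and let \<open>u(t, x) = \<chi>(t) e\<^sup>-\<^sup>q\<^sup>t \<integral> \<surd>Z ds\<close>, the integral being over a large interval
  \<open>[-R, R]\<close>. Since \<open>L u\<close> only involves \<open>\<surd>Z\<close> where \<open>\<chi>' \<noteq> 0\<close> or \<open>s = \<plusminus>R\<close>, hence where \<open>Re Z > 0\<close>, it is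
  smooth. But \<open>u\<close> is not differentiable along \<open>exp(sX)\<close> at \<open>(t\<^sub>0, 1)\<close>, where its difference
  quotients diverge logarithmically.\<close>

text \<open>The shape of \<open>Z\<close> is dictated by what happens at \<open>t\<^sub>0\<close>
  and x = exp(rX). With F(v) = f(exp(vX)) = v + O(v^2), there Z = i (F(r + s) - s) + kappa s^2: the
  term -i w cancels the linear part of i f, so that at r = 0 the modulus of \<open>Z\<close> is
  comparable to s^2 near s = 0. One derivative in r then turns the root into an integrand of size
  1/|s|, just short of integrable; an exponent larger than 1/2 would give an integrable one. The
  term kappa w^2 keeps Re Z positive off s = 0; for small kappa its price, kappa times the square of
  B - B(t0), is absorbed by B - B(t0) itself. Since Re Z >= 0, the principal root stays in the
  sector |arg| <= pi/4, where it is Hoelder continuous and the singular contributions cannot cancel.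

  The equation for L u cannot be checked by differentiating u. It is proved for the root of eps + Z,
  which is smooth, put in weak form, and passed to the limit.

  Only the curve exp(sX) enters, whether or not it closes up. As exp is given by a definite
  description, existence and uniqueness of one-parameter subgroups have to be proved, starting from
  Picard iteration.\<close>

section \<open>Calculus of smooth maps between normed spaces\<close>

lemma dir_deriv_append:
  "dir_deriv (vs @ [v]) f = dir_deriv vs (\<lambda>x. frechet_derivative f (at x) v)"
  by (induction vs) auto

text \<open>Smoothness speaks of all lists of directions at once; this order-by-order version allows
  induction on the order with the function varying. Order n asks for differentiability of the
  derivatives of order up to n, so order 0 already means differentiable. Here the derivative taken
  first is peeled off, in \<open>dir_deriv\<close> the one taken last;
  \<open>dir_deriv_append\<close> reconciles the two.\<close>

primrec Ck :: "nat \<Rightarrow> 'a set \<Rightarrow> ('a::real_normed_vector \<Rightarrow> 'b::real_normed_vector) \<Rightarrow> bool" where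
  "Ck 0 S f \<longleftrightarrow> (\<forall>x\<in>S. f differentiable at x)"
| "Ck (Suc n) S f \<longleftrightarrow>
     (\<forall>x\<in>S. f differentiable at x) \<and> (\<forall>v. Ck n S (\<lambda>x. frechet_derivative f (at x) v))"

lemma Ck_iff_dir_deriv:
  fixes S :: "'a::real_normed_vector set"
  shows "Ck n S f \<longleftrightarrow> (\<forall>vs. length vs \<le> n \<longrightarrow> (\<forall>x\<in>S. dir_deriv vs f differentiable at x))"
proof (induction n arbitrary: f)
  case (Suc n)
  show ?case (is "?l \<longleftrightarrow> ?r")
  proof
    assume l: ?l
    show ?r
    proof (intro allI impI ballI)
      fix vs :: "'a list" and x assume "length vs \<le> Suc n" "x \<in> S"
      with l Suc show "dir_deriv vs f differentiable at x"
        by (cases vs rule: rev_cases) (auto simp: dir_deriv_append)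
    qed
  next
    assume r: ?r
    have "dir_deriv vs (\<lambda>x. frechet_derivative f (at x) v) differentiable at x"
      if "length vs \<le> n" "x \<in> S" for vs :: "'a list" and v x
      using r[rule_format, of "vs @ [v]" x] that by (simp add: dir_deriv_append)
    moreover have "f differentiable at x" if "x \<in> S" for x
      using r[rule_format, of "[]" x] that by simp
    ultimately show ?l by (simp add: Suc)
  qed
qed auto

lemma smooth_on_iff_Ck: "smooth_on S f \<longleftrightarrow> (\<forall>n. Ck n S f)"
  unfolding Ck_iff_dir_deriv smooth_on_def by blast

lemma Ck_differentiable: "Ck n S f \<Longrightarrow> x \<in> S \<Longrightarrow> f differentiable at x"
  by (cases n) auto

lemma Ck_Suc_imp: "Ck (Suc n) S f \<Longrightarrow> Ck n S f"
  by (simp add: Ck_iff_dir_deriv)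

lemma frechet_derivative_cong_open:
  assumes "open S" "x \<in> S" "\<And>y. y \<in> S \<Longrightarrow> f y = g y"
  shows "frechet_derivative f (at x) = frechet_derivative g (at x)"
proof -
  have "(g has_derivative D) (at x)" if "(f has_derivative D) (at x)" for D
    using that assms by (rule has_derivative_transform_within_open)
  moreover have "(f has_derivative D) (at x)" if "(g has_derivative D) (at x)" for D
    using that assms(1,2) assms(3)[symmetric] by (rule has_derivative_transform_within_open)
  ultimately have "(f has_derivative D) (at x) \<longleftrightarrow> (g has_derivative D) (at x)" for D
    by blast
  then show ?thesis by (simp add: frechet_derivative_def)
qed

lemma Ck_cong:
  assumes "open S" "\<And>x. x \<in> S \<Longrightarrow> f x = g x" "Ck n S f"
  shows "Ck n S g"
  using assms(2,3)
proof (induction n arbitrary: f g)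
  case 0
  have "g differentiable at x" if "x \<in> S" for x
    using Ck_differentiable[OF 0(2) that] has_derivative_transform_within_open[where f=f and g=g, OF _ assms(1) that 0(1)]
    unfolding differentiable_def by blast
  then show ?case by simp
next
  case (Suc n)
  have "g differentiable at x" if "x \<in> S" for x
    using Ck_differentiable[OF Suc.prems(2) that]
      has_derivative_transform_within_open[where f=f and g=g, OF _ assms(1) that Suc.prems(1)]
    unfolding differentiable_def by blast
  moreover have "Ck n S (\<lambda>x. frechet_derivative g (at x) v)" for v
  proof (rule Suc.IH[of "\<lambda>x. frechet_derivative f (at x) v"])
    show "frechet_derivative f (at x) v = frechet_derivative g (at x) v" if "x \<in> S" for x
      using frechet_derivative_cong_open[OF assms(1) that, of f g] Suc.prems(1) by simp
    show "Ck n S (\<lambda>x. frechet_derivative f (at x) v)" using Suc.prems(2) by simp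
  qed
  ultimately show ?case by simp
qed

text \<open>Any formula \<open>D\<close> for the derivative will do: uniqueness of the Frechet
  derivative identifies it with the one in \<open>Ck\<close>.\<close>

lemma Ck_SucI:
  assumes "open S" "\<And>x. x \<in> S \<Longrightarrow> (f has_derivative D x) (at x)" "\<And>v. Ck n S (\<lambda>x. D x v)"
  shows "Ck (Suc n) S f"
proof -
  have *: "frechet_derivative f (at x) = D x" if "x \<in> S" for x
    using assms(2)[OF that] by (metis frechet_derivative_at)
  have "Ck n S (\<lambda>x. frechet_derivative f (at x) v)" for v
    by (rule Ck_cong[OF assms(1) _ assms(3)]) (simp add: *)
  then show ?thesis using assms(2) by (auto simp: differentiable_def)
qed

lemma CkI:
  assumes "open S" "\<And>x. x \<in> S \<Longrightarrow> (f has_derivative D x) (at x)" "\<And>v m. n = Suc m \<Longrightarrow> Ck m S (\<lambda>x. D x v)"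
  shows "Ck n S f"
proof (cases n)
  case 0
  then show ?thesis using assms(2) by (auto simp: differentiable_def)
next
  case (Suc m)
  show ?thesis unfolding Suc by (rule Ck_SucI[OF assms(1,2)]) (use Suc assms(3) in auto)
qed

lemma Ck_has_derivative:
  "Ck n S f \<Longrightarrow> x \<in> S \<Longrightarrow> (f has_derivative frechet_derivative f (at x)) (at x)"
  using Ck_differentiable frechet_derivative_works by blast

lemma Ck_const: "open S \<Longrightarrow> Ck n S (\<lambda>x. c)"
  by (induction n arbitrary: c) (auto intro!: Ck_SucI[where D="\<lambda>x v. 0"])

lemma Ck_bounded_linear:
  assumes "open S" "bounded_linear L"
  shows "Ck n S L"
  by (rule CkI[where D="\<lambda>x. L"]) (use assms in \<open>auto intro: Ck_const bounded_linear_imp_has_derivative\<close>)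

lemma Ck_add:
  assumes S: "open S" and "Ck n S f" "Ck n S g"
  shows "Ck n S (\<lambda>x. f x + g x)"
  using assms(2,3)
proof (induction n arbitrary: f g)
  case 0
  then show ?case by (auto intro: differentiable_add)
next
  case (Suc n)
  show ?case
    by (rule Ck_SucI[OF S has_derivative_add[OF Ck_has_derivative[OF Suc.prems(1)]
          Ck_has_derivative[OF Suc.prems(2)]]])
      (use Suc in auto)
qed

text \<open>By the product rule the derivative is a sum of two terms built with the same bilinear
  map, each with one factor differentiated once; hence the induction over both factors at
  once.\<close>

lemma Ck_bilinear:
  assumes S: "open S" and p: "bounded_bilinear p" and "Ck n S f" "Ck n S g"
  shows "Ck n S (\<lambda>x. p (f x) (g x))"
  using assms(3,4)
proof (induction n arbitrary: f g)
  case 0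
  then show ?case
    using bounded_bilinear.FDERIV[OF p] unfolding Ck.simps differentiable_def by blast
next
  case (Suc n)
  show ?case
    by (rule Ck_SucI[OF S bounded_bilinear.FDERIV[OF p Ck_has_derivative[OF Suc.prems(1)]
          Ck_has_derivative[OF Suc.prems(2)]]])
      (use Suc.prems Suc.prems[THEN Ck_Suc_imp] in \<open>auto intro!: Ck_add[OF S] Suc.IH\<close>)
qed

lemma Ck_linear_comp:
  assumes S: "open S" and L: "bounded_linear L" and "Ck n S f"
  shows "Ck n S (\<lambda>x. L (f x))"
  using assms(3)
proof (induction n arbitrary: f)
  case 0
  then show ?case using bounded_linear.has_derivative[OF L] unfolding Ck.simps differentiable_def by blast
next
  case (Suc n)
  show ?case
    by (rule Ck_SucI[OF S bounded_linear.has_derivative[OF L Ck_has_derivative[OF Suc.prems(1)]]])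
      (use Suc in auto)
qed

lemma Ck_sum:
  assumes S: "open S" and "\<And>i. i \<in> I \<Longrightarrow> Ck n S (f i)"
  shows "Ck n S (\<lambda>x. \<Sum>i\<in>I. f i x)"
  using assms(2) by (induction I rule: infinite_finite_induct) (auto intro: Ck_const[OF S] Ck_add[OF S])

text \<open>The chain rule applies a varying linear map to a varying vector. Expanding that vector
  in a basis of the middle space turns the derivative into a finite sum of products, whose factors
  are coordinates of the derivative of \<open>f\<close> and partial derivatives of \<open>g\<close>
  composed with \<open>f\<close>; the induction hypothesis covers the latter.\<close>

lemma Ck_compose:
  fixes f :: "'a::real_normed_vector \<Rightarrow> 'b::euclidean_space" and g :: "'b \<Rightarrow> 'c::real_normed_vector"
  assumes S: "open S" and T: "open T" and "\<And>x. x \<in> S \<Longrightarrow> f x \<in> T" and "Ck n S f" "Ck n T g"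
  shows "Ck n S (\<lambda>x. g (f x))"
  using assms(3-)
proof (induction n arbitrary: f g)
  case 0
  then show ?case
    unfolding Ck.simps differentiable_def by (blast intro: has_derivative_compose)
next
  case (Suc n)
  have 1: "((\<lambda>x. g (f x)) has_derivative
      (\<lambda>v. \<Sum>b\<in>Basis. (frechet_derivative f (at x) v \<bullet> b) *\<^sub>R frechet_derivative g (at (f x)) b)) (at x)"
    if "x \<in> S" for x
  proof -
    have gd: "(g has_derivative frechet_derivative g (at (f x))) (at (f x))"
      using Suc.prems that Ck_has_derivative by blast
    have lin: "linear (frechet_derivative g (at (f x)))" using gd has_derivative_linear by blast
    have "frechet_derivative g (at (f x)) (\<Sum>b\<in>Basis. (w \<bullet> b) *\<^sub>R b) =
        (\<Sum>b\<in>Basis. (w \<bullet> b) *\<^sub>R frechet_derivative g (at (f x)) b)" for w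
      by (simp add: linear_sum[OF lin] linear_cmul[OF lin])
    then have eq: "(\<lambda>v. frechet_derivative g (at (f x)) (frechet_derivative f (at x) v)) =
        (\<lambda>v. \<Sum>b\<in>Basis. (frechet_derivative f (at x) v \<bullet> b) *\<^sub>R frechet_derivative g (at (f x)) b)"
      unfolding euclidean_representation by (rule ext)
    show ?thesis
      by (rule has_derivative_eq_rhs[OF has_derivative_compose[OF Ck_has_derivative[OF Suc.prems(2) that] gd] eq])
  qed
  show ?case
  proof (rule Ck_SucI[OF S 1])
    fix v
    show "Ck n S (\<lambda>x. \<Sum>b\<in>Basis. (frechet_derivative f (at x) v \<bullet> b) *\<^sub>R frechet_derivative g (at (f x)) b)"
    proof (intro Ck_sum[OF S] Ck_bilinear[OF S bounded_bilinear_scaleR])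
      fix b :: 'b
      show "Ck n S (\<lambda>x. frechet_derivative f (at x) v \<bullet> b)"
        using Suc.prems(2) by (auto intro!: Ck_linear_comp[OF S bounded_linear_inner_left])
      show "Ck n S (\<lambda>x. frechet_derivative g (at (f x)) b)"
        by (rule Suc.IH[of f "\<lambda>y. frechet_derivative g (at y) b"])
          (use Suc.prems Suc.prems(2)[THEN Ck_Suc_imp] in auto)
    qed
  qed auto
qed

lemma Ck_Pair:
  assumes S: "open S" and "Ck n S f" "Ck n S g"
  shows "Ck n S (\<lambda>x. (f x, g x))"
proof -
  have "Ck n S (\<lambda>x. (f x, 0) + (0, g x))"
    by (intro Ck_add[OF S] Ck_linear_comp[OF S _ assms(2), where L="\<lambda>y. (y, 0)"]
        Ck_linear_comp[OF S _ assms(3), where L="\<lambda>y. (0, y)"] bounded_linear_Pair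
        bounded_linear_ident bounded_linear_zero)
  then show ?thesis by simp
qed

section \<open>Closure properties of smooth functions\<close>

lemma smooth_on_subset: "smooth_on S f \<Longrightarrow> T \<subseteq> S \<Longrightarrow> smooth_on T f"
  unfolding smooth_on_def by blast

lemma smooth_on_cong:
  "open S \<Longrightarrow> (\<And>x. x \<in> S \<Longrightarrow> f x = g x) \<Longrightarrow> smooth_on S f \<Longrightarrow> smooth_on S g"
  unfolding smooth_on_iff_Ck by (blast intro: Ck_cong)

lemma smooth_on_local:
  assumes "\<And>x. x \<in> S \<Longrightarrow> \<exists>T. x \<in> T \<and> smooth_on T f"
  shows "smooth_on S f"
  using assms unfolding smooth_on_def by blast

lemma smooth_onI_derivative:
  assumes "open S" "\<And>x. x \<in> S \<Longrightarrow> (f has_derivative D x) (at x)" "\<And>v. smooth_on S (\<lambda>x. D x v)"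
  shows "smooth_on S f"
  unfolding smooth_on_iff_Ck
proof
  fix n show "Ck n S f"
    by (rule CkI[OF assms(1,2)]) (use assms(3) in \<open>auto simp: smooth_on_iff_Ck\<close>)
qed

lemma smooth_on_imp_frechet: "smooth_on S f \<Longrightarrow> smooth_on S (\<lambda>x. frechet_derivative f (at x) v)"
  unfolding smooth_on_iff_Ck by (metis Ck.simps(2))

lemma smooth_on_differentiable: "smooth_on S f \<Longrightarrow> x \<in> S \<Longrightarrow> f differentiable at x"
  unfolding smooth_on_def by (metis dir_deriv.simps(1))

lemma smooth_on_has_derivative:
  "smooth_on S f \<Longrightarrow> x \<in> S \<Longrightarrow> (f has_derivative frechet_derivative f (at x)) (at x)"
  using smooth_on_differentiable frechet_derivative_works by blast

lemma smooth_on_continuous_on: "smooth_on S f \<Longrightarrow> continuous_on S f"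
  by (meson continuous_at_imp_continuous_on differentiable_imp_continuous_within smooth_on_differentiable)

text \<open>A class of functions that is closed under taking directional derivatives consists of
  smooth functions. One guesses a parametrised family containing the function, and only first
  derivatives remain to be computed.\<close>

lemma smooth_on_family:
  assumes S: "open S" and "P f"
    and step: "\<And>f. P f \<Longrightarrow> \<exists>D. (\<forall>x\<in>S. (f has_derivative D x) (at x)) \<and> (\<forall>v. P (\<lambda>x. D x v))"
  shows "smooth_on S f"
proof -
  have "Ck n S f" for n
    using \<open>P f\<close>
  proof (induction n arbitrary: f)
    case 0
    then show ?case using step[OF 0] unfolding Ck.simps differentiable_def by blast
  next
    case (Suc n)
    obtain D where "\<And>x. x \<in> S \<Longrightarrow> (f has_derivative D x) (at x)" "\<And>v. P (\<lambda>x. D x v)"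
      using step[OF Suc.prems] by blast
    then show ?case using Suc.IH by (intro Ck_SucI[OF S]) auto
  qed
  then show ?thesis by (simp add: smooth_on_iff_Ck)
qed

lemma smooth_on_const: "open S \<Longrightarrow> smooth_on S (\<lambda>x. c)"
  by (simp add: smooth_on_iff_Ck Ck_const)

lemma smooth_on_linear: "open S \<Longrightarrow> bounded_linear L \<Longrightarrow> smooth_on S L"
  by (simp add: smooth_on_iff_Ck Ck_bounded_linear)

lemma smooth_on_add: "open S \<Longrightarrow> smooth_on S f \<Longrightarrow> smooth_on S g \<Longrightarrow> smooth_on S (\<lambda>x. f x + g x)"
  by (simp add: smooth_on_iff_Ck Ck_add)

lemma smooth_on_linear_comp:
  "open S \<Longrightarrow> bounded_linear L \<Longrightarrow> smooth_on S f \<Longrightarrow> smooth_on S (\<lambda>x. L (f x))"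
  by (simp add: smooth_on_iff_Ck Ck_linear_comp)

lemma smooth_on_bilinear:
  "open S \<Longrightarrow> bounded_bilinear p \<Longrightarrow> smooth_on S f \<Longrightarrow> smooth_on S g \<Longrightarrow> smooth_on S (\<lambda>x. p (f x) (g x))"
  by (simp add: smooth_on_iff_Ck Ck_bilinear)

lemma smooth_on_minus: "open S \<Longrightarrow> smooth_on S f \<Longrightarrow> smooth_on S (\<lambda>x. - f x)"
  by (rule smooth_on_linear_comp[OF _ bounded_linear_minus[OF bounded_linear_ident]])

lemma smooth_on_diff:
  "open S \<Longrightarrow> smooth_on S f \<Longrightarrow> smooth_on S g \<Longrightarrow> smooth_on S (\<lambda>x. f x - g x)"
  using smooth_on_add[of S f "\<lambda>x. - g x"] smooth_on_minus[of S g] by simp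

lemma smooth_on_mult:
  fixes f g :: "'a::real_normed_vector \<Rightarrow> 'b::real_normed_algebra"
  shows "open S \<Longrightarrow> smooth_on S f \<Longrightarrow> smooth_on S g \<Longrightarrow> smooth_on S (\<lambda>x. f x * g x)"
  by (rule smooth_on_bilinear[OF _ bounded_bilinear_mult])

lemma smooth_on_inner:
  fixes f g :: "'a::real_normed_vector \<Rightarrow> 'b::real_inner"
  shows "open S \<Longrightarrow> smooth_on S f \<Longrightarrow> smooth_on S g \<Longrightarrow> smooth_on S (\<lambda>x. f x \<bullet> g x)"
  by (rule smooth_on_bilinear[OF _ bounded_bilinear_inner])

lemma smooth_on_scaleR:
  "open S \<Longrightarrow> smooth_on S f \<Longrightarrow> smooth_on S g \<Longrightarrow> smooth_on S (\<lambda>x. f x *\<^sub>R g x)"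
  by (rule smooth_on_bilinear[OF _ bounded_bilinear_scaleR])

lemma smooth_on_sum:
  "open S \<Longrightarrow> (\<And>i. i \<in> I \<Longrightarrow> smooth_on S (f i)) \<Longrightarrow> smooth_on S (\<lambda>x. \<Sum>i\<in>I. f i x)"
  by (simp add: smooth_on_iff_Ck Ck_sum)

lemma smooth_on_Pair: "open S \<Longrightarrow> smooth_on S f \<Longrightarrow> smooth_on S g \<Longrightarrow> smooth_on S (\<lambda>x. (f x, g x))"
  by (simp add: smooth_on_iff_Ck Ck_Pair)

lemma smooth_on_compose:
  fixes f :: "'a::real_normed_vector \<Rightarrow> 'b::euclidean_space"
  assumes "open S" "open T" "\<And>x. x \<in> S \<Longrightarrow> f x \<in> T" "smooth_on S f" "smooth_on T g"
  shows "smooth_on S (\<lambda>x. g (f x))"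
  using assms by (simp add: smooth_on_iff_Ck Ck_compose)

text \<open>Differentiation under the integral sign produces an integral of the same kind, with a
  partial derivative of the integrand, so \<open>smooth_on_family\<close> applies to the class of
  all such integrals.\<close>

lemma smooth_on_integral:
  fixes \<Phi> :: "'a::euclidean_space \<times> real \<Rightarrow> 'b::euclidean_space"
  assumes S: "open S" and "smooth_on (S \<times> UNIV) \<Phi>"
  shows "smooth_on S (\<lambda>x. integral {a..b} (\<lambda>s. \<Phi> (x, s)))"
proof (rule smooth_on_family[OF S, where P = "\<lambda>f. \<exists>\<Phi>. smooth_on (S \<times> UNIV) \<Phi> \<and> f = (\<lambda>x. integral {a..b} (\<lambda>s. \<Phi> (x, s)))"])
  fix f :: "'a \<Rightarrow> 'b"
  assume "\<exists>\<Phi>. smooth_on (S \<times> UNIV) \<Phi> \<and> f = (\<lambda>x. integral {a..b} (\<lambda>s. \<Phi> (x, s)))"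
  then obtain \<Phi> where sm: "smooth_on (S \<times> UNIV) \<Phi>"
    and f: "f = (\<lambda>x. integral {a..b} (\<lambda>s. \<Phi> (x, s)))" by blast
  \<comment> \<open>\<open>leibniz_rule\<close> wants the derivative as a continuous map into the
    bounded linear maps; in finite dimension its continuity is checked one direction at a
    time.\<close>
  define D where "D = (\<lambda>x s. Blinfun (\<lambda>v. frechet_derivative \<Phi> (at (x, s)) (v, 0)))"
  have d: "((\<lambda>x. \<Phi> (x, s)) has_derivative (\<lambda>v. frechet_derivative \<Phi> (at (x, s)) (v, 0))) (at x)"
    if "x \<in> S" for x s
    by (rule has_derivative_compose[OF _ smooth_on_has_derivative[OF sm], of "\<lambda>x. (x, s)"])
      (use that in \<open>auto intro!: derivative_eq_intros\<close>)
  have D: "blinfun_apply (D x s) = (\<lambda>v. frechet_derivative \<Phi> (at (x, s)) (v, 0))" if "x \<in> S" for x s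
    unfolding D_def by (rule bounded_linear_Blinfun_apply) (use d[OF that] in blast)
  have cD: "continuous_on (T \<times> cbox a b) (\<lambda>(x, s). D x s)" if "T \<subseteq> S" for T
  proof (rule continuous_on_blinfun_componentwise)
    fix i :: 'a
    have "continuous_on (T \<times> cbox a b) (\<lambda>p. frechet_derivative \<Phi> (at p) (i, 0))"
      by (rule continuous_on_subset[OF smooth_on_continuous_on[OF smooth_on_imp_frechet[OF sm]]])
        (use that in auto)
    then show "continuous_on (T \<times> cbox a b) (\<lambda>x. blinfun_apply (case x of (x, s) \<Rightarrow> D x s) i)"
      by (rule continuous_on_eq) (use that D in auto)
  qed
  have int: "(\<lambda>s. h (x, s)) integrable_on cbox a b" if "continuous_on (S \<times> UNIV) h" "x \<in> S"
    for h :: "'a \<times> real \<Rightarrow> 'c::euclidean_space" and x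
    by (rule integrable_continuous, rule continuous_on_compose2[OF that(1)])
      (use that in \<open>auto intro!: continuous_intros\<close>)
  have "(f has_derivative (\<lambda>v. integral {a..b} (\<lambda>s. frechet_derivative \<Phi> (at (x, s)) (v, 0)))) (at x)"
    if x: "x \<in> S" for x
  proof -
    obtain r where r: "r > 0" "ball x r \<subseteq> S" using S x open_contains_ball by blast
    have "((\<lambda>x. integral (cbox a b) (\<lambda>s. \<Phi> (x, s))) has_derivative
        blinfun_apply (integral (cbox a b) (D x))) (at x within ball x r)"
    proof (rule leibniz_rule)
      show "continuous_on (ball x r \<times> cbox a b) (\<lambda>(x, t). D x t)" using r cD by blast
      show "((\<lambda>x. \<Phi> (x, t)) has_derivative blinfun_apply (D y t)) (at y within ball x r)"
        if "y \<in> ball x r" for y t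
        using that r by (simp add: D d has_derivative_at_withinI subset_iff)
      show "(\<lambda>s. \<Phi> (y, s)) integrable_on cbox a b" if "y \<in> ball x r" for y
        using that r by (intro int[OF smooth_on_continuous_on[OF sm]]) blast
    qed (use r in simp_all)
    moreover have "blinfun_apply (integral (cbox a b) (D x)) =
        (\<lambda>v. integral {a..b} (\<lambda>s. frechet_derivative \<Phi> (at (x, s)) (v, 0)))"
    proof -
      have "continuous_on (cbox a b) (D x)"
        using continuous_on_compose2[OF cD[OF order_refl], of "cbox a b" "Pair x"] x
          continuous_on_Pair[OF continuous_on_const continuous_on_id, of "cbox a b" x]
        by (simp add: image_subset_iff)
      then have "D x integrable_on cbox a b" by (rule integrable_continuous)
      then show ?thesis using D[OF x]
        by (auto simp: blinfun_apply_integral)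
    qed
    moreover have "at x within ball x r = at x"
      using r by (intro at_within_open) auto
    ultimately show ?thesis unfolding f by (simp add: cbox_interval)
  qed
  moreover have "smooth_on (S \<times> UNIV) (\<lambda>p. frechet_derivative \<Phi> (at p) (v, 0))" for v
    by (rule smooth_on_imp_frechet[OF sm])
  ultimately show "\<exists>D. (\<forall>x\<in>S. (f has_derivative D x) (at x)) \<and>
      (\<forall>v. \<exists>\<Phi>. smooth_on (S \<times> UNIV) \<Phi> \<and> (\<lambda>x. D x v) = (\<lambda>x. integral {a..b} (\<lambda>s. \<Phi> (x, s))))"
    by (intro exI[of _ "\<lambda>x v. integral {a..b} (\<lambda>s. frechet_derivative \<Phi> (at (x, s)) (v, 0))"]) auto
qed (use assms in auto)

section \<open>Cutoff functions, square roots and periodization\<close>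

lemma smooth_on_ident: "open S \<Longrightarrow> smooth_on S (\<lambda>x. x)"
  by (rule smooth_on_linear[OF _ bounded_linear_ident])

lemmas smooth_intros = smooth_on_const smooth_on_ident smooth_on_add smooth_on_diff smooth_on_minus
  smooth_on_mult smooth_on_scaleR smooth_on_inner smooth_on_sum smooth_on_Pair

lemma smooth_on_vector_derivativeI:
  assumes "open S" "\<And>x. x \<in> S \<Longrightarrow> (f has_vector_derivative f' x) (at x)" "smooth_on S f'"
  shows "smooth_on S f"
  by (rule smooth_onI_derivative[where D = "\<lambda>x v. v *\<^sub>R f' x"])
    (use assms in \<open>auto simp: has_vector_derivative_def intro: smooth_on_linear_comp[OF _ bounded_linear_scaleR_right]\<close>)

lemma smooth_on_has_vector_derivative:
  assumes "smooth_on S f" "x \<in> S"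
  shows "(f has_vector_derivative frechet_derivative f (at x) 1) (at x)"
  using differentiableI_vector frechet_derivative_works smooth_on_differentiable[OF assms]
  by (metis (no_types) has_derivative_at_withinI vector_derivative_works frechet_derivative_eq_vector_derivative scaleR_one)

text \<open>For a field-differentiable function the derivative in direction v is multiplication of v
  by f', whence the factor v in the closure condition.\<close>

lemma smooth_on_field_family:
  fixes f :: "'a::real_normed_field \<Rightarrow> 'a"
  assumes S: "open S" and "P f"
    and step: "\<And>f. P f \<Longrightarrow> \<exists>f'. (\<forall>x\<in>S. (f has_field_derivative f' x) (at x)) \<and> (\<forall>v. P (\<lambda>x. f' x * v))"
  shows "smooth_on S f"
proof (rule smooth_on_family[where P = P, OF S \<open>P f\<close>])
  fix f assume "P f"
  from step[OF this] obtain f' where "\<forall>x\<in>S. (f has_field_derivative f' x) (at x)" "\<forall>v. P (\<lambda>x. f' x * v)"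
    by blast
  then show "\<exists>D. (\<forall>x\<in>S. (f has_derivative D x) (at x)) \<and> (\<forall>v. P (\<lambda>x. D x v))"
    by (intro exI[of _ "\<lambda>x v. f' x * v"]) (auto simp: has_field_derivative_def)
qed

lemma smooth_on_exp: "smooth_on UNIV (exp :: 'a::{real_normed_field,banach} \<Rightarrow> 'a)"
proof (rule smooth_on_field_family[where P = "\<lambda>f. \<exists>c. f = (\<lambda>z. c * exp z)"])
  fix f :: "'a \<Rightarrow> 'a" assume "\<exists>c. f = (\<lambda>z. c * exp z)"
  then obtain c where f: "f = (\<lambda>z. c * exp z)" by blast
  show "\<exists>f'. (\<forall>x\<in>UNIV. (f has_field_derivative f' x) (at x)) \<and> (\<forall>v. \<exists>c. (\<lambda>x. f' x * v) = (\<lambda>z. c * exp z))"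
    unfolding f
    by (rule exI[of _ "\<lambda>z. c * exp z"]) (auto intro!: derivative_eq_intros exI[of _ "c * _"] simp: ac_simps)
qed (auto intro: exI[of _ 1])

lemma smooth_on_inverse: "smooth_on (- {0}) (inverse :: 'a::real_normed_field \<Rightarrow> 'a)"
proof (rule smooth_on_field_family[where P = "\<lambda>f. \<exists>c n. f = (\<lambda>z. c * inverse z ^ n)"])
  show "\<exists>c n. inverse = (\<lambda>z::'a. c * inverse z ^ n)"
    by (rule exI[of _ 1], rule exI[of _ 1]) auto
  fix f :: "'a \<Rightarrow> 'a" assume "\<exists>c n. f = (\<lambda>z. c * inverse z ^ n)"
  then obtain c n where f: "f = (\<lambda>z. c * inverse z ^ n)" by blast
  have "((\<lambda>z. c * inverse z ^ n) has_field_derivative (- c * of_nat n) * inverse x ^ Suc n) (at x)"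
    if "x \<noteq> 0" for x
    using that by (auto intro!: derivative_eq_intros) (cases n; simp add: power_Suc field_simps)
  then show "\<exists>f'. (\<forall>x\<in>- {0}. (f has_field_derivative f' x) (at x)) \<and>
      (\<forall>v. \<exists>c n. (\<lambda>x. f' x * v) = (\<lambda>z. c * inverse z ^ n))"
    unfolding f
    by (intro exI[of _ "\<lambda>z. (- c * of_nat n) * inverse z ^ Suc n"] conjI allI)
      (auto intro!: exI[of _ "- c * of_nat n * _"] exI[of _ "Suc n"] simp: ac_simps)
qed auto

text \<open>The family c csqrt(z) z^(-n) is closed under differentiation because the derivative of
  the root is csqrt(z) / (2 z).\<close>

lemma smooth_on_csqrt: "smooth_on {z. Re z > 0} csqrt"
proof (rule smooth_on_field_family[where P = "\<lambda>f. \<exists>c n. f = (\<lambda>z. c * csqrt z * inverse z ^ n)"])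
  show "\<exists>c n. csqrt = (\<lambda>z. c * csqrt z * inverse z ^ n)"
    by (rule exI[of _ 1], rule exI[of _ 0]) auto
  show "open {z. Re z > 0}" by (rule open_halfspace_Re_gt)
  fix f :: "complex \<Rightarrow> complex" assume "\<exists>c n. f = (\<lambda>z. c * csqrt z * inverse z ^ n)"
  then obtain c n where f: "f = (\<lambda>z. c * csqrt z * inverse z ^ n)" by blast
  define d where "d = c * (1 / 2 - of_nat n)"
  have "((\<lambda>z. c * csqrt z * inverse z ^ n) has_field_derivative d * csqrt x * inverse x ^ Suc n) (at x)"
    if "Re x > 0" for x
  proof -
    have x: "x \<noteq> 0" "x \<notin> \<real>\<^sub>\<le>\<^sub>0" using that by (auto simp: complex_nonpos_Reals_iff)
    have s: "inverse (2 * csqrt x) = csqrt x * inverse x / 2"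
      using x power2_csqrt[of x] by (simp add: field_simps power2_eq_square)
    have p: "((\<lambda>z. inverse z ^ n) has_field_derivative - of_nat n * inverse x ^ Suc n) (at x)"
      using x by (auto intro!: derivative_eq_intros) (cases n; simp add: power_Suc field_simps)
    have "((\<lambda>z. c * csqrt z) has_field_derivative c * (csqrt x * inverse x / 2)) (at x)"
      using DERIV_cmult[OF has_field_derivative_csqrt[OF x(2)], of c] unfolding s by simp
    from DERIV_mult[OF this p] show ?thesis
      by (rule DERIV_cong) (simp add: d_def algebra_simps)
  qed
  then show "\<exists>f'. (\<forall>x\<in>{z. Re z > 0}. (f has_field_derivative f' x) (at x)) \<and>
      (\<forall>v. \<exists>c n. (\<lambda>x. f' x * v) = (\<lambda>z. c * csqrt z * inverse z ^ n))"
    unfolding f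
    by (intro exI[of _ "\<lambda>z. d * csqrt z * inverse z ^ Suc n"] conjI allI)
      (auto intro!: exI[of _ "d * _"] exI[of _ "Suc n"] simp: ac_simps)
qed

section \<open>A smooth step function built from exp(-1/r)\<close>

definition flat :: "nat \<Rightarrow> real \<Rightarrow> real" where
  "flat n r = (if r > 0 then inverse r ^ n * exp (- inverse r) else 0)"

text \<open>With x = 1/r and m = n + 2, raising x/m <= exp(x/m) to the power m gives x^m exp(-x) <=
  m^m. The two extra powers of x leave the factor r^2, which makes the difference quotient at 0
  vanish in the limit.\<close>

lemma flat_bound: "\<bar>flat n r\<bar> \<le> real (n + 2) ^ (n + 2) * r\<^sup>2"
proof (cases "r > 0")
  case True
  define m where "m = n + 2"
  define x where "x = inverse r"
  have x: "x > 0" using True by (simp add: x_def)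
  have m: "real m > 0" by (simp add: m_def)
  have "x / real m \<le> exp (x / real m)" using exp_ge_add_one_self[of "x / real m"] by linarith
  then have "(x / real m) ^ m \<le> exp (x / real m) ^ m" using x m by (intro power_mono) auto
  also have "\<dots> = exp x" using m by (simp flip: exp_of_nat_mult)
  finally have "x ^ m * exp (- x) \<le> real m ^ m" using m
    by (simp add: power_divide field_simps exp_minus)
  moreover have "flat n r = x ^ m * exp (- x) * r\<^sup>2"
    using True by (simp add: flat_def x_def m_def power_add power_inverse field_simps power2_eq_square)
  ultimately show ?thesis using x by (simp add: abs_mult mult_right_mono m_def)
qed (simp add: flat_def)

lemma flat_deriv: "(flat n has_real_derivative flat (n + 2) r - real n * flat (n + 1) r) (at r)"
proof -
  consider "r > 0" | "r < 0" | "r = 0" by linarith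
  then show ?thesis
  proof cases
    case 1
    have "((\<lambda>r. inverse r ^ n * exp (- inverse r)) has_real_derivative flat (n + 2) r - real n * flat (n + 1) r) (at r)"
      using 1 by (auto intro!: derivative_eq_intros simp: flat_def)
        (cases n; simp add: power_Suc field_simps power2_eq_square)
    then show ?thesis
      by (rule has_field_derivative_transform_within_open[where S = "{0<..}"]) (use 1 in \<open>auto simp: flat_def\<close>)
  next
    case 2
    have "((\<lambda>r::real. 0::real) has_real_derivative flat (n + 2) r - real n * flat (n + 1) r) (at r)"
      using 2 by (auto intro!: derivative_eq_intros simp: flat_def)
    then show ?thesis
      by (rule has_field_derivative_transform_within_open[where S = "{..<0}"]) (use 2 in \<open>auto simp: flat_def\<close>)
  next
    case 3
    have "((\<lambda>y. (flat n y - flat n 0) / (y - 0)) \<longlongrightarrow> 0) (at 0)"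
    proof (rule Lim_null_comparison)
      show "\<forall>\<^sub>F y in at 0. norm ((flat n y - flat n 0) / (y - 0)) \<le> real (n + 2) ^ (n + 2) * \<bar>y\<bar>"
        unfolding eventually_at
      proof (intro exI[of _ 1] conjI ballI impI)
        fix y :: real assume "y \<noteq> 0 \<and> dist y 0 < 1"
        then show "norm ((flat n y - flat n 0) / (y - 0)) \<le> real (n + 2) ^ (n + 2) * \<bar>y\<bar>"
          using flat_bound[of n y] by (simp add: flat_def[of n 0] abs_divide divide_le_eq power2_eq_square mult.assoc)
      qed simp
      show "((\<lambda>y. real (n + 2) ^ (n + 2) * \<bar>y\<bar>) \<longlongrightarrow> 0) (at 0)"
        by (auto intro!: tendsto_eq_intros)
    qed
    then show ?thesis using 3 by (simp add: has_field_derivative_iff flat_def)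
  qed
qed

lemma smooth_on_flat: "smooth_on UNIV (flat n)"
proof -
  have "Ck k UNIV (flat n)" for k
  proof (induction k arbitrary: n)
    case (Suc k)
    show ?case
    proof (rule Ck_SucI)
      show "(flat n has_derivative (\<lambda>v. (flat (n + 2) x + (- real n) * flat (n + 1) x) * v)) (at x)" for x
        using flat_deriv[of n x] by (simp add: has_field_derivative_def)
      show "Ck k UNIV (\<lambda>x. (flat (n + 2) x + (- real n) * flat (n + 1) x) * v)" for v
        by (intro Ck_linear_comp[OF open_UNIV bounded_linear_mult_left] Ck_add
            Ck_linear_comp[OF open_UNIV bounded_linear_mult_right] Suc open_UNIV)
    qed simp
  qed (use flat_deriv in \<open>auto simp: real_differentiable_def differentiable_def has_field_derivative_def\<close>)
  then show ?thesis by (simp add: smooth_on_iff_Ck)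
qed

text \<open>At least one of r and 1 - r is positive, so the denominator never vanishes.\<close>

definition smooth_step :: "real \<Rightarrow> real" where
  "smooth_step r = flat 0 r * inverse (flat 0 r + flat 0 (1 - r))"

lemma smooth_on_smooth_step: "smooth_on UNIV smooth_step"
proof -
  have a: "smooth_on UNIV (\<lambda>r. flat 0 (1 - r))"
    by (rule smooth_on_compose[OF open_UNIV open_UNIV _ smooth_on_diff[OF open_UNIV
          smooth_on_const[OF open_UNIV] smooth_on_linear[OF open_UNIV bounded_linear_ident]] smooth_on_flat]) auto
  have "smooth_on UNIV (\<lambda>r. inverse (flat 0 r + flat 0 (1 - r)))"
  proof (rule smooth_on_compose[OF open_UNIV _ _ _ smooth_on_inverse])
    show "flat 0 x + flat 0 (1 - x) \<in> - {0}" for x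
      by (auto simp: flat_def add_nonneg_eq_0_iff)
  qed (auto intro: smooth_on_add smooth_on_flat a)
  then show ?thesis unfolding smooth_step_def by (intro smooth_on_mult smooth_on_flat) auto
qed

lemma smooth_step_simps:
  "r \<le> 0 \<Longrightarrow> smooth_step r = 0" "r \<ge> 1 \<Longrightarrow> smooth_step r = 1" "r > 0 \<Longrightarrow> smooth_step r > 0"
  "0 \<le> smooth_step r" "smooth_step r \<le> 1"
proof -
  have p: "flat 0 r \<ge> 0" for r by (simp add: flat_def)
  show "r \<le> 0 \<Longrightarrow> smooth_step r = 0" "r \<ge> 1 \<Longrightarrow> smooth_step r = 1" by (auto simp: smooth_step_def flat_def)
  show "r > 0 \<Longrightarrow> smooth_step r > 0" using p[of "1 - r"]
    by (auto simp: smooth_step_def flat_def[of _ r] intro!: mult_pos_pos add_pos_nonneg)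
  show "0 \<le> smooth_step r" "smooth_step r \<le> 1"
    using p[of r] p[of "1 - r"] by (auto simp: smooth_step_def field_simps divide_le_eq)
qed

text \<open>The composition lemmas want a function that is smooth on the whole plane, while the
  principal root is smooth only off the closed negative axis. The cutoff is 0 up to Re z =
  \<delta>/2 and 1 from Re z = \<delta> on.\<close>

definition csqrt_cut :: "real \<Rightarrow> complex \<Rightarrow> complex" where
  "csqrt_cut \<delta> z = smooth_step (2 * Re z / \<delta> - 1) *\<^sub>R csqrt z"

lemma csqrt_cut_eq: "\<delta> > 0 \<Longrightarrow> Re z \<ge> \<delta> \<Longrightarrow> csqrt_cut \<delta> z = csqrt z"
  unfolding csqrt_cut_def by (subst smooth_step_simps(2)) (auto simp: field_simps)

lemma smooth_on_csqrt_cut: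
  assumes "\<delta> > 0" shows "smooth_on UNIV (csqrt_cut \<delta>)"
proof (rule smooth_on_local)
  fix z :: complex
  have o: "open {z. Re z > 0}" by (rule open_halfspace_Re_gt)
  have lin: "smooth_on S (\<lambda>z. 2 * Re z / \<delta> - 1)" if "open S" for S
    by (rule smooth_on_diff[OF that smooth_on_linear[OF that] smooth_on_const[OF that]])
      (auto intro!: bounded_linear_intros bounded_linear_Re simp: divide_inverse)
  show "\<exists>T. z \<in> T \<and> smooth_on T (csqrt_cut \<delta>)"
  proof (cases "Re z > 0")
    case True
    have "smooth_on {z. Re z > 0} (csqrt_cut \<delta>)" unfolding csqrt_cut_def[abs_def]
      by (rule smooth_on_scaleR[OF o smooth_on_compose[OF o open_UNIV _ lin[OF o] smooth_on_smooth_step] smooth_on_csqrt]) auto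
    then show ?thesis using True by (intro exI[of _ "{z. Re z > 0}"]) simp
  next
    case False
    have o2: "open {z. Re z < \<delta> / 2}" by (rule open_halfspace_Re_lt)
    have "smooth_on {z. Re z < \<delta> / 2} (csqrt_cut \<delta>)"
      by (rule smooth_on_cong[OF o2 _ smooth_on_const[OF o2, of 0]])
        (use assms in \<open>auto simp: csqrt_cut_def smooth_step_simps(1) field_simps\<close>)
    then show ?thesis using False assms by (intro exI[of _ "{z. Re z < \<delta> / 2}"]) auto
  qed
qed

section \<open>Periodization of functions supported inside one period\<close>

lemma periodic_int:
  assumes "\<And>t. h (t + 2 * pi) = h t"
  shows "h (t - 2 * pi * of_int n) = h t"
proof -
  have *: "h (t + 2 * pi * real m) = h t" for t m
    by (induction m) (use assms[of "t + 2 * pi * real _"] in \<open>auto simp: algebra_simps\<close>)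
  show ?thesis
    using *[of t "nat (- n)"] *[of "t - 2 * pi * of_int n" "nat n"] by (cases "n \<ge> 0") auto
qed

definition periodize :: "real \<Rightarrow> (real \<Rightarrow> 'b) \<Rightarrow> real \<Rightarrow> 'b" where
  "periodize p f t = f (t - 2 * pi * of_int \<lfloor>(t - p) / (2 * pi)\<rfloor>)"

lemma periodize_point:
  obtains n :: int where "p \<le> t - 2 * pi * of_int n" "t - 2 * pi * of_int n < p + 2 * pi"
    "periodize p f t = f (t - 2 * pi * of_int n)" "n = \<lfloor>(t - p) / (2 * pi)\<rfloor>"
proof
  define n where "n = \<lfloor>(t - p) / (2 * pi)\<rfloor>"
  have "of_int n \<le> (t - p) / (2 * pi)" "(t - p) / (2 * pi) < of_int n + 1" by (auto simp: n_def)
  then show "p \<le> t - 2 * pi * of_int n" "t - 2 * pi * of_int n < p + 2 * pi"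
    by (auto simp: field_simps)
  show "periodize p f t = f (t - 2 * pi * of_int n)" by (simp add: periodize_def n_def)
qed (rule refl)

lemma periodize_eq:
  assumes "p \<le> t - 2 * pi * of_int n" "t - 2 * pi * of_int n < p + 2 * pi"
  shows "periodize p f t = f (t - 2 * pi * of_int n)"
proof -
  have "\<lfloor>(t - p) / (2 * pi)\<rfloor> = n"
    by (rule floor_unique) (use assms in \<open>auto simp: field_simps\<close>)
  then show ?thesis by (simp add: periodize_def)
qed

text \<open>Beyond an end of the window the formula changes to the neighbouring translate, but the
  support stays away from both ends, so near them both translates vanish and one translate describes
  the periodization on a neighbourhood.\<close>

lemma periodize_local:
  assumes f0: "\<And>t. t < l \<or> t > u \<Longrightarrow> f t = 0" and "p < l" "u < p + 2 * pi"
    and n: "p \<le> t - 2 * pi * of_int n" "t - 2 * pi * of_int n < p + 2 * pi"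
  shows "\<exists>T. open T \<and> t \<in> T \<and> (\<forall>y\<in>T. periodize p f y = f (y - 2 * pi * of_int n))"
proof (intro exI conjI ballI)
  \<comment> \<open>The bound pi keeps the neighbourhood from reaching beyond the adjacent window;
    the other two keep it inside the zero set of \<open>f\<close> once it crosses an end.\<close>
  define e where "e = min (min (l - p) (p + 2 * pi - u)) pi"
  show "open (ball t e)" "t \<in> ball t e" using assms by (auto simp: e_def)
  fix y assume "y \<in> ball t e"
  then have y: "\<bar>y - t\<bar> < e" by (simp add: dist_real_def abs_minus_commute)
  define y' where "y' = y - 2 * pi * of_int n"
  have y': "p - e < y'" "y' < p + 2 * pi + e" using y n by (auto simp: y'_def abs_less_iff)
  have e: "e \<le> l - p" "e \<le> p + 2 * pi - u" "e \<le> pi" by (auto simp: e_def)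
  consider "y' < p" | "p \<le> y'" "y' < p + 2 * pi" | "p + 2 * pi \<le> y'" by linarith
  then show "periodize p f y = f (y - 2 * pi * of_int n)"
  proof cases
    case 1
    have "periodize p f y = f (y - 2 * pi * of_int (n - 1))"
      using 1 y' e pi_gt_zero by (intro periodize_eq) (auto simp: y'_def algebra_simps)
    also have "\<dots> = 0" using y' e by (intro f0) (auto simp: y'_def algebra_simps)
    finally show ?thesis using f0[of y'] 1 assms(2) by (simp add: y'_def)
  next
    case 2
    then show ?thesis by (intro periodize_eq) (auto simp: y'_def)
  next
    case 3
    have "periodize p f y = f (y - 2 * pi * of_int (n + 1))"
      using 3 y' e pi_gt_zero by (intro periodize_eq) (auto simp: y'_def algebra_simps)
    also have "\<dots> = 0" using y' e by (intro f0) (auto simp: y'_def algebra_simps)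
    finally show ?thesis using f0[of y'] 3 assms(3) by (simp add: y'_def)
  qed
qed

lemma periodize_has_vector_derivative:
  assumes "\<And>t. t < l \<or> t > u \<Longrightarrow> f t = 0" "p < l" "u < p + 2 * pi"
    and n: "p \<le> t - 2 * pi * of_int n" "t - 2 * pi * of_int n < p + 2 * pi"
    and D: "(f has_vector_derivative D) (at (t - 2 * pi * of_int n))"
  shows "(periodize p f has_vector_derivative D) (at t)"
proof -
  obtain T where T: "open T" "t \<in> T" "\<And>y. y \<in> T \<Longrightarrow> periodize p f y = f (y - 2 * pi * of_int n)"
    using periodize_local[where f = f, OF assms(1-3) n] by auto
  have "((\<lambda>y. f (y - 2 * pi * of_int n)) has_vector_derivative 1 *\<^sub>R D) (at t)"
    by (rule vector_diff_chain_at[of "\<lambda>y. y - 2 * pi * of_int n" 1 t f D, unfolded o_def])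
      (use D in \<open>auto intro!: derivative_eq_intros\<close>)
  then have "((\<lambda>y. f (y - 2 * pi * of_int n)) has_vector_derivative D) (at t)" by simp
  then show ?thesis
    by (rule has_vector_derivative_transform_within_open[OF _ T(1,2)]) (simp add: T(3))
qed

lemma circle_smooth_periodize:
  assumes f0: "\<And>t. t < l \<or> t > u \<Longrightarrow> f t = 0" and "p < l" "u < p + 2 * pi" and sm: "smooth_on UNIV f"
  shows "circle_smooth (periodize p f)"
  unfolding circle_smooth_def
proof (intro conjI allI)
  show "smooth_on UNIV (periodize p f)"
  proof (rule smooth_on_local)
    fix t
    obtain n where n: "p \<le> t - 2 * pi * of_int n" "t - 2 * pi * of_int n < p + 2 * pi"
      by (rule periodize_point[of p t])
    obtain T where T: "open T" "t \<in> T" "\<And>y. y \<in> T \<Longrightarrow> periodize p f y = f (y - 2 * pi * of_int n)"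
      using periodize_local[where f = f, OF assms(1-3) n] by auto
    have "smooth_on T (\<lambda>y. f (y - 2 * pi * of_int n))"
      by (rule smooth_on_compose[OF T(1) open_UNIV _ _ sm])
        (auto intro!: smooth_intros T)
    then have "smooth_on T (periodize p f)"
      by (rule smooth_on_cong[OF T(1), rotated]) (simp add: T)
    then show "\<exists>T. t \<in> T \<and> smooth_on T (periodize p f)" using T(2) by (intro exI[of _ T]) simp
  qed
  fix t
  obtain n where n: "p \<le> t - 2 * pi * of_int n" "t - 2 * pi * of_int n < p + 2 * pi"
    by (rule periodize_point[of p t])
  then have "periodize p f (t + 2 * pi) = f (t + 2 * pi - 2 * pi * of_int (n + 1))"
    by (intro periodize_eq) (auto simp: algebra_simps)
  also have "\<dots> = periodize p f t" using periodize_eq[OF n, of f] by (simp add: algebra_simps)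
  finally show "periodize p f (t + 2 * pi) = periodize p f t" .
qed

lemma smooth_on_step_affine:
  fixes f :: "real \<Rightarrow> real"
  shows "smooth_on UNIV (\<lambda>t. smooth_step ((t - a) * c))" "smooth_on UNIV (\<lambda>t. smooth_step ((a - t) * c))"
  by (rule smooth_on_compose[OF open_UNIV open_UNIV _ _ smooth_on_smooth_step]; auto intro!: smooth_intros)+

text \<open>Neither a0 (t - t0) nor B - B(t0) is periodic. \<alpha> and \<beta> are periodic
  substitutes with the correct derivatives wherever \<open>E\<close> is nonzero, which is all that
  the transport equation uses, and \<beta> stays nonnegative everywhere. \<open>E\<close> combines
  the cutoff with exp(-q t), a solution of E' + q E = 0, so that this expression can be nonzero only
  where the cutoff varies.\<close>

lemma cutoff_data:
  fixes b :: "real \<Rightarrow> real" and q :: complex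
  assumes b: "circle_smooth b" and neg: "b s\<^sub>1 < 0" and pos: "b s\<^sub>2 > 0"
  obtains \<alpha> \<beta> :: "real \<Rightarrow> real" and E :: "real \<Rightarrow> complex" and t\<^sub>0 \<delta> :: real
  where "circle_smooth \<alpha>" "circle_smooth \<beta>" "circle_smooth E" "\<delta> > 0" "\<And>t. \<beta> t \<ge> 0"
    "\<beta> t\<^sub>0 = 0" "\<alpha> t\<^sub>0 = 0" "E t\<^sub>0 \<noteq> 0"
    "\<And>t. E t \<noteq> 0 \<Longrightarrow> (\<alpha> has_vector_derivative a\<^sub>0) (at t)"
    "\<And>t. E t \<noteq> 0 \<Longrightarrow> (\<beta> has_vector_derivative b t) (at t)"
    "\<And>t. vector_derivative E (at t) + q * E t \<noteq> 0 \<Longrightarrow> \<delta> \<le> \<beta> t"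
proof -
  have bsm: "smooth_on UNIV b" and bper: "\<And>t. b (t + 2 * pi) = b t"
    using b by (auto simp: circle_smooth_def)
  have bper_n: "b (t - 2 * pi * of_int n) = b t" for t n
    by (rule periodic_int[where h = b, OF bper])
  \<comment> \<open>Translating \<open>s\<^sub>2\<close> by whole periods preserves the value of
    \<open>b\<close> and puts the point within one period to the right of \<open>s\<^sub>1\<close>;
    the opposite signs exclude equality.\<close>
  obtain n where n: "s\<^sub>1 \<le> s\<^sub>2 - 2 * pi * of_int n" "s\<^sub>2 - 2 * pi * of_int n < s\<^sub>1 + 2 * pi"
    by (rule periodize_point[of s\<^sub>1 s\<^sub>2])
  define s where "s = s\<^sub>2 - 2 * pi * of_int n"
  have bs: "b s > 0" using pos by (simp add: s_def bper_n)
  have s: "s\<^sub>1 < s" "s < s\<^sub>1 + 2 * pi" using n bs neg by (auto simp: s_def less_le)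
  \<comment> \<open>The primitive has to be smooth around the whole interval including the fringes
    of width \<open>e\<close> <= 1 added below; 7 is a generous margin.\<close>
  define l r where "l = s\<^sub>1 - 7" and "r = s\<^sub>1 + 2 * pi + 7"
  define B where "B u = integral {l..u} b" for u
  have bc: "continuous_on T b" for T
    using smooth_on_continuous_on[OF bsm] continuous_on_subset by blast
  have Bd: "(B has_real_derivative b u) (at u)" if "l < u" "u < r" for u
  proof -
    have "(B has_real_derivative b u) (at u within {l..r})"
      unfolding B_def by (rule integral_has_real_derivative[OF bc]) (use that in auto)
    then show ?thesis using that by (simp add: at_within_Icc_at)
  qed
  have Bsm: "smooth_on {l<..<r} B"
    by (rule smooth_on_vector_derivativeI[OF _ _ smooth_on_subset[OF bsm]])
      (use Bd in \<open>auto simp: has_real_derivative_iff_has_vector_derivative\<close>)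
  have Bcont: "continuous_on {s\<^sub>1..s} B"
    by (rule continuous_on_subset[OF smooth_on_continuous_on[OF Bsm]])
      (use s pi_gt_zero in \<open>auto simp: l_def r_def\<close>)
  obtain t\<^sub>0 where t0: "t\<^sub>0 \<in> {s\<^sub>1..s}" "\<And>y. y \<in> {s\<^sub>1..s} \<Longrightarrow> B t\<^sub>0 \<le> B y"
    using continuous_attains_inf[OF _ _ Bcont] s by auto
  have inl: "l < s\<^sub>1" "s\<^sub>1 < r" "l < s" "s < r" using s pi_gt_zero by (auto simp: l_def r_def)
  have m1: "B t\<^sub>0 < B s\<^sub>1"
  proof -
    obtain d where d: "d > 0" "\<And>h. h > 0 \<Longrightarrow> h < d \<Longrightarrow> B (s\<^sub>1 + h) < B s\<^sub>1"
      using DERIV_neg_dec_right[OF Bd[OF inl(1,2)] neg] by blast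
    define h where "h = min (d / 2) (s - s\<^sub>1)"
    have "B (s\<^sub>1 + h) < B s\<^sub>1" using d s by (intro d(2)) (auto simp: h_def)
    moreover have "B t\<^sub>0 \<le> B (s\<^sub>1 + h)" using d s by (intro t0(2)) (auto simp: h_def)
    ultimately show ?thesis by linarith
  qed
  have m2: "B t\<^sub>0 < B s"
  proof -
    obtain d where d: "d > 0" "\<And>h. h > 0 \<Longrightarrow> h < d \<Longrightarrow> B (s - h) < B s"
      using DERIV_pos_inc_left[OF Bd[OF inl(3,4)] bs] by blast
    define h where "h = min (d / 2) (s - s\<^sub>1)"
    have "B (s - h) < B s" using d s by (intro d(2)) (auto simp: h_def)
    moreover have "B t\<^sub>0 \<le> B (s - h)" using d s by (intro t0(2)) (auto simp: h_def)
    ultimately show ?thesis by linarith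
  qed
  have t0': "s\<^sub>1 < t\<^sub>0" "t\<^sub>0 < s" using t0(1) m1 m2 by (auto simp: less_le)
  \<comment> \<open>Half of the smaller excess of \<open>B\<close> over its minimum: the bound is
    then strict at both ends and persists in neighbourhoods of them.\<close>
  define \<delta> where "\<delta> = min (B s\<^sub>1 - B t\<^sub>0) (B s - B t\<^sub>0) / 2"
  have \<delta>: "\<delta> > 0" using m1 m2 by (simp add: \<delta>_def)
  have near: "\<exists>d>0. \<forall>y. \<bar>y - x\<bar> \<le> d \<longrightarrow> B t\<^sub>0 + \<delta> \<le> B y" if "l < x" "x < r" "B t\<^sub>0 + \<delta> < B x" for x
  proof -
    have "isCont B x" using Bd[OF that(1,2)] DERIV_isCont by blast
    then have "\<forall>\<^sub>F y in at x. B y > B t\<^sub>0 + \<delta>"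
      using that(3) order_tendstoD(1) unfolding isCont_def by blast
    then obtain d where d: "d > 0" "\<And>y. y \<noteq> x \<Longrightarrow> dist y x < d \<Longrightarrow> B y > B t\<^sub>0 + \<delta>"
      unfolding eventually_at by auto
    have "B t\<^sub>0 + \<delta> \<le> B y" if y: "\<bar>y - x\<bar> \<le> d / 2" for y
      using d(2)[of y] d(1) y \<open>B t\<^sub>0 + \<delta> < B x\<close> by (cases "y = x") (auto simp: dist_real_def)
    then show ?thesis using d(1) by (intro exI[of _ "d / 2"]) auto
  qed
  have lt: "B t\<^sub>0 + \<delta> < B s\<^sub>1" "B t\<^sub>0 + \<delta> < B s" using m1 m2 by (auto simp: \<delta>_def min_def field_simps)
  obtain d1 where d1: "d1 > 0" "\<And>y. \<bar>y - s\<^sub>1\<bar> \<le> d1 \<Longrightarrow> B t\<^sub>0 + \<delta> \<le> B y"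
    using near[OF inl(1,2) lt(1)] by blast
  obtain d2 where d2: "d2 > 0" "\<And>y. \<bar>y - s\<bar> \<le> d2 \<Longrightarrow> B t\<^sub>0 + \<delta> \<le> B y"
    using near[OF inl(3,4) lt(2)] by blast
  \<comment> \<open>The bounds on \<open>e\<close>: 1 stays inside the margin; \<open>d1\<close> and
    \<open>d2\<close> keep the transition zones where \<open>B\<close> exceeds its minimum by
    \<delta>; a quarter of the gap to the next period makes the enlarged interval fit strictly into
    the window starting at \<open>p\<close>; a quarter of the length keeps the inner zones inside
    the interval.\<close>
  define M where "M = {1, d1, d2, (s\<^sub>1 + 2 * pi - s) / 4, (s - s\<^sub>1) / 4}"
  define e where "e = Min M"
  have le: "e \<le> x" if "x \<in> M" for x using that unfolding e_def by (intro Min_le) (auto simp: M_def)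
  have e: "e \<le> d1" "e \<le> d2" "e \<le> (s\<^sub>1 + 2 * pi - s) / 4" "e \<le> 1" "e \<le> (s - s\<^sub>1) / 4"
    by (rule le; simp add: M_def)+
  have epos: "e > 0" unfolding e_def M_def using d1(1) d2(1) s by (subst Min_gr_iff) auto
  note e = epos e
  define p where "p = s\<^sub>1 - 2 * e"
  \<comment> \<open>Two nested cutoffs: \<open>c\<close> is supported in the interval and
    \<open>w\<close> is 1 on all of it, so the truncation by \<open>w\<close> does not affect the
    derivatives of \<alpha> and \<beta> on the support of \<open>E\<close>.\<close>
  define w where "w t = smooth_step ((t - (s\<^sub>1 - e)) * inverse e) * smooth_step (((s + e) - t) * inverse e)" for t
  define c where "c t = smooth_step ((t - s\<^sub>1) * inverse e) * smooth_step ((s - t) * inverse e)" for t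
  have win: "p < s\<^sub>1 - e" "s + e < p + 2 * pi" "p < s\<^sub>1" "s < p + 2 * pi" using e by (auto simp: p_def)
  have w0: "w t = 0" if "t < s\<^sub>1 - e \<or> t > s + e" for t
    using that e(1) unfolding w_def by (auto intro!: smooth_step_simps(1) mult_nonpos_nonneg)
  have w1: "w t = 1" if "s\<^sub>1 \<le> t" "t \<le> s" for t
    using that e(1) unfolding w_def by (subst (1 2) smooth_step_simps(2)) (auto simp: field_simps)
  have w_nonneg: "w t \<ge> 0" for t by (simp add: w_def smooth_step_simps)
  have c0: "c t = 0" if "t \<le> s\<^sub>1 \<or> t \<ge> s" for t
    using that e(1) unfolding c_def by (auto intro!: smooth_step_simps(1) mult_nonpos_nonneg)
  have c1: "c t = 1" if "s\<^sub>1 + e \<le> t" "t \<le> s - e" for t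
    using that e(1) unfolding c_def by (subst (1 2) smooth_step_simps(2)) (auto simp: field_simps)
  have wsm: "smooth_on UNIV w" and csm: "smooth_on UNIV c"
    unfolding w_def c_def by (intro smooth_on_mult smooth_on_step_affine open_UNIV)+
  define f\<^sub>\<alpha> f\<^sub>\<beta> where "f\<^sub>\<alpha> t = w t * (a\<^sub>0 * (t - t\<^sub>0))" and "f\<^sub>\<beta> t = w t * (B t - B t\<^sub>0)" for t
  define f\<^sub>E where "f\<^sub>E t = complex_of_real (c t) * exp (- q * complex_of_real t)" for t
  have sm\<alpha>: "smooth_on UNIV f\<^sub>\<alpha>"
    unfolding f\<^sub>\<alpha>_def by (intro smooth_intros wsm open_UNIV)
  have sm\<beta>: "smooth_on UNIV f\<^sub>\<beta>"
  proof (rule smooth_on_local)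
    fix t :: real
    consider "l < t \<and> t < r" | "t < s\<^sub>1 - e" | "t > s + e" using inl e by (fastforce simp: l_def r_def)
    then show "\<exists>T. t \<in> T \<and> smooth_on T f\<^sub>\<beta>"
    proof cases
      case 1
      have "smooth_on {l<..<r} f\<^sub>\<beta>" unfolding f\<^sub>\<beta>_def
        by (intro smooth_intros Bsm smooth_on_subset[OF wsm]) auto
      then show ?thesis using 1 by (intro exI[of _ "{l<..<r}"]) auto
    next
      case 2
      have "smooth_on {..<s\<^sub>1 - e} f\<^sub>\<beta>"
        by (rule smooth_on_cong[OF _ _ smooth_on_const[of _ 0]]) (auto simp: f\<^sub>\<beta>_def w0)
      then show ?thesis using 2 by (intro exI[of _ "{..<s\<^sub>1 - e}"]) auto
    next
      case 3
      have "smooth_on {s + e<..} f\<^sub>\<beta>"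
        by (rule smooth_on_cong[OF _ _ smooth_on_const[of _ 0]]) (auto simp: f\<^sub>\<beta>_def w0)
      then show ?thesis using 3 by (intro exI[of _ "{s + e<..}"]) auto
    qed
  qed
  have smE: "smooth_on UNIV f\<^sub>E"
    unfolding f\<^sub>E_def
    by (intro smooth_on_mult smooth_on_linear_comp[OF _ bounded_linear_of_real csm] open_UNIV
        smooth_on_compose[OF open_UNIV open_UNIV _ _ smooth_on_exp] smooth_intros
        smooth_on_linear[OF _ bounded_linear_of_real]) auto
  define \<alpha> \<beta> E where "\<alpha> = periodize p f\<^sub>\<alpha>" and "\<beta> = periodize p f\<^sub>\<beta>" and "E = periodize p f\<^sub>E"
  have z\<alpha>: "t < s\<^sub>1 - e \<or> t > s + e \<Longrightarrow> f\<^sub>\<alpha> t = 0" for t by (simp add: f\<^sub>\<alpha>_def w0)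
  have z\<beta>: "t < s\<^sub>1 - e \<or> t > s + e \<Longrightarrow> f\<^sub>\<beta> t = 0" for t by (simp add: f\<^sub>\<beta>_def w0)
  have zE: "t < s\<^sub>1 \<or> t > s \<Longrightarrow> f\<^sub>E t = 0" for t by (auto simp: f\<^sub>E_def c0)
  have t00: "p \<le> t\<^sub>0 - 2 * pi * of_int 0" "t\<^sub>0 - 2 * pi * of_int 0 < p + 2 * pi"
    using t0' win by auto
  have f\<^sub>\<beta>_nonneg: "f\<^sub>\<beta> t \<ge> 0" for t
  proof (cases "t < s\<^sub>1 - e \<or> t > s + e")
    case False
    \<comment> \<open>In the fringes outside the interval minimality of \<open>t\<^sub>0\<close>
      says nothing; there the neighbourhoods \<open>d1\<close> and \<open>d2\<close> of the ends
      give the sign.\<close>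
    then consider "\<bar>t - s\<^sub>1\<bar> \<le> e" | "\<bar>t - s\<bar> \<le> e" | "t \<in> {s\<^sub>1..s}" by fastforce
    then have "B t\<^sub>0 \<le> B t"
      using t0(2)[of t] d1(2)[of t] d2(2)[of t] e \<delta> by cases auto
    then show ?thesis using w_nonneg[of t] by (simp add: f\<^sub>\<beta>_def)
  qed (simp add: z\<beta>)
  show thesis
  proof
    show "circle_smooth \<alpha>" unfolding \<alpha>_def by (rule circle_smooth_periodize[OF z\<alpha> win(1,2) sm\<alpha>])
    show "circle_smooth \<beta>" unfolding \<beta>_def by (rule circle_smooth_periodize[OF z\<beta> win(1,2) sm\<beta>])
    show "circle_smooth E" unfolding E_def by (rule circle_smooth_periodize[OF zE win(3,4) smE])
    show "\<delta> > 0" by (rule \<delta>)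
    show "\<beta> t \<ge> 0" for t by (simp add: \<beta>_def periodize_def f\<^sub>\<beta>_nonneg)
    show "\<beta> t\<^sub>0 = 0" "\<alpha> t\<^sub>0 = 0"
      using periodize_eq[OF t00, of f\<^sub>\<alpha>] periodize_eq[OF t00, of f\<^sub>\<beta>] by (simp_all add: \<alpha>_def \<beta>_def f\<^sub>\<alpha>_def f\<^sub>\<beta>_def)
    have "c t\<^sub>0 > 0" using t0' e(1) unfolding c_def by (intro mult_pos_pos smooth_step_simps(3)) auto
    then show "E t\<^sub>0 \<noteq> 0" using periodize_eq[OF t00, of f\<^sub>E] by (simp add: E_def f\<^sub>E_def)
    fix t
    obtain n where n: "p \<le> t - 2 * pi * of_int n" "t - 2 * pi * of_int n < p + 2 * pi"
      by (rule periodize_point[of p t])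
    define y where "y = t - 2 * pi * of_int n"
    note eqs = periodize_eq[OF n, folded y_def]
    {
      assume "E t \<noteq> 0"
      then have "f\<^sub>E y \<noteq> 0" by (simp add: E_def eqs)
      then have y: "s\<^sub>1 < y" "y < s" using c0[of y] by (auto simp: f\<^sub>E_def simp flip: not_le)
      have lin: "((\<lambda>t. a\<^sub>0 * (t - t\<^sub>0)) has_vector_derivative a\<^sub>0) (at y)"
        unfolding has_real_derivative_iff_has_vector_derivative[symmetric]
        by (auto intro!: derivative_eq_intros)
      have "(f\<^sub>\<alpha> has_vector_derivative a\<^sub>0) (at y)"
        by (rule has_vector_derivative_transform_within_open[OF lin, of "{s\<^sub>1<..<s}"])
          (use y in \<open>auto simp: f\<^sub>\<alpha>_def w1\<close>)
      then show "(\<alpha> has_vector_derivative a\<^sub>0) (at t)" unfolding \<alpha>_def y_def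
        by (intro periodize_has_vector_derivative[OF z\<alpha> win(1,2) n])
      have "((\<lambda>t. B t - B t\<^sub>0) has_vector_derivative b y) (at y)"
        unfolding has_real_derivative_iff_has_vector_derivative[symmetric]
        by (rule derivative_eq_intros Bd refl | use y inl in force)+
      then have "(f\<^sub>\<beta> has_vector_derivative b y) (at y)"
        by (rule has_vector_derivative_transform_within_open[of _ _ _ "{s\<^sub>1<..<s}"])
          (use y in \<open>auto simp: f\<^sub>\<beta>_def w1\<close>)
      then have "(f\<^sub>\<beta> has_vector_derivative b t) (at y)" using bper_n[of t n] by (simp add: y_def)
      then show "(\<beta> has_vector_derivative b t) (at t)" unfolding \<beta>_def y_def
        by (intro periodize_has_vector_derivative[OF z\<beta> win(1,2) n])
    }
    assume nz: "vector_derivative E (at t) + q * E t \<noteq> 0"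
    \<comment> \<open>Outside the two transition zones the cutoff is locally constant, 1 or 0, and
      \<open>f\<^sub>E\<close> solves the homogeneous equation.\<close>
    have "y \<in> {s\<^sub>1..s\<^sub>1 + e} \<union> {s - e..s}"
    proof (rule ccontr)
      assume a: "y \<notin> {s\<^sub>1..s\<^sub>1 + e} \<union> {s - e..s}"
      have "\<exists>D. (f\<^sub>E has_vector_derivative D) (at y) \<and> D + q * f\<^sub>E y = 0"
      proof (cases "s\<^sub>1 + e < y \<and> y < s - e")
        case True
        have "((\<lambda>t. exp (- q * complex_of_real t)) has_vector_derivative - q * exp (- q * complex_of_real y)) (at y)"
        proof -
          have "((\<lambda>t. exp (t *\<^sub>R (- q))) has_vector_derivative exp (y *\<^sub>R (- q)) * - q) (at y)"
            by (rule exp_scaleR_has_vector_derivative_right)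
          then show ?thesis by (simp add: scaleR_conv_of_real mult.commute)
        qed
        then have "(f\<^sub>E has_vector_derivative - q * exp (- q * complex_of_real y)) (at y)"
          by (rule has_vector_derivative_transform_within_open[of _ _ _ "{s\<^sub>1 + e<..<s - e}"])
            (use True in \<open>auto simp: f\<^sub>E_def c1\<close>)
        then show ?thesis using True by (intro exI) (auto simp: f\<^sub>E_def c1)
      next
        case False
        then have "y \<in> {..<s\<^sub>1} \<union> {s<..}" using a by auto
        moreover have "((\<lambda>t::real. 0::complex) has_vector_derivative 0) (at y)" by simp
        then have "(f\<^sub>E has_vector_derivative 0) (at y)"
          by (rule has_vector_derivative_transform_within_open[of _ _ _ "{..<s\<^sub>1} \<union> {s<..}"])
            (use calculation zE in auto)
        ultimately show ?thesis using zE by (intro exI[of _ 0]) auto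
      qed
      then obtain D where D: "(f\<^sub>E has_vector_derivative D) (at y)" "D + q * f\<^sub>E y = 0" by blast
      have "(E has_vector_derivative D) (at t)" unfolding E_def
        by (intro periodize_has_vector_derivative[OF zE win(3,4) n] D(1)[unfolded y_def])
      then have "vector_derivative E (at t) + q * E t = D + q * f\<^sub>E y"
        using vector_derivative_at by (metis E_def eqs)
      then show False using D(2) nz by simp
    qed
    moreover from this have "w y = 1" using e s by (intro w1) auto
    ultimately have "f\<^sub>\<beta> y \<ge> \<delta>"
      using d1(2)[of y] d2(2)[of y] e by (auto simp: f\<^sub>\<beta>_def)
    then show "\<delta> \<le> \<beta> t" by (simp add: \<beta>_def eqs)
  qed
qed

section \<open>Smooth maps between manifolds\<close>

lemma smooth_atlasD:
  assumes "smooth_atlas A" "(U, \<phi>) \<in> A"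
  shows "open U" "open (\<phi> ` U)" "homeomorphism U (\<phi> ` U) \<phi> (inv_into U \<phi>)" "inj_on \<phi> U"
    "continuous_on U \<phi>" "continuous_on (\<phi> ` U) (inv_into U \<phi>)"
proof -
  show *: "open U" "open (\<phi> ` U)" "homeomorphism U (\<phi> ` U) \<phi> (inv_into U \<phi>)"
    using assms by (auto simp: smooth_atlas_def is_chart_def)
  show "inj_on \<phi> U"
    by (rule inj_on_inverseI[where g = "inv_into U \<phi>"]) (rule homeomorphism_apply1[OF *(3)])
  show "continuous_on U \<phi>" "continuous_on (\<phi> ` U) (inv_into U \<phi>)"
    using *(3) by (auto simp: homeomorphism_def)
qed

lemma smooth_atlas_cover: "smooth_atlas A \<Longrightarrow> \<exists>U \<phi>. (U, \<phi>) \<in> A \<and> x \<in> U"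
  unfolding smooth_atlas_def by blast

lemma open_chart_image:
  assumes A: "smooth_atlas A" "(U, \<phi>) \<in> A" and O: "open O'" "O' \<subseteq> U"
  shows "open (\<phi> ` O')"
proof -
  note c = smooth_atlasD[OF A]
  have "\<phi> ` O' = \<phi> ` U \<inter> inv_into U \<phi> -` O'"
    using O(2) c(4) by (auto simp: inv_into_f_f subset_iff)
  then show ?thesis using c(6) O(1) by (simp add: continuous_on_open_vimage[OF c(2)] Int_commute)
qed

text \<open>Charts, their inverses and local flows are meaningful only on open subsets, but all are
  total functions on their types; hence a version of \<open>smooth_map\<close> relative to a
  set.\<close>

definition smooth_map_on ::
  "'m set \<Rightarrow> ('m::topological_space, 'e::euclidean_space) chart set \<Rightarrow>
   ('n::topological_space, 'f::euclidean_space) chart set \<Rightarrow> ('m \<Rightarrow> 'n) \<Rightarrow> bool" where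
  "smooth_map_on S A B f \<longleftrightarrow> continuous_on S f \<and>
     (\<forall>(U, \<phi>)\<in>A. \<forall>(V, \<psi>)\<in>B. smooth_on (\<phi> ` (S \<inter> U \<inter> f -` V)) (\<psi> \<circ> f \<circ> inv_into U \<phi>))"

lemma smooth_map_on_UNIV: "smooth_map_on UNIV A B f \<longleftrightarrow> smooth_map A B f"
  by (simp add: smooth_map_on_def smooth_map_def)

lemma smooth_map_on_continuous: "smooth_map_on S A B f \<Longrightarrow> continuous_on S f"
  by (simp add: smooth_map_on_def)

lemma smooth_map_continuous: "smooth_map A B f \<Longrightarrow> continuous_on UNIV f"
  by (simp add: smooth_map_def)

lemma smooth_map_on_chart:
  "smooth_map_on S A B f \<Longrightarrow> (U, \<phi>) \<in> A \<Longrightarrow> (V, \<psi>) \<in> B \<Longrightarrow>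
   smooth_on (\<phi> ` (S \<inter> U \<inter> f -` V)) (\<psi> \<circ> f \<circ> inv_into U \<phi>)"
  by (auto simp: smooth_map_on_def)

lemma open_chart_preimage:
  assumes "smooth_atlas A" "(U, \<phi>) \<in> A" "open S" "continuous_on S f" "open V"
  shows "open (\<phi> ` (S \<inter> U \<inter> f -` V))"
proof (rule open_chart_image[OF assms(1,2)])
  have "open (S \<inter> f -` V)" using assms(3-5) by (simp add: continuous_on_open_vimage Int_commute)
  from open_Int[OF this smooth_atlasD(1)[OF assms(1,2)]] show "open (S \<inter> U \<inter> f -` V)"
    by (simp add: Int_ac)
qed auto

lemma smooth_map_onI:
  assumes "continuous_on S f"
    "\<And>U \<phi> V \<psi>. (U, \<phi>) \<in> A \<Longrightarrow> (V, \<psi>) \<in> B \<Longrightarrow>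
       smooth_on (\<phi> ` (S \<inter> U \<inter> f -` V)) (\<psi> \<circ> f \<circ> inv_into U \<phi>)"
  shows "smooth_map_on S A B f"
  using assms by (auto simp: smooth_map_on_def)

lemma smooth_mapI:
  assumes "continuous_on UNIV f"
    "\<And>U \<phi> V \<psi>. (U, \<phi>) \<in> A \<Longrightarrow> (V, \<psi>) \<in> B \<Longrightarrow>
       smooth_on (\<phi> ` (U \<inter> f -` V)) (\<psi> \<circ> f \<circ> inv_into U \<phi>)"
  shows "smooth_map A B f"
  using assms by (auto simp: smooth_map_def)

lemma smooth_map_on_subset:
  assumes f: "smooth_map_on S A B f" and T: "T \<subseteq> S"
  shows "smooth_map_on T A B f"
proof (rule smooth_map_onI)
  show "continuous_on T f" by (rule continuous_on_subset[OF smooth_map_on_continuous[OF f] T])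
  fix U \<phi> V \<psi> assume "(U, \<phi>) \<in> A" "(V, \<psi>) \<in> B"
  then show "smooth_on (\<phi> ` (T \<inter> U \<inter> f -` V)) (\<psi> \<circ> f \<circ> inv_into U \<phi>)"
    using T by (intro smooth_on_subset[OF smooth_map_on_chart[OF f, of U \<phi> V \<psi>]]) auto
qed

lemma smooth_map_on_of_smooth_map: "smooth_map A B f \<Longrightarrow> smooth_map_on S A B f"
  using smooth_map_on_subset[of UNIV A B f S] by (simp add: smooth_map_on_UNIV)

lemma smooth_map_on_cong:
  assumes A: "smooth_atlas A" and B: "smooth_atlas B" and S: "open S"
    and f: "smooth_map_on S A B f" and eq: "\<And>x. x \<in> S \<Longrightarrow> f x = g x"
  shows "smooth_map_on S A B g"
proof (rule smooth_map_onI)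
  show "continuous_on S g" by (rule continuous_on_eq[OF smooth_map_on_continuous[OF f] eq])
  fix U \<phi> V \<psi> assume UV: "(U, \<phi>) \<in> A" "(V, \<psi>) \<in> B"
  have o: "open (\<phi> ` (S \<inter> U \<inter> f -` V))"
    using open_chart_preimage[OF A UV(1) S smooth_map_on_continuous[OF f] smooth_atlasD(1)[OF B UV(2)]] .
  have "S \<inter> U \<inter> f -` V = S \<inter> U \<inter> g -` V" using eq by auto
  moreover have "smooth_on (\<phi> ` (S \<inter> U \<inter> f -` V)) (\<psi> \<circ> g \<circ> inv_into U \<phi>)"
    by (rule smooth_on_cong[OF o _ smooth_map_on_chart[OF f UV]])
      (use eq smooth_atlasD(4)[OF A UV(1)] in \<open>auto simp: inv_into_f_f\<close>)
  ultimately show "smooth_on (\<phi> ` (S \<inter> U \<inter> g -` V)) (\<psi> \<circ> g \<circ> inv_into U \<phi>)" by simp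
qed

lemma smooth_map_on_local:
  assumes "\<And>x. x \<in> S \<Longrightarrow> \<exists>T. open T \<and> x \<in> T \<and> smooth_map_on T A B f"
  shows "smooth_map_on S A B f"
proof (rule smooth_map_onI)
  show "continuous_on S f"
  proof -
    have "continuous_on (\<Union>{T. open T \<and> smooth_map_on T A B f}) f"
      by (rule continuous_on_open_Union) (auto intro: smooth_map_on_continuous)
    then show ?thesis by (rule continuous_on_subset) (use assms in blast)
  qed
  fix U \<phi> V \<psi> assume UV: "(U, \<phi>) \<in> A" "(V, \<psi>) \<in> B"
  show "smooth_on (\<phi> ` (S \<inter> U \<inter> f -` V)) (\<psi> \<circ> f \<circ> inv_into U \<phi>)"
  proof (rule smooth_on_local)
    fix y assume "y \<in> \<phi> ` (S \<inter> U \<inter> f -` V)"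
    then obtain x where x: "x \<in> S" "x \<in> U" "f x \<in> V" "y = \<phi> x" by auto
    then obtain T where T: "open T" "x \<in> T" "smooth_map_on T A B f" using assms by blast
    then show "\<exists>T. y \<in> T \<and> smooth_on T (\<psi> \<circ> f \<circ> inv_into U \<phi>)"
      using smooth_map_on_chart[OF T(3) UV] x by (intro exI[of _ "\<phi> ` (T \<inter> U \<inter> f -` V)"]) auto
  qed
qed

text \<open>Around each point one inserts a chart of the middle manifold; continuity of
  \<open>f\<close> and \<open>g\<close> lets the source shrink until everything stays inside that
  chart, where composition of Euclidean maps applies.\<close>

lemma smooth_map_on_compose:
  assumes A: "smooth_atlas A" and B: "smooth_atlas B" and C: "smooth_atlas C"
    and S: "open S" and T: "open T" and f: "smooth_map_on S A B f" and g: "smooth_map_on T B C g"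
    and sub: "f ` S \<subseteq> T"
  shows "smooth_map_on S A C (\<lambda>x. g (f x))"
proof (rule smooth_map_onI)
  show "continuous_on S (\<lambda>x. g (f x))"
    by (rule continuous_on_compose2[OF smooth_map_on_continuous[OF g] smooth_map_on_continuous[OF f] sub])
  fix U \<phi> W \<theta> assume UW: "(U, \<phi>) \<in> A" "(W, \<theta>) \<in> C"
  show "smooth_on (\<phi> ` (S \<inter> U \<inter> (\<lambda>x. g (f x)) -` W)) (\<theta> \<circ> (\<lambda>x. g (f x)) \<circ> inv_into U \<phi>)"
  proof (rule smooth_on_local)
    fix y assume "y \<in> \<phi> ` (S \<inter> U \<inter> (\<lambda>x. g (f x)) -` W)"
    then obtain x where x: "x \<in> S" "x \<in> U" "g (f x) \<in> W" "y = \<phi> x" by auto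
    obtain V \<psi> where V: "(V, \<psi>) \<in> B" "f x \<in> V" using smooth_atlas_cover[OF B] by blast
    define V' where "V' = T \<inter> V \<inter> g -` W"
    have "open (T \<inter> g -` W)"
      using smooth_map_on_continuous[OF g] smooth_atlasD(1)[OF C UW(2)]
      by (simp add: continuous_on_open_vimage[OF T] Int_commute)
    then have V': "open V'" "V' \<subseteq> V"
      using open_Int[OF smooth_atlasD(1)[OF B V(1)], of "T \<inter> g -` W"] unfolding V'_def
      by (auto simp: Int_assoc Int_left_commute)
    define N where "N = \<phi> ` (S \<inter> U \<inter> f -` V')"
    have o: "open N" "open (\<psi> ` V')"
      using open_chart_preimage[OF A UW(1) S smooth_map_on_continuous[OF f] V'(1)]
        open_chart_image[OF B V(1) V'] by (auto simp: N_def)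
    have inv: "inv_into U \<phi> (\<phi> z) = z" if "z \<in> U" for z
      using smooth_atlasD(4)[OF A UW(1)] that by simp
    have inv': "inv_into V \<psi> (\<psi> z) = z" if "z \<in> V" for z
      using smooth_atlasD(4)[OF B V(1)] that by simp
    have 1: "smooth_on N (\<psi> \<circ> f \<circ> inv_into U \<phi>)"
      by (rule smooth_on_subset[OF smooth_map_on_chart[OF f UW(1) V(1)]]) (use V' in \<open>auto simp: N_def\<close>)
    have 2: "smooth_on (\<psi> ` V') (\<theta> \<circ> g \<circ> inv_into V \<psi>)"
      by (rule smooth_on_subset[OF smooth_map_on_chart[OF g V(1) UW(2)]]) (auto simp: V'_def)
    have "smooth_on N (\<lambda>z. (\<theta> \<circ> g \<circ> inv_into V \<psi>) ((\<psi> \<circ> f \<circ> inv_into U \<phi>) z))"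
      by (rule smooth_on_compose[OF o _ 1 2]) (auto simp: N_def inv)
    then have "smooth_on N (\<theta> \<circ> (\<lambda>x. g (f x)) \<circ> inv_into U \<phi>)"
      by (rule smooth_on_cong[OF o(1), rotated]) (use V'(2) in \<open>auto simp: N_def inv inv' subset_iff\<close>)
    moreover have "y \<in> N" using x V sub by (auto simp: N_def V'_def)
    ultimately show "\<exists>T. y \<in> T \<and> smooth_on T (\<theta> \<circ> (\<lambda>x. g (f x)) \<circ> inv_into U \<phi>)"
      by (intro exI[of _ N]) simp
  qed
qed

lemma smooth_map_compose:
  assumes "smooth_atlas A" "smooth_atlas B" "smooth_atlas C" "smooth_map A B f" "smooth_map B C g"
  shows "smooth_map A C (\<lambda>x. g (f x))"
  using smooth_map_on_compose[OF assms(1-3) open_UNIV open_UNIV, of f g] assms(4,5)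
  by (simp add: smooth_map_on_UNIV)

section \<open>Product manifolds\<close>

lemma inv_into_map_prod:
  assumes "inj_on \<phi> U" "inj_on \<psi> V" "p \<in> map_prod \<phi> \<psi> ` (U \<times> V)"
  shows "inv_into (U \<times> V) (map_prod \<phi> \<psi>) p = (inv_into U \<phi> (fst p), inv_into V \<psi> (snd p))"
proof -
  obtain x y where xy: "x \<in> U" "y \<in> V" "p = map_prod \<phi> \<psi> (x, y)" using assms(3) by auto
  have "inj_on (map_prod \<phi> \<psi>) (U \<times> V)" using assms(1,2) by (rule map_prod_inj_on)
  then have "inv_into (U \<times> V) (map_prod \<phi> \<psi>) (map_prod \<phi> \<psi> (x, y)) = (x, y)"
    using xy by (intro inv_into_f_f) auto
  then show ?thesis using xy assms by simp
qed

lemma smooth_map_on_Pair: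
  assumes A: "smooth_atlas A" and B: "smooth_atlas B" and C: "smooth_atlas C" and S: "open S"
    and f: "smooth_map_on S A B f" and g: "smooth_map_on S A C g"
  shows "smooth_map_on S A (prod_atlas B C) (\<lambda>x. (f x, g x))"
proof (rule smooth_map_onI)
  show "continuous_on S (\<lambda>x. (f x, g x))"
    using f g by (intro continuous_on_Pair smooth_map_on_continuous)
  fix U \<phi> P \<pi> assume U: "(U, \<phi>) \<in> A" and P: "(P, \<pi>) \<in> prod_atlas B C"
  obtain V \<psi> W \<theta> where V: "(V, \<psi>) \<in> B" and W: "(W, \<theta>) \<in> C"
    and PV: "P = V \<times> W" "\<pi> = map_prod \<psi> \<theta>"
    using P by (auto simp: prod_atlas_def)
  define N where "N = \<phi> ` (S \<inter> U \<inter> (\<lambda>x. (f x, g x)) -` P)"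
  have o: "open N" unfolding N_def
    by (rule open_chart_preimage[OF A U S])
      (use smooth_map_on_continuous[OF f] smooth_map_on_continuous[OF g]
          smooth_atlasD(1)[OF B V] smooth_atlasD(1)[OF C W] in
        \<open>auto simp: PV intro!: continuous_on_Pair open_Times\<close>)
  have "smooth_on N (\<psi> \<circ> f \<circ> inv_into U \<phi>)" "smooth_on N (\<theta> \<circ> g \<circ> inv_into U \<phi>)"
    by (rule smooth_on_subset[OF smooth_map_on_chart[OF f U V]] smooth_on_subset[OF smooth_map_on_chart[OF g U W]];
        auto simp: N_def PV)+
  from smooth_on_Pair[OF o this] have "smooth_on N (\<pi> \<circ> (\<lambda>x. (f x, g x)) \<circ> inv_into U \<phi>)"
    by (simp add: PV o_def)
  then show "smooth_on (\<phi> ` (S \<inter> U \<inter> (\<lambda>x. (f x, g x)) -` P)) (\<pi> \<circ> (\<lambda>x. (f x, g x)) \<circ> inv_into U \<phi>)"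
    by (simp add: N_def)
qed

lemma smooth_map_Pair:
  assumes "smooth_atlas A" "smooth_atlas B" "smooth_atlas C" "smooth_map A B f" "smooth_map A C g"
  shows "smooth_map A (prod_atlas B C) (\<lambda>x. (f x, g x))"
  using smooth_map_on_Pair[OF assms(1-3) open_UNIV, of f g] assms(4,5) by (simp add: smooth_map_on_UNIV)

lemma smooth_map_const:
  assumes A: "smooth_atlas A" and B: "smooth_atlas B"
  shows "smooth_map A B (\<lambda>x. c)"
proof (rule smooth_mapI)
  fix U \<phi> V \<psi> assume "(U, \<phi>) \<in> A" "(V, \<psi>) \<in> B"
  have "open (\<phi> ` (UNIV \<inter> U \<inter> (\<lambda>x. c) -` V))"
    using \<open>(U, \<phi>) \<in> A\<close> \<open>(V, \<psi>) \<in> B\<close>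
    by (intro open_chart_preimage[OF A] smooth_atlasD(1)[OF B]) auto
  then show "smooth_on (\<phi> ` (U \<inter> (\<lambda>x. c) -` V)) (\<psi> \<circ> (\<lambda>x. c) \<circ> inv_into U \<phi>)"
    by (simp add: o_def smooth_on_const)
qed auto

lemma smooth_map_ident: "smooth_atlas A \<Longrightarrow> smooth_map A A (\<lambda>x. x)"
  unfolding smooth_map_def by (auto simp: smooth_atlas_def o_def)

lemma prod_atlasE:
  assumes "(P, \<pi>) \<in> prod_atlas A B"
  obtains U \<phi> V \<psi> where "(U, \<phi>) \<in> A" "(V, \<psi>) \<in> B" "P = U \<times> V" "\<pi> = map_prod \<phi> \<psi>"
  using assms by (auto simp: prod_atlas_def)

lemma prod_chart_simps:
  assumes A: "smooth_atlas A" and B: "smooth_atlas B" and "(U, \<phi>) \<in> A" "(V, \<psi>) \<in> B"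
    "p \<in> (\<phi> ` U) \<times> (\<psi> ` V)"
  shows "inv_into (U \<times> V) (map_prod \<phi> \<psi>) p = (inv_into U \<phi> (fst p), inv_into V \<psi> (snd p))"
  by (rule inv_into_map_prod) (use assms smooth_atlasD(4)[OF A] smooth_atlasD(4)[OF B] in
      \<open>auto simp: map_prod_surj_on[OF refl refl]\<close>)

lemma smooth_atlas_prod:
  assumes A: "smooth_atlas A" and B: "smooth_atlas B"
  shows "smooth_atlas (prod_atlas A B)"
  unfolding smooth_atlas_def
proof (intro conjI ballI)
  fix c assume "c \<in> prod_atlas A B"
  then obtain U \<phi> V \<psi> where UV: "(U, \<phi>) \<in> A" "(V, \<psi>) \<in> B" "c = (U \<times> V, map_prod \<phi> \<psi>)"
    by (auto simp: prod_atlas_def)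
  note a = smooth_atlasD[OF A UV(1)] and b = smooth_atlasD[OF B UV(2)]
  have im: "map_prod \<phi> \<psi> ` (U \<times> V) = \<phi> ` U \<times> \<psi> ` V" by (simp add: map_prod_surj_on)
  have inv: "inv_into (U \<times> V) (map_prod \<phi> \<psi>) p = (inv_into U \<phi> (fst p), inv_into V \<psi> (snd p))"
    if "p \<in> \<phi> ` U \<times> \<psi> ` V" for p
    using prod_chart_simps[OF A B UV(1,2) that] .
  have "homeomorphism (U \<times> V) (\<phi> ` U \<times> \<psi> ` V) (map_prod \<phi> \<psi>) (inv_into (U \<times> V) (map_prod \<phi> \<psi>))"
  proof (rule homeomorphismI)
    have "continuous_on (U \<times> V) (\<lambda>p. (\<phi> (fst p), \<psi> (snd p)))"
      by (intro continuous_on_Pair continuous_on_compose2[OF a(5)] continuous_on_compose2[OF b(5)])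
        (auto intro!: continuous_intros)
    then show "continuous_on (U \<times> V) (map_prod \<phi> \<psi>)" by (simp add: map_prod_def case_prod_beta')
    have "continuous_on (\<phi> ` U \<times> \<psi> ` V) (\<lambda>p. (inv_into U \<phi> (fst p), inv_into V \<psi> (snd p)))"
      by (intro continuous_on_Pair continuous_on_compose2[OF a(6)] continuous_on_compose2[OF b(6)])
        (auto intro!: continuous_intros)
    then show "continuous_on (\<phi> ` U \<times> \<psi> ` V) (inv_into (U \<times> V) (map_prod \<phi> \<psi>))"
      by (rule continuous_on_eq) (simp add: inv)
  qed (use a(4) b(4) inv in \<open>auto simp: im\<close>)
  then show "is_chart c" unfolding is_chart_def UV(3) by (simp add: im open_Times a b)
next
  have "p \<in> (\<Union>(U, \<phi>)\<in>prod_atlas A B. U)" for p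
  proof -
    obtain U \<phi> V \<psi> where "(U, \<phi>) \<in> A" "fst p \<in> U" "(V, \<psi>) \<in> B" "snd p \<in> V"
      using smooth_atlas_cover[OF A, of "fst p"] smooth_atlas_cover[OF B, of "snd p"] by auto
    then have "(U \<times> V, map_prod \<phi> \<psi>) \<in> prod_atlas A B" "p \<in> U \<times> V"
      by (auto simp: prod_atlas_def mem_Times_iff)
    then show ?thesis by blast
  qed
  then show "(\<Union>(U, \<phi>)\<in>prod_atlas A B. U) = UNIV" by blast
next
  have "smooth_on (\<pi> ` (P \<inter> Q)) (\<rho> \<circ> inv_into P \<pi>)"
    if P: "(P, \<pi>) \<in> prod_atlas A B" and Q: "(Q, \<rho>) \<in> prod_atlas A B" for P \<pi> Q \<rho>
  proof -
    obtain U \<phi> V \<psi> where UV: "(U, \<phi>) \<in> A" "(V, \<psi>) \<in> B" "P = U \<times> V" "\<pi> = map_prod \<phi> \<psi>"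
      using P by (rule prod_atlasE)
    obtain U' \<phi>' V' \<psi>' where UV': "(U', \<phi>') \<in> A" "(V', \<psi>') \<in> B" "Q = U' \<times> V'" "\<rho> = map_prod \<phi>' \<psi>'"
      using Q by (rule prod_atlasE)
    define N M where "N = \<phi> ` (U \<inter> U')" and "M = \<psi> ` (V \<inter> V')"
    have o: "open N" "open M" unfolding N_def M_def
      by (intro open_chart_image[OF A UV(1)] open_chart_image[OF B UV(2)] open_Int
          smooth_atlasD(1)[OF A UV(1)] smooth_atlasD(1)[OF A UV'(1)]
          smooth_atlasD(1)[OF B UV(2)] smooth_atlasD(1)[OF B UV'(2)] Int_lower1)+
    have s: "smooth_on N (\<phi>' \<circ> inv_into U \<phi>)" "smooth_on M (\<psi>' \<circ> inv_into V \<psi>)"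
      using A B UV UV' unfolding smooth_atlas_def N_def M_def by blast+
    have sm: "smooth_on (N \<times> M) (\<lambda>p. ((\<phi>' \<circ> inv_into U \<phi>) (fst p), (\<psi>' \<circ> inv_into V \<psi>) (snd p)))"
      by (intro smooth_on_Pair smooth_on_compose[OF _ o(1) _ _ s(1)] smooth_on_compose[OF _ o(2) _ _ s(2)]
          smooth_on_linear open_Times o bounded_linear_fst bounded_linear_snd) auto
    moreover have "\<pi> ` (P \<inter> Q) = N \<times> M"
      unfolding UV UV' Times_Int_Times N_def M_def by (simp add: map_prod_surj_on)
    moreover have eq: "((\<phi>' \<circ> inv_into U \<phi>) (fst p), (\<psi>' \<circ> inv_into V \<psi>) (snd p)) = (\<rho> \<circ> inv_into P \<pi>) p"
      if "p \<in> N \<times> M" for p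
      unfolding UV UV' o_def
      by (subst prod_chart_simps[OF A B UV(1,2)]) (use that in \<open>auto simp: N_def M_def\<close>)
    ultimately show ?thesis using smooth_on_cong[OF open_Times[OF o] eq sm] by (simp add: o_def)
  qed
  then show "case c of (U, \<phi>) \<Rightarrow> \<forall>(V, \<psi>)\<in>prod_atlas A B. smooth_on (\<phi> ` (U \<inter> V)) (\<psi> \<circ> inv_into U \<phi>)"
    if "c \<in> prod_atlas A B" for c using that by auto
qed

lemma smooth_map_fst:
  assumes A: "smooth_atlas A" and B: "smooth_atlas B"
  shows "smooth_map (prod_atlas A B) A fst"
proof (rule smooth_mapI)
  fix P \<pi> W \<theta> assume P: "(P, \<pi>) \<in> prod_atlas A B" and W: "(W, \<theta>) \<in> A"
  obtain U \<phi> V \<psi> where UV: "(U, \<phi>) \<in> A" "(V, \<psi>) \<in> B" "P = U \<times> V" "\<pi> = map_prod \<phi> \<psi>"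
    using P by (rule prod_atlasE)
  define N M where "N = \<phi> ` (U \<inter> W)" and "M = \<psi> ` V"
  have o: "open N" "open M" unfolding N_def M_def
    by (intro open_chart_image[OF A UV(1)] open_Int smooth_atlasD(1)[OF A UV(1)] smooth_atlasD(1)[OF A W]
        smooth_atlasD(2)[OF B UV(2)] Int_lower1)+
  have s: "smooth_on N (\<theta> \<circ> inv_into U \<phi>)" using A UV W unfolding smooth_atlas_def N_def by blast
  have im: "\<pi> ` (P \<inter> fst -` W) = N \<times> M"
  proof -
    have "P \<inter> fst -` W = (U \<inter> W) \<times> V" by (auto simp: UV)
    then show ?thesis by (simp add: UV N_def M_def map_prod_surj_on)
  qed
  have "smooth_on (N \<times> M) (\<lambda>p. (\<theta> \<circ> inv_into U \<phi>) (fst p))"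
    by (rule smooth_on_compose[OF _ o(1) _ smooth_on_linear s])
      (auto intro: open_Times o bounded_linear_fst)
  then have "smooth_on (N \<times> M) (\<theta> \<circ> fst \<circ> inv_into P \<pi>)"
  proof (rule smooth_on_cong[OF open_Times[OF o], rotated])
    fix p assume "p \<in> N \<times> M"
    then show "(\<theta> \<circ> inv_into U \<phi>) (fst p) = (\<theta> \<circ> fst \<circ> inv_into P \<pi>) p"
      unfolding UV o_def
      by (subst prod_chart_simps[OF A B UV(1,2)]) (auto simp: N_def M_def)
  qed
  then show "smooth_on (\<pi> ` (P \<inter> fst -` W)) (\<theta> \<circ> fst \<circ> inv_into P \<pi>)" by (simp add: im)
qed (auto intro: continuous_intros)

lemma smooth_map_snd:
  assumes A: "smooth_atlas A" and B: "smooth_atlas B"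
  shows "smooth_map (prod_atlas A B) B snd"
proof (rule smooth_mapI)
  fix P \<pi> W \<theta> assume P: "(P, \<pi>) \<in> prod_atlas A B" and W: "(W, \<theta>) \<in> B"
  obtain U \<phi> V \<psi> where UV: "(U, \<phi>) \<in> A" "(V, \<psi>) \<in> B" "P = U \<times> V" "\<pi> = map_prod \<phi> \<psi>"
    using P by (rule prod_atlasE)
  define N M where "N = \<phi> ` U" and "M = \<psi> ` (V \<inter> W)"
  have o: "open N" "open M" unfolding N_def M_def
    by (intro open_chart_image[OF B UV(2)] open_Int smooth_atlasD(1)[OF B UV(2)] smooth_atlasD(1)[OF B W]
        smooth_atlasD(2)[OF A UV(1)] Int_lower1)+
  have s: "smooth_on M (\<theta> \<circ> inv_into V \<psi>)" using B UV W unfolding smooth_atlas_def M_def by blast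
  have im: "\<pi> ` (P \<inter> snd -` W) = N \<times> M"
  proof -
    have "P \<inter> snd -` W = U \<times> (V \<inter> W)" by (auto simp: UV)
    then show ?thesis by (simp add: UV N_def M_def map_prod_surj_on)
  qed
  have "smooth_on (N \<times> M) (\<lambda>p. (\<theta> \<circ> inv_into V \<psi>) (snd p))"
    by (rule smooth_on_compose[OF _ o(2) _ smooth_on_linear s])
      (auto intro: open_Times o bounded_linear_snd)
  then have "smooth_on (N \<times> M) (\<theta> \<circ> snd \<circ> inv_into P \<pi>)"
  proof (rule smooth_on_cong[OF open_Times[OF o], rotated])
    fix p assume "p \<in> N \<times> M"
    then show "(\<theta> \<circ> inv_into V \<psi>) (snd p) = (\<theta> \<circ> snd \<circ> inv_into P \<pi>) p"
      unfolding UV o_def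
      by (subst prod_chart_simps[OF A B UV(1,2)]) (auto simp: N_def M_def)
  qed
  then show "smooth_on (\<pi> ` (P \<inter> snd -` W)) (\<theta> \<circ> snd \<circ> inv_into P \<pi>)" by (simp add: im)
qed (auto intro: continuous_intros)

section \<open>Euclidean space as a manifold with one chart\<close>

lemma smooth_atlas_euclidean: "smooth_atlas (euclidean_atlas :: ('e::euclidean_space, 'e) chart set)"
proof -
  have i: "inv_into UNIV (id :: 'e \<Rightarrow> 'e) = id" by (auto simp: inv_into_def)
  show ?thesis
    by (auto simp: smooth_atlas_def euclidean_atlas_def is_chart_def i o_def id_def smooth_on_ident
        intro!: homeomorphismI)
qed

lemma inv_into_UNIV_id: "inv_into UNIV id = id"
  by (auto simp: inv_into_def)

lemma smooth_map_on_euclidean_iff: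
  fixes f :: "'a::euclidean_space \<Rightarrow> 'b::euclidean_space"
  shows "smooth_map_on S euclidean_atlas euclidean_atlas f \<longleftrightarrow> smooth_on S f"
  by (auto simp: smooth_map_on_def euclidean_atlas_def inv_into_UNIV_id smooth_on_continuous_on)

lemma smooth_map_euclidean_iff:
  fixes f :: "'a::euclidean_space \<Rightarrow> 'b::euclidean_space"
  shows "smooth_map euclidean_atlas euclidean_atlas f \<longleftrightarrow> smooth_on UNIV f"
  by (simp flip: smooth_map_on_UNIV add: smooth_map_on_euclidean_iff)

lemma smooth_map_on_euclideanI:
  assumes A: "smooth_atlas A" and "\<And>U \<phi>. (U, \<phi>) \<in> A \<Longrightarrow> smooth_on (\<phi> ` (S \<inter> U)) (f \<circ> inv_into U \<phi>)"
    and S: "open S"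
  shows "smooth_map_on S A euclidean_atlas f"
proof (rule smooth_map_onI)
  show "continuous_on S f"
  proof -
    have *: "continuous_on (S \<inter> U) f" if U: "(U, \<phi>) \<in> A" for U \<phi>
    proof -
      note c = smooth_atlasD[OF A U]
      have "continuous_on (S \<inter> U) (\<lambda>z. (f \<circ> inv_into U \<phi>) (\<phi> z))"
        by (rule continuous_on_compose2[OF smooth_on_continuous_on[OF assms(2)[OF U]]])
          (auto intro: continuous_on_subset[OF c(5)])
      then show ?thesis by (rule continuous_on_eq) (use c(4) in auto)
    qed
    have "continuous_on (\<Union>((\<lambda>(U, \<phi>). S \<inter> U) ` A)) f"
      by (rule continuous_on_open_Union) (use * smooth_atlasD(1)[OF A] S in auto)
    then show ?thesis
      by (rule continuous_on_subset) (use smooth_atlas_cover[OF A] in fastforce)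
  qed
qed (use assms(2) in \<open>auto simp: euclidean_atlas_def\<close>)

lemma smooth_fun_chart:
  "smooth_fun A f \<Longrightarrow> (U, \<phi>) \<in> A \<Longrightarrow> smooth_on (\<phi> ` U) (f \<circ> inv_into U \<phi>)"
  by (auto simp: smooth_fun_def smooth_map_def euclidean_atlas_def)

lemma smooth_funI:
  assumes "smooth_atlas A" "\<And>U \<phi>. (U, \<phi>) \<in> A \<Longrightarrow> smooth_on (\<phi> ` U) (f \<circ> inv_into U \<phi>)"
  shows "smooth_fun A f"
  using smooth_map_on_euclideanI[OF assms(1), of UNIV f] assms(2) by (simp add: smooth_fun_def smooth_map_on_UNIV)

lemma prod_atlas_euclidean:
  "prod_atlas euclidean_atlas euclidean_atlas = (euclidean_atlas :: ('a::euclidean_space \<times> 'b::euclidean_space, _) chart set)"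
  by (auto simp: prod_atlas_def euclidean_atlas_def id_def map_prod_def)

section \<open>Derivations and tangent vectors\<close>

lemma smooth_on_fst: "open S \<Longrightarrow> smooth_on S fst"
  by (rule smooth_on_linear[OF _ bounded_linear_fst])

lemma smooth_on_snd: "open S \<Longrightarrow> smooth_on S snd"
  by (rule smooth_on_linear[OF _ bounded_linear_snd])

lemma smooth_fun_pullback:
  assumes "smooth_atlas A" "smooth_atlas B" "smooth_map A B f" "smooth_fun B g"
  shows "smooth_fun A (\<lambda>x. g (f x))"
  using smooth_map_compose[OF assms(1,2) smooth_atlas_euclidean assms(3)] assms(4)
  by (simp add: smooth_fun_def)

lemma smooth_fun_compose:
  assumes "smooth_atlas A" "smooth_fun A f" "smooth_on UNIV g"
  shows "smooth_fun A (\<lambda>x. g (f x))"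
  using smooth_fun_pullback[OF assms(1) smooth_atlas_euclidean, of f g] assms(2,3)
  by (simp add: smooth_fun_def smooth_map_euclidean_iff)

lemma smooth_fun_const: "smooth_atlas A \<Longrightarrow> smooth_fun A (\<lambda>x. c)"
  unfolding smooth_fun_def by (rule smooth_map_const[OF _ smooth_atlas_euclidean])

lemma smooth_fun_Pair:
  assumes "smooth_atlas A" "smooth_fun A f" "smooth_fun A g"
  shows "smooth_fun A (\<lambda>x. (f x, g x))"
  using smooth_map_Pair[OF assms(1) smooth_atlas_euclidean smooth_atlas_euclidean, of f g] assms(2,3)
  by (simp add: smooth_fun_def prod_atlas_euclidean)

lemma smooth_fun_compose2:
  assumes "smooth_atlas A" "smooth_fun A f" "smooth_fun A g" "smooth_on UNIV (\<lambda>p. h (fst p) (snd p))"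
  shows "smooth_fun A (\<lambda>x. h (f x) (g x))"
  using smooth_fun_compose[OF assms(1) smooth_fun_Pair[OF assms(1-3)] assms(4)] by simp

lemma smooth_fun_linear_comp:
  fixes f :: "'m::topological_space \<Rightarrow> 'a::euclidean_space" and L :: "'a \<Rightarrow> 'b::euclidean_space"
  shows "smooth_atlas A \<Longrightarrow> smooth_fun A f \<Longrightarrow> bounded_linear L \<Longrightarrow> smooth_fun A (\<lambda>x. L (f x))"
  by (rule smooth_fun_compose) (auto intro: smooth_on_linear)

lemma smooth_fun_add:
  "smooth_atlas A \<Longrightarrow> smooth_fun A f \<Longrightarrow> smooth_fun A g \<Longrightarrow> smooth_fun A (\<lambda>x. f x + g x)"
  by (rule smooth_fun_compose2[where h = "(+)"])
    (auto intro!: smooth_on_add smooth_on_fst smooth_on_snd)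

lemma smooth_fun_diff:
  "smooth_atlas A \<Longrightarrow> smooth_fun A f \<Longrightarrow> smooth_fun A g \<Longrightarrow> smooth_fun A (\<lambda>x. f x - g x)"
  by (rule smooth_fun_compose2[where h = "(-)"])
    (auto intro!: smooth_on_diff smooth_on_fst smooth_on_snd)

lemma smooth_fun_mult:
  fixes f g :: "'m::topological_space \<Rightarrow> 'a::{euclidean_space, real_normed_algebra}"
  shows "smooth_atlas A \<Longrightarrow> smooth_fun A f \<Longrightarrow> smooth_fun A g \<Longrightarrow> smooth_fun A (\<lambda>x. f x * g x)"
  by (rule smooth_fun_compose2[where h = "(*)"])
    (auto intro!: smooth_on_mult smooth_on_fst smooth_on_snd)

lemma smooth_fun_sum:
  "smooth_atlas A \<Longrightarrow> (\<And>i. i \<in> I \<Longrightarrow> smooth_fun A (f i)) \<Longrightarrow> smooth_fun A (\<lambda>x. \<Sum>i\<in>I. f i x)"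
  by (induction I rule: infinite_finite_induct) (auto intro: smooth_fun_const smooth_fun_add)

lemma smooth_fun_continuous: "smooth_fun A f \<Longrightarrow> continuous_on UNIV f"
  by (simp add: smooth_fun_def smooth_map_continuous)

lemma smooth_atlas_transition:
  "smooth_atlas A \<Longrightarrow> (U, \<phi>) \<in> A \<Longrightarrow> (V, \<psi>) \<in> A \<Longrightarrow> smooth_on (\<phi> ` (U \<inter> V)) (\<psi> \<circ> inv_into U \<phi>)"
  unfolding smooth_atlas_def by blast

lemma smooth_map_on_chart_map:
  assumes A: "smooth_atlas A" and U: "(U, \<phi>) \<in> A"
  shows "smooth_map_on U A euclidean_atlas \<phi>"
proof (rule smooth_map_on_euclideanI[OF A _ smooth_atlasD(1)[OF A U]])
  fix V \<psi> assume V: "(V, \<psi>) \<in> A"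
  show "smooth_on (\<psi> ` (U \<inter> V)) (\<phi> \<circ> inv_into V \<psi>)"
    using smooth_atlas_transition[OF A V U] by (simp add: Int_commute)
qed

lemma smooth_map_on_inv_chart:
  fixes A :: "('m::topological_space, 'e::euclidean_space) chart set"
  assumes A: "smooth_atlas A" and U: "(U, \<phi>) \<in> A"
  shows "smooth_map_on (\<phi> ` U) euclidean_atlas A (inv_into U \<phi>)"
proof (rule smooth_map_onI)
  note c = smooth_atlasD[OF A U]
  show "continuous_on (\<phi> ` U) (inv_into U \<phi>)" by (rule c)
  fix T \<tau> V \<psi> assume T: "(T :: 'e set, \<tau> :: 'e \<Rightarrow> 'e) \<in> euclidean_atlas" and V: "(V, \<psi>) \<in> A"
  have "smooth_on (\<phi> ` (U \<inter> V)) (\<psi> \<circ> inv_into U \<phi>)"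
    by (rule smooth_atlas_transition[OF A U V])
  moreover have "\<phi> ` (U \<inter> V) = \<phi> ` U \<inter> inv_into U \<phi> -` V" using c(4) by auto
  ultimately show "smooth_on (\<tau> ` (\<phi> ` U \<inter> T \<inter> inv_into U \<phi> -` V)) (\<psi> \<circ> inv_into U \<phi> \<circ> inv_into T \<tau>)"
    using T by (auto simp: euclidean_atlas_def inv_into_UNIV_id)
qed

section \<open>Bump functions in a chart\<close>

definition bump :: "'e::euclidean_space \<Rightarrow> real \<Rightarrow> 'e \<Rightarrow> real" where
  "bump y\<^sub>0 s y = smooth_step (2 - ((y - y\<^sub>0) \<bullet> (y - y\<^sub>0)) * inverse (s\<^sup>2))"

lemma smooth_on_bump:
  assumes "s > 0"
  shows "smooth_on UNIV (bump y\<^sub>0 s)" "\<And>y. dist y y\<^sub>0 \<le> s \<Longrightarrow> bump y\<^sub>0 s y = 1"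
    "\<And>y. dist y y\<^sub>0 \<ge> 2 * s \<Longrightarrow> bump y\<^sub>0 s y = 0"
proof -
  have d: "(y - y\<^sub>0) \<bullet> (y - y\<^sub>0) = (dist y y\<^sub>0)\<^sup>2" for y by (simp add: dist_norm power2_norm_eq_inner)
  show "smooth_on UNIV (bump y\<^sub>0 s)" unfolding bump_def
    by (rule smooth_on_compose[OF open_UNIV open_UNIV _ _ smooth_on_smooth_step])
      (auto intro!: smooth_on_diff smooth_on_const smooth_on_mult smooth_on_inner smooth_on_ident)
  show "bump y\<^sub>0 s y = 1" if "dist y y\<^sub>0 \<le> s" for y
  proof -
    have "(dist y y\<^sub>0)\<^sup>2 \<le> s\<^sup>2" using that by (intro power_mono) auto
    then show ?thesis using assms(1) unfolding bump_def d by (intro smooth_step_simps(2)) (simp add: field_simps)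
  qed
  show "bump y\<^sub>0 s y = 0" if "dist y y\<^sub>0 \<ge> 2 * s" for y
  proof -
    have "(2 * s)\<^sup>2 \<le> (dist y y\<^sub>0)\<^sup>2" using that assms(1) by (intro power_mono) auto
    moreover have "2 * s\<^sup>2 \<le> (2 * s)\<^sup>2" by (simp add: power_mult_distrib)
    ultimately have "2 * s\<^sup>2 \<le> (dist y y\<^sub>0)\<^sup>2" by linarith
    then show ?thesis using assms(1) unfolding bump_def d by (intro smooth_step_simps(1)) (simp add: field_simps)
  qed
qed

text \<open>Extension by zero is smooth because the function is glued from two open pieces:
  \<open>W\<close>, and the complement of the compact preimage \<open>K\<close> of a closed ball.
  The latter is open because compact sets are closed in a Hausdorff space.\<close>

lemma chart_bump:
  fixes A :: "('m::t2_space, 'e::euclidean_space) chart set"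
  assumes A: "smooth_atlas A" and U: "(U, \<phi>) \<in> A" and W: "open W" "W \<subseteq> U" "p \<in> W"
  obtains \<rho> :: "'m \<Rightarrow> real" and N where "smooth_fun A \<rho>" "open N" "p \<in> N" "N \<subseteq> W"
    "\<And>x. x \<in> N \<Longrightarrow> \<rho> x = 1" "\<And>x. x \<notin> W \<Longrightarrow> \<rho> x = 0"
    "\<And>g :: 'e \<Rightarrow> real. smooth_on (\<phi> ` W) g \<Longrightarrow> smooth_fun A (\<lambda>x. if x \<in> W then \<rho> x * g (\<phi> x) else 0)"
proof -
  note c = smooth_atlasD[OF A U]
  have inj: "inv_into U \<phi> (\<phi> x) = x" if "x \<in> U" for x using c(4) that by simp
  have oW: "open (\<phi> ` W)" by (rule open_chart_image[OF A U W(1,2)])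
  then obtain r where r: "r > 0" "cball (\<phi> p) r \<subseteq> \<phi> ` W"
    using W(3) open_contains_cball by (metis imageI)
  define s where "s = r / 2"
  have s: "s > 0" using r by (simp add: s_def)
  define \<rho>\<^sub>0 where "\<rho>\<^sub>0 = bump (\<phi> p) s"
  note b = smooth_on_bump[OF s, where y\<^sub>0 = "\<phi> p", folded \<rho>\<^sub>0_def]
  define K where "K = inv_into U \<phi> ` cball (\<phi> p) r"
  have "cball (\<phi> p) r \<subseteq> \<phi> ` U" using r W by blast
  then have "compact K" unfolding K_def
    by (intro compact_continuous_image continuous_on_subset[OF c(6)]) auto
  then have K: "open (- K)" by (simp add: compact_imp_closed open_Compl)
  have KW: "K \<subseteq> W"
  proof
    fix x assume "x \<in> K"
    then obtain y where y: "y \<in> cball (\<phi> p) r" "x = inv_into U \<phi> y" by (auto simp: K_def)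
    then obtain z where "z \<in> W" "y = \<phi> z" using r by blast
    then show "x \<in> W" using y inj W by auto
  qed
  have out: "\<rho>\<^sub>0 (\<phi> x) = 0" if "x \<in> W" "x \<notin> K" for x
  proof (rule b(3))
    have "\<phi> x \<notin> cball (\<phi> p) r" using that inj W unfolding K_def by force
    then show "2 * s \<le> dist (\<phi> x) (\<phi> p)" by (simp add: s_def dist_commute)
  qed
  define \<rho> where "\<rho> x = (if x \<in> W then \<rho>\<^sub>0 (\<phi> x) else 0)" for x
  have ext: "smooth_fun A (\<lambda>x. if x \<in> W then \<rho>\<^sub>0 (\<phi> x) * g (\<phi> x) else 0)" (is "smooth_fun A ?F")
    if g: "smooth_on (\<phi> ` W) g" for g :: "'e \<Rightarrow> real"
    unfolding smooth_fun_def smooth_map_on_UNIV[symmetric]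
  proof (rule smooth_map_on_local)
    fix x
    show "\<exists>T. open T \<and> x \<in> T \<and> smooth_map_on T A euclidean_atlas ?F"
    proof (cases "x \<in> W")
      case True
      have "smooth_on (\<phi> ` W) (\<lambda>y. \<rho>\<^sub>0 y * g y)"
        by (intro smooth_on_mult oW g smooth_on_subset[OF b(1)]) auto
      then have "smooth_map_on W A euclidean_atlas (\<lambda>x. \<rho>\<^sub>0 (\<phi> x) * g (\<phi> x))"
        by (intro smooth_map_on_compose[OF A smooth_atlas_euclidean smooth_atlas_euclidean W(1) oW
              smooth_map_on_subset[OF smooth_map_on_chart_map[OF A U] W(2)]])
          (auto simp: smooth_map_on_euclidean_iff)
      then have "smooth_map_on W A euclidean_atlas ?F"
        by (rule smooth_map_on_cong[OF A smooth_atlas_euclidean W(1)]) simp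
      then show ?thesis using W True by blast
    next
      case False
      have "smooth_map_on (- K) A euclidean_atlas (\<lambda>x. 0::real)"
        by (rule smooth_map_on_of_smooth_map[OF smooth_map_const[OF A smooth_atlas_euclidean]])
      then have "smooth_map_on (- K) A euclidean_atlas ?F"
        by (rule smooth_map_on_cong[OF A smooth_atlas_euclidean K]) (auto simp: out)
      then show ?thesis using K KW False by blast
    qed
  qed
  define N where "N = W \<inter> \<phi> -` ball (\<phi> p) s"
  show thesis
  proof
    show "smooth_fun A \<rho>"
      using ext[OF smooth_on_const[OF oW, of 1]] by (simp add: \<rho>_def[abs_def] cong: if_cong)
    have "continuous_on W \<phi>" by (rule continuous_on_subset[OF c(5) W(2)])
    then show "open N" unfolding N_def using W(1) by (simp add: continuous_on_open_vimage Int_commute)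
    show "p \<in> N" using s W by (simp add: N_def)
    show "N \<subseteq> W" by (simp add: N_def)
    show "\<rho> x = 1" if "x \<in> N" for x using that b(2) by (simp add: N_def \<rho>_def dist_commute less_imp_le)
    show "\<rho> x = 0" if "x \<notin> W" for x using that by (simp add: \<rho>_def)
    show "smooth_fun A (\<lambda>x. if x \<in> W then \<rho> x * g (\<phi> x) else 0)" if "smooth_on (\<phi> ` W) g" for g
      using ext[OF that] by (rule back_subst[of "smooth_fun A"]) (auto simp: \<rho>_def)
  qed
qed

text \<open>This turns an identity of f(x) and f(y) for all smooth \<open>f\<close> into the
  equality of x and y, the way identities between group elements are obtained from derivatives
  below.\<close>

lemma smooth_fun_separates:
  fixes A :: "('m::t2_space, 'e::euclidean_space) chart set"
  assumes A: "smooth_atlas A" and "p \<noteq> p'"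
  obtains f :: "'m \<Rightarrow> real" where "smooth_fun A f" "f p \<noteq> f p'"
proof -
  obtain U \<phi> where U: "(U, \<phi>) \<in> A" "p \<in> U" using smooth_atlas_cover[OF A] by blast
  have "open (U - {p'})" using smooth_atlasD(1)[OF A U(1)] by (intro open_Diff) auto
  then show ?thesis
    by (rule chart_bump[OF A U(1), of "U - {p'}" p]) (use U assms that in auto)
qed

text \<open>As in \<open>lie_algebra\<close>, but at any point and without the convention on
  nonsmooth functions, so that left translates of an element of the Lie algebra are
  included.\<close>

definition derivation_at ::
  "('m::topological_space, 'e::euclidean_space) chart set \<Rightarrow> 'm \<Rightarrow> (('m \<Rightarrow> real) \<Rightarrow> real) \<Rightarrow> bool" where
  "derivation_at A p D \<longleftrightarrow>
     (\<forall>f g. smooth_fun A f \<longrightarrow> smooth_fun A g \<longrightarrow> D (\<lambda>x. f x + g x) = D f + D g) \<and>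
     (\<forall>c f. smooth_fun A f \<longrightarrow> D (\<lambda>x. c * f x) = c * D f) \<and>
     (\<forall>f g. smooth_fun A f \<longrightarrow> smooth_fun A g \<longrightarrow> D (\<lambda>x. f x * g x) = f p * D g + g p * D f)"

lemma derivation_atD:
  assumes "derivation_at A p D" "smooth_fun A f" "smooth_fun A g"
  shows "D (\<lambda>x. f x + g x) = D f + D g" "D (\<lambda>x. c * f x) = c * D f"
    "D (\<lambda>x. f x * g x) = f p * D g + g p * D f"
  using assms unfolding derivation_at_def by blast+

lemma derivation_const:
  assumes A: "smooth_atlas A" and D: "derivation_at A p D"
  shows "D (\<lambda>x. c) = 0"
proof -
  have 1: "smooth_fun A (\<lambda>x. 1::real)" by (rule smooth_fun_const[OF A])
  have "D (\<lambda>x. 1) = 0" using derivation_atD(3)[OF D 1 1] by simp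
  then show ?thesis using derivation_atD(2)[OF D 1 1, of c] by simp
qed

lemma derivation_sum:
  assumes A: "smooth_atlas A" and D: "derivation_at A p D" and f: "\<And>i. i \<in> I \<Longrightarrow> smooth_fun A (f i)"
  shows "D (\<lambda>x. \<Sum>i\<in>I. f i x) = (\<Sum>i\<in>I. D (f i))"
  using f
proof (induction I rule: infinite_finite_induct)
  case (insert i I)
  then show ?case
    using derivation_atD(1)[OF D, of "f i" "\<lambda>x. \<Sum>i\<in>I. f i x"] smooth_fun_sum[OF A, of I f] by simp
qed (use derivation_const[OF A D] in auto)

text \<open>The coefficients in Hadamard's first-order expansion at \<open>y\<^sub>0\<close>:
  averages of the partial derivatives over the segment from \<open>y\<^sub>0\<close> to
  \<open>y\<close>, which remain smooth in \<open>y\<close>.\<close>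

definition hadamard_quotient ::
  "('e::euclidean_space \<Rightarrow> real) \<Rightarrow> 'e \<Rightarrow> 'e \<Rightarrow> 'e \<Rightarrow> real" where
  "hadamard_quotient F y\<^sub>0 b y =
     integral {0..1} (\<lambda>\<tau>. frechet_derivative F (at (y\<^sub>0 + \<tau> *\<^sub>R (y - y\<^sub>0))) b)"

lemma hadamard:
  fixes F :: "'e::euclidean_space \<Rightarrow> real" and y\<^sub>0 :: 'e
  assumes F: "smooth_on UNIV F"
  shows "smooth_on UNIV (hadamard_quotient F y\<^sub>0 b)"
    "F y = F y\<^sub>0 + (\<Sum>b\<in>Basis. ((y - y\<^sub>0) \<bullet> b) * hadamard_quotient F y\<^sub>0 b y)"
    "hadamard_quotient F y\<^sub>0 b y\<^sub>0 = frechet_derivative F (at y\<^sub>0) b"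
proof -
  define g where "g = hadamard_quotient F y\<^sub>0"
  have "g b y\<^sub>0 = frechet_derivative F (at y\<^sub>0) b" by (simp add: g_def hadamard_quotient_def)
  then show "hadamard_quotient F y\<^sub>0 b y\<^sub>0 = frechet_derivative F (at y\<^sub>0) b" by (simp add: g_def)
  note F' = smooth_on_imp_frechet[OF F]
  have "smooth_on UNIV (\<lambda>p. frechet_derivative F (at (y\<^sub>0 + snd p *\<^sub>R (fst p - y\<^sub>0))) b)"
    by (rule smooth_on_compose[OF open_UNIV open_UNIV _ _ F'])
      (auto intro!: smooth_on_add smooth_on_diff smooth_on_scaleR smooth_on_const
        smooth_on_fst smooth_on_snd)
  then show "smooth_on UNIV (hadamard_quotient F y\<^sub>0 b)"
    unfolding hadamard_quotient_def[abs_def] using smooth_on_integral[OF open_UNIV, where \<Phi> = "\<lambda>p. frechet_derivative F (at (y\<^sub>0 + snd p *\<^sub>R (fst p - y\<^sub>0))) b"]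
    by simp
  have hd: "((\<lambda>\<tau>. F (y\<^sub>0 + \<tau> *\<^sub>R (y - y\<^sub>0))) has_vector_derivative
      (\<Sum>b\<in>Basis. ((y - y\<^sub>0) \<bullet> b) * frechet_derivative F (at (y\<^sub>0 + \<tau> *\<^sub>R (y - y\<^sub>0))) b)) (at \<tau> within {0..1})" for \<tau>
  proof -
    define z where "z = y\<^sub>0 + \<tau> *\<^sub>R (y - y\<^sub>0)"
    have d: "(F has_derivative frechet_derivative F (at z)) (at z)"
      using smooth_on_has_derivative[OF F] by simp
    then have lin: "linear (frechet_derivative F (at z))" by (rule has_derivative_linear)
    have "((\<lambda>\<tau>. y\<^sub>0 + \<tau> *\<^sub>R (y - y\<^sub>0)) has_derivative (\<lambda>h. h *\<^sub>R (y - y\<^sub>0))) (at \<tau> within {0..1})"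
      by (auto intro!: derivative_eq_intros)
    from has_derivative_compose[OF this d[unfolded z_def]]
    have "((\<lambda>\<tau>. F (y\<^sub>0 + \<tau> *\<^sub>R (y - y\<^sub>0))) has_vector_derivative frechet_derivative F (at z) (y - y\<^sub>0)) (at \<tau> within {0..1})"
      unfolding has_vector_derivative_def z_def by (rule has_derivative_eq_rhs) (auto simp: linear_cmul[OF lin[unfolded z_def]])
    moreover have "frechet_derivative F (at z) (\<Sum>b\<in>Basis. ((y - y\<^sub>0) \<bullet> b) *\<^sub>R b) =
        (\<Sum>b\<in>Basis. ((y - y\<^sub>0) \<bullet> b) * frechet_derivative F (at z) b)"
      by (simp add: linear_sum[OF lin] linear_cmul[OF lin])
    ultimately show ?thesis unfolding euclidean_representation z_def by simp
  qed
  have int: "(\<lambda>\<tau>. frechet_derivative F (at (y\<^sub>0 + \<tau> *\<^sub>R (y - y\<^sub>0))) b) integrable_on {0..1}" for b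
    by (rule integrable_continuous_real, rule continuous_on_compose2[OF smooth_on_continuous_on[OF F']])
      (auto intro!: continuous_intros)
  have "((\<lambda>\<tau>. \<Sum>b\<in>Basis. ((y - y\<^sub>0) \<bullet> b) * frechet_derivative F (at (y\<^sub>0 + \<tau> *\<^sub>R (y - y\<^sub>0))) b)
      has_integral F y - F y\<^sub>0) {0..1}"
    using fundamental_theorem_of_calculus[OF _ hd] by simp
  moreover have "((\<lambda>\<tau>. \<Sum>b\<in>Basis. ((y - y\<^sub>0) \<bullet> b) * frechet_derivative F (at (y\<^sub>0 + \<tau> *\<^sub>R (y - y\<^sub>0))) b)
      has_integral (\<Sum>b\<in>Basis. ((y - y\<^sub>0) \<bullet> b) * g b y)) {0..1}"
    unfolding g_def hadamard_quotient_def by (intro has_integral_sum has_integral_mult_right integrable_integral int) auto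
  ultimately have "F y - F y\<^sub>0 = (\<Sum>b\<in>Basis. ((y - y\<^sub>0) \<bullet> b) * g b y)"
    by (rule has_integral_unique)
  then show "F y = F y\<^sub>0 + (\<Sum>b\<in>Basis. ((y - y\<^sub>0) \<bullet> b) * hadamard_quotient F y\<^sub>0 b y)"
    by (simp add: g_def)
qed

text \<open>Hadamard's formula integrates along segments, which may leave the image of a chart; a
  cutoff gives a globally smooth function with the same germ.\<close>

lemma smooth_on_extend:
  fixes F :: "'e::euclidean_space \<Rightarrow> real"
  assumes S: "open S" "y\<^sub>0 \<in> S" and F: "smooth_on S F"
  obtains F' e where "smooth_on UNIV F'" "e > 0" "ball y\<^sub>0 e \<subseteq> S" "\<And>y. y \<in> ball y\<^sub>0 e \<Longrightarrow> F' y = F y"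
proof -
  obtain r where r: "r > 0" "cball y\<^sub>0 r \<subseteq> S" using S open_contains_cball by blast
  define s where "s = r / 2"
  have s: "s > 0" using r by (simp add: s_def)
  define \<rho> where "\<rho> = bump y\<^sub>0 s"
  note b = smooth_on_bump[OF s, where y\<^sub>0 = y\<^sub>0, folded \<rho>_def]
  define F' where "F' y = (if y \<in> S then \<rho> y * F y else 0)" for y
  have "smooth_on UNIV F'"
  proof (rule smooth_on_local)
    fix y
    show "\<exists>T. y \<in> T \<and> smooth_on T F'"
    proof (cases "y \<in> S")
      case True
      have "smooth_on S F'"
        by (rule smooth_on_cong[OF S(1) _ smooth_on_mult[OF S(1) smooth_on_subset[OF b(1)] F]])
          (auto simp: F'_def)
      then show ?thesis using True by (intro exI[of _ S]) simp
    next
      case False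
      have o: "open (- cball y\<^sub>0 r)" by (simp add: open_Compl)
      have "smooth_on (- cball y\<^sub>0 r) F'"
        by (rule smooth_on_cong[OF o _ smooth_on_const[OF o, of 0]])
          (auto simp: F'_def s_def dist_commute intro!: b(3))
      then show ?thesis using False r by (intro exI[of _ "- cball y\<^sub>0 r"]) auto
    qed
  qed
  moreover have "F' y = F y" if "y \<in> ball y\<^sub>0 s" for y
    using that r b(2)[of y] by (auto simp: F'_def s_def dist_commute subset_iff)
  moreover have "ball y\<^sub>0 s \<subseteq> S" using r by (auto simp: s_def subset_iff)
  ultimately show thesis using s that by blast
qed

text \<open>Every derivation is a combination of partial derivatives, with its values on the cut-off
  coordinates as coefficients. It is evaluated on an expansion of \<open>f\<close> to first order
  that holds on the whole manifold.\<close>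

lemma derivation_chart:
  fixes A :: "('m::t2_space, 'e::euclidean_space) chart set" and \<rho> :: "'m \<Rightarrow> real"
  assumes A: "smooth_atlas A" and U: "(U, \<phi>) \<in> A" and N: "open N" "N \<subseteq> U" "p \<in> N"
    and \<rho>: "\<And>x. x \<in> N \<Longrightarrow> \<rho> x = 1"
    and x: "\<And>b. smooth_fun A (\<lambda>x. if x \<in> U then \<rho> x * (\<phi> x \<bullet> b) else 0)"
    and D: "derivation_at A p D" and f: "smooth_fun A f"
  shows "D f = (\<Sum>b\<in>Basis. D (\<lambda>x. if x \<in> U then \<rho> x * (\<phi> x \<bullet> b) else 0) *
    frechet_derivative (f \<circ> inv_into U \<phi>) (at (\<phi> p)) b)"
proof -
  note c = smooth_atlasD[OF A U]
  define xb where "xb b = (\<lambda>x. if x \<in> U then \<rho> x * (\<phi> x \<bullet> b) else 0)" for b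
  define y\<^sub>0 where "y\<^sub>0 = \<phi> p"
  have pU: "p \<in> U" using N by blast
  have y0: "y\<^sub>0 \<in> \<phi> ` U" using pU by (simp add: y\<^sub>0_def)
  obtain F' e where F': "smooth_on UNIV F'" "e > 0" "ball y\<^sub>0 e \<subseteq> \<phi> ` U"
    "\<And>y. y \<in> ball y\<^sub>0 e \<Longrightarrow> F' y = (f \<circ> inv_into U \<phi>) y"
    using smooth_on_extend[OF c(2) y0 smooth_fun_chart[OF f U]] by blast
  define g where "g = hadamard_quotient F' y\<^sub>0"
  note h = hadamard[OF F'(1), where y\<^sub>0 = y\<^sub>0, folded g_def]
  define W where "W = N \<inter> (U \<inter> \<phi> -` ball y\<^sub>0 e)"
  have "open (U \<inter> \<phi> -` ball y\<^sub>0 e)"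
    using c(1,5) by (simp add: continuous_on_open_vimage Int_commute)
  then have W: "open W" "W \<subseteq> U" "p \<in> W" using N F'(2) pU by (auto simp: W_def y\<^sub>0_def)
  obtain \<eta> :: "'m \<Rightarrow> real" and N' where \<eta>: "smooth_fun A \<eta>" "p \<in> N'" "\<And>x. x \<in> N' \<Longrightarrow> \<eta> x = 1"
    "\<And>x. x \<notin> W \<Longrightarrow> \<eta> x = 0"
    "\<And>g :: 'e \<Rightarrow> real. smooth_on (\<phi> ` W) g \<Longrightarrow> smooth_fun A (\<lambda>x. if x \<in> W then \<eta> x * g (\<phi> x) else 0)"
    by (rule chart_bump[OF A U W]) blast
  define G where "G b = (\<lambda>x. if x \<in> W then \<eta> x * g b (\<phi> x) else 0)" for b
  have G: "smooth_fun A (G b)" for b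
    unfolding G_def by (rule \<eta>(5)[OF smooth_on_subset[OF h(1)]]) simp
  have xbs: "smooth_fun A (xb b)" for b unfolding xb_def by (rule x)
  have xc: "smooth_fun A (\<lambda>x. xb b x + (- (y\<^sub>0 \<bullet> b)))" for b
    by (intro smooth_fun_add smooth_fun_const A xbs)
  have fc: "smooth_fun A (\<lambda>x. f x + (- f p))" by (intro smooth_fun_add smooth_fun_const A f)
  have \<eta>c: "smooth_fun A (\<lambda>x. 1 - \<eta> x)" by (intro smooth_fun_diff smooth_fun_const A \<eta>)
  \<comment> \<open>On \<open>W\<close> this is Hadamard's expansion multiplied by
    \<open>\<eta>\<close>, off \<open>W\<close> a tautology. Both factors of the middle product
    vanish at \<open>p\<close>, so the derivation annihilates it; in the last sum only the first
    factors vanish there, which leaves D(x_b) times a partial derivative.\<close>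
  have dec: "f x = f p + ((1 - \<eta> x) * (f x + (- f p)) + (\<Sum>b\<in>Basis. (xb b x + (- (y\<^sub>0 \<bullet> b))) * G b x))" for x
  proof (cases "x \<in> W")
    case True
    then have xx: "x \<in> N" "x \<in> U" "\<phi> x \<in> ball y\<^sub>0 e" by (auto simp: W_def)
    have "f x = F' (\<phi> x)" "f p = F' y\<^sub>0"
      using F'(2,4) xx c(4) pU by (auto simp: y\<^sub>0_def)
    then have "f x - f p = (\<Sum>b\<in>Basis. ((\<phi> x - y\<^sub>0) \<bullet> b) * g b (\<phi> x))"
      using h(2)[of "\<phi> x"] by simp
    then have "\<eta> x * (f x - f p) = (\<Sum>b\<in>Basis. (xb b x + (- (y\<^sub>0 \<bullet> b))) * G b x)"
      using True xx \<rho> by (simp add: xb_def G_def sum_distrib_left inner_diff_left algebra_simps)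
    then show ?thesis by (simp add: algebra_simps)
  next
    case False
    then show ?thesis using \<eta>(4) by (simp add: G_def)
  qed
  have sG: "smooth_fun A (\<lambda>x. (xb b x + (- (y\<^sub>0 \<bullet> b))) * G b x)" for b
    by (intro smooth_fun_mult A xc G)
  have sM: "smooth_fun A (\<lambda>x. (1 - \<eta> x) * (f x + (- f p)))" by (intro smooth_fun_mult A \<eta>c fc)
  have "D f = D (\<lambda>x. f p + ((1 - \<eta> x) * (f x + (- f p)) + (\<Sum>b\<in>Basis. (xb b x + (- (y\<^sub>0 \<bullet> b))) * G b x)))"
    using dec by presburger
  also have "\<dots> = D (\<lambda>x. f p) + (D (\<lambda>x. (1 - \<eta> x) * (f x + (- f p))) +
      D (\<lambda>x. \<Sum>b\<in>Basis. (xb b x + (- (y\<^sub>0 \<bullet> b))) * G b x))"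
    by (simp only: derivation_atD(1)[OF D smooth_fun_const[OF A] smooth_fun_add[OF A sM smooth_fun_sum[OF A sG]]]
        derivation_atD(1)[OF D sM smooth_fun_sum[OF A sG]])
  also have "D (\<lambda>x. f p) = 0" by (rule derivation_const[OF A D])
  also have "D (\<lambda>x. (1 - \<eta> x) * (f x + (- f p))) = 0"
    using derivation_atD(3)[OF D \<eta>c fc] \<eta>(2,3) by simp
  also have "D (\<lambda>x. \<Sum>b\<in>Basis. (xb b x + (- (y\<^sub>0 \<bullet> b))) * G b x) =
      (\<Sum>b\<in>Basis. D (\<lambda>x. (xb b x + (- (y\<^sub>0 \<bullet> b))) * G b x))"
    by (rule derivation_sum[OF A D sG])
  also have "\<dots> = (\<Sum>b\<in>Basis. D (xb b) * frechet_derivative F' (at y\<^sub>0) b)"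
  proof (rule sum.cong[OF refl])
    fix b :: 'e
    have "D (\<lambda>x. xb b x + (- (y\<^sub>0 \<bullet> b))) = D (xb b)"
      by (simp only: derivation_atD(1)[OF D xbs smooth_fun_const[OF A]] derivation_const[OF A D] add_0_right)
    moreover have "xb b p = y\<^sub>0 \<bullet> b" using pU \<rho> N by (simp add: xb_def y\<^sub>0_def)
    moreover have "G b p = frechet_derivative F' (at y\<^sub>0) b"
      using W \<eta>(2,3) h(3)[of b] by (simp add: G_def y\<^sub>0_def)
    ultimately show "D (\<lambda>x. (xb b x + (- (y\<^sub>0 \<bullet> b))) * G b x) = D (xb b) * frechet_derivative F' (at y\<^sub>0) b"
      using derivation_atD(3)[OF D xc[of b] G[of b]] by simp
  qed
  also have "frechet_derivative F' (at y\<^sub>0) = frechet_derivative (f \<circ> inv_into U \<phi>) (at y\<^sub>0)"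
    by (rule frechet_derivative_cong_open[of "ball y\<^sub>0 e"]) (use F' in auto)
  finally show ?thesis by (simp add: xb_def y\<^sub>0_def)
qed

section \<open>Smooth ordinary differential equations\<close>

text \<open>Banach's fixed point theorem for the integral equation, on the complete space of bounded
  continuous functions on the whole line.\<close>

lemma picard_lindeloef:
  fixes W :: "'e::euclidean_space \<Rightarrow> 'e"
  assumes K: "K > 0" and lip: "\<And>x y. dist (W x) (W y) \<le> K * dist x y"
  obtains \<epsilon> y where "\<epsilon> > 0" "y 0 = y\<^sub>0" "\<And>s. \<bar>s\<bar> < \<epsilon> \<Longrightarrow> (y has_vector_derivative W (y s)) (at s)"
proof -
  \<comment> \<open>The two integrals in \<open>T\<close> run over lengths at most 2 \<epsilon> and
    \<epsilon>, so the contraction constant is 3 K \<epsilon> = 1/2.\<close>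
  define \<epsilon> where "\<epsilon> = 1 / (6 * K)"
  have \<epsilon>: "\<epsilon> > 0" using K by (simp add: \<epsilon>_def)
  \<comment> \<open>Clamping time to [-\<epsilon>, \<epsilon>] makes the image of every function
    under \<open>T\<close> bounded on the whole line.\<close>
  define c where "c s = max (- \<epsilon>) (min \<epsilon> s)" for s
  have c: "- \<epsilon> \<le> c s" "c s \<le> \<epsilon>" for s using \<epsilon> by (auto simp: c_def)
  have Wc: "continuous_on UNIV W"
    unfolding continuous_on_iff
  proof (intro ballI allI impI)
    fix x :: 'e and e :: real assume "e > 0"
    then show "\<exists>d>0. \<forall>x'\<in>UNIV. dist x' x < d \<longrightarrow> dist (W x') (W x) < e"
      using K lip by (intro exI[of _ "e / K"]) (auto simp: field_simps intro: le_less_trans)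
  qed
  \<comment> \<open>The oriented integral from 0 to \<open>c s\<close>, written with lower limit
    -\<epsilon> because an integral over a reversed interval is 0 here.\<close>
  define T where "T f s = y\<^sub>0 + integral {- \<epsilon>..c s} (\<lambda>r. W (f r)) - integral {- \<epsilon>..0} (\<lambda>r. W (f r))"
    for f :: "real \<Rightarrow> 'e" and s
  have Wf: "continuous_on S (\<lambda>r. W (apply_bcontfun f r))" for S and f :: "real \<Rightarrow>\<^sub>C 'e"
    by (rule continuous_on_compose2[OF Wc]) auto
  have T: "T (apply_bcontfun f) \<in> bcontfun" for f
  proof -
    have ic: "continuous_on {- \<epsilon>..\<epsilon>} (\<lambda>u. integral {- \<epsilon>..u} (\<lambda>r. W (apply_bcontfun f r)))"
      by (intro indefinite_integral_continuous_1 integrable_continuous_real Wf)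
    have cc: "continuous_on UNIV c" unfolding c_def by (intro continuous_intros)
    have "continuous_on UNIV (T (apply_bcontfun f))" unfolding T_def
      by (intro continuous_intros continuous_on_compose2[OF ic cc]) (use c in auto)
    moreover have "range (T (apply_bcontfun f)) \<subseteq>
        (\<lambda>u. y\<^sub>0 + integral {- \<epsilon>..u} (\<lambda>r. W (apply_bcontfun f r)) - integral {- \<epsilon>..0} (\<lambda>r. W (apply_bcontfun f r))) ` {- \<epsilon>..\<epsilon>}"
      using c by (auto simp: T_def)
    moreover have "compact ((\<lambda>u. y\<^sub>0 + integral {- \<epsilon>..u} (\<lambda>r. W (apply_bcontfun f r)) - integral {- \<epsilon>..0} (\<lambda>r. W (apply_bcontfun f r))) ` {- \<epsilon>..\<epsilon>})"
      by (intro compact_continuous_image continuous_intros ic compact_Icc)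
    ultimately show ?thesis
      unfolding bcontfun_def using bounded_subset compact_imp_bounded by blast
  qed
  define TT where "TT f = Bcontfun (T (apply_bcontfun f))" for f
  have TT: "apply_bcontfun (TT f) = T (apply_bcontfun f)" for f
    unfolding TT_def by (rule Bcontfun_inverse[OF T])
  have contr: "dist (TT f) (TT g) \<le> 1 / 2 * dist f g" for f g
  proof (rule dist_bound)
    fix s
    define h where "h r = W (apply_bcontfun f r) - W (apply_bcontfun g r)" for r
    have h: "norm (h r) \<le> K * dist f g" for r
      using lip[of "apply_bcontfun f r" "apply_bcontfun g r"] dist_bounded[of f r g] K
      by (auto simp: h_def dist_norm[symmetric] intro: order_trans mult_left_mono)
    have hc: "continuous_on S h" for S unfolding h_def by (intro continuous_intros Wf)
    have bnd: "norm (integral {- \<epsilon>..u} h) \<le> K * dist f g * (u - (- \<epsilon>))" if "- \<epsilon> \<le> u" for u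
      by (rule integral_bound[OF that hc h])
    have "dist (apply_bcontfun (TT f) s) (apply_bcontfun (TT g) s) =
        norm (integral {- \<epsilon>..c s} h - integral {- \<epsilon>..0} h)"
      unfolding TT T_def h_def dist_norm
      by (subst (1 2) integral_diff) (auto intro: integrable_continuous_real Wf simp: algebra_simps)
    also have "\<dots> \<le> norm (integral {- \<epsilon>..c s} h) + norm (integral {- \<epsilon>..0} h)" by (rule norm_triangle_ineq4)
    also have "\<dots> \<le> K * dist f g * (c s - (- \<epsilon>)) + K * dist f g * (0 - (- \<epsilon>))"
      using c \<epsilon> by (intro add_mono bnd) auto
    also have "\<dots> \<le> K * dist f g * (2 * \<epsilon>) + K * dist f g * \<epsilon>"
      using K c[of s] by (intro add_mono mult_left_mono) auto
    also have "\<dots> = 1 / 2 * dist f g" using K by (simp add: \<epsilon>_def field_simps)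
    finally show "dist (apply_bcontfun (TT f) s) (apply_bcontfun (TT g) s) \<le> 1 / 2 * dist f g" .
  qed
  have "\<exists>!f. TT f = f" by (rule banach_fix_type[of "1 / 2"]) (use contr in auto)
  then obtain f where f: "TT f = f" by blast
  define y where "y = apply_bcontfun f"
  have y: "y s = T y s" for s using TT[of f] f by (simp add: y_def)
  show thesis
  proof
    show "\<epsilon> > 0" by (rule \<epsilon>)
    show "y 0 = y\<^sub>0" using \<epsilon> unfolding y[of 0] by (simp add: T_def c_def)
    fix s assume s: "\<bar>s\<bar> < \<epsilon>"
    have "((\<lambda>u. integral {- \<epsilon>..u} (\<lambda>r. W (y r))) has_vector_derivative W (y s)) (at s within {- \<epsilon>..\<epsilon>})"
      by (rule integral_has_vector_derivative) (use s Wf[of _ f] in \<open>auto simp: y_def\<close>)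
    then have "((\<lambda>u. integral {- \<epsilon>..u} (\<lambda>r. W (y r))) has_vector_derivative W (y s)) (at s)"
      using s by (simp add: at_within_Icc_at)
    then have hd: "((\<lambda>u. y\<^sub>0 + integral {- \<epsilon>..u} (\<lambda>r. W (y r)) - integral {- \<epsilon>..0} (\<lambda>r. W (y r))) has_vector_derivative W (y s)) (at s)"
      by (auto intro!: derivative_eq_intros)
    moreover have eq: "y\<^sub>0 + integral {- \<epsilon>..u} (\<lambda>r. W (y r)) - integral {- \<epsilon>..0} (\<lambda>r. W (y r)) = y u"
      if "u \<in> {- \<epsilon><..<\<epsilon>}" for u
    proof -
      have "c u = u" using that by (simp add: c_def)
      then show ?thesis using y[of u] by (simp add: T_def)
    qed
    ultimately show "(y has_vector_derivative W (y s)) (at s)"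
      using s by (intro has_vector_derivative_transform_within_open[OF hd, of "{- \<epsilon><..<\<epsilon>}"]) auto
  qed
qed

text \<open>Bootstrapping: if \<open>y\<close> has order k, so has its derivative V(y), and
  \<open>y\<close> gains one order.\<close>

lemma smooth_on_ode:
  fixes y :: "real \<Rightarrow> 'e::euclidean_space"
  assumes I: "open I" and S: "open S" and V: "smooth_on S V" and y: "\<And>s. s \<in> I \<Longrightarrow> y s \<in> S"
    and d: "\<And>s. s \<in> I \<Longrightarrow> (y has_vector_derivative V (y s)) (at s)"
  shows "smooth_on I y"
proof -
  have "Ck k I y" for k
  proof (induction k)
    case 0
    then show ?case using d by (auto simp: differentiable_def has_vector_derivative_def)
  next
    case (Suc k)
    have "Ck k I (\<lambda>s. V (y s))"
      using V by (intro Ck_compose[OF I S y Suc]) (auto simp: smooth_on_iff_Ck)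
    then show ?case
      using d by (intro Ck_SucI[OF I, where D = "\<lambda>s h. h *\<^sub>R V (y s)"])
        (auto simp: has_vector_derivative_def intro: Ck_linear_comp[OF I bounded_linear_scaleR_right])
  qed
  then show ?thesis by (simp add: smooth_on_iff_Ck)
qed

text \<open>\<open>V\<close> is Lipschitz only on compact convex pieces of \<open>S\<close>.
  Composed with the nearest-point projection to a closed ball it becomes globally Lipschitz; the
  solution stays in the ball for a short time, and there the projection does nothing.\<close>

lemma smooth_ode_local_solution:
  fixes V :: "'e::euclidean_space \<Rightarrow> 'e"
  assumes S: "open S" "y\<^sub>0 \<in> S" and V: "smooth_on S V"
  obtains \<epsilon> y where "\<epsilon> > 0" "y 0 = y\<^sub>0" "\<And>s. \<bar>s\<bar> < \<epsilon> \<Longrightarrow> y s \<in> S"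
    "\<And>s. \<bar>s\<bar> < \<epsilon> \<Longrightarrow> (y has_vector_derivative V (y s)) (at s)" "smooth_on {- \<epsilon><..<\<epsilon>} y"
proof -
  obtain r where r: "r > 0" "cball y\<^sub>0 r \<subseteq> S" using S open_contains_cball by blast
  define B where "B = cball y\<^sub>0 r"
  have B: "convex B" "closed B" "B \<noteq> {}" "compact B" using r by (auto simp: B_def)
  have "\<exists>K>0. \<forall>x\<in>B. \<forall>y\<in>B. dist (V x) (V y) \<le> K * dist x y"
  proof -
    have "\<exists>M. \<forall>x\<in>B. norm (frechet_derivative V (at x) b) \<le> M" for b
    proof -
      have "continuous_on B (\<lambda>x. frechet_derivative V (at x) b)"
        by (rule continuous_on_subset[OF smooth_on_continuous_on[OF smooth_on_imp_frechet[OF V]]])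
          (use r in \<open>auto simp: B_def\<close>)
      then have "bounded ((\<lambda>x. frechet_derivative V (at x) b) ` B)"
        by (intro compact_imp_bounded compact_continuous_image B)
      then show ?thesis by (auto simp: bounded_iff)
    qed
    then obtain M where M: "\<And>b x. x \<in> B \<Longrightarrow> norm (frechet_derivative V (at x) b) \<le> M b" by metis
    \<comment> \<open>The operator norm is at most the sum of the norms on basis vectors; the
      summand 1 makes the constant positive also when \<open>V\<close> is constant.\<close>
    define K where "K = (\<Sum>b\<in>Basis. \<bar>M b\<bar>) + 1"
    have Kpos: "K > 0" unfolding K_def by (intro add_nonneg_pos sum_nonneg) auto
    have on: "onorm (frechet_derivative V (at x)) \<le> K" if x: "x \<in> B" for x
    proof (rule onorm_le)
      fix v :: 'e
      have "x \<in> S" using x r by (auto simp: B_def)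
      then have lin: "linear (frechet_derivative V (at x))"
        using smooth_on_has_derivative[OF V] has_derivative_linear by blast
      have "norm (frechet_derivative V (at x) (\<Sum>b\<in>Basis. (v \<bullet> b) *\<^sub>R b)) \<le>
          (\<Sum>b\<in>Basis. \<bar>v \<bullet> b\<bar> * norm (frechet_derivative V (at x) b))"
        unfolding linear_sum[OF lin] linear_cmul[OF lin]
        by (rule order_trans[OF norm_sum]) simp
      also have "\<dots> \<le> (\<Sum>b\<in>Basis. norm v * \<bar>M b\<bar>)"
        by (intro sum_mono mult_mono Basis_le_norm) (use M[OF x] in \<open>auto intro: order_trans[OF _ abs_ge_self]\<close>)
      also have "\<dots> \<le> K * norm v" by (simp add: K_def sum_distrib_left[symmetric] algebra_simps)
      finally show "norm (frechet_derivative V (at x) v) \<le> K * norm v"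
        unfolding euclidean_representation .
    qed
    have "dist (V x) (V y) \<le> K * dist x y" if "x \<in> B" "y \<in> B" for x y
      unfolding dist_norm
    proof (rule differentiable_bound[OF B(1) _ on that])
      fix z assume "z \<in> B"
      then have "z \<in> S" using r by (auto simp: B_def)
      then show "(V has_derivative frechet_derivative V (at z)) (at z within B)"
        by (rule has_derivative_at_withinI[OF smooth_on_has_derivative[OF V]])
    qed
    then show ?thesis using Kpos by blast
  qed
  then obtain K where K: "K > 0" "\<And>x y. x \<in> B \<Longrightarrow> y \<in> B \<Longrightarrow> dist (V x) (V y) \<le> K * dist x y" by blast
  define W where "W x = V (closest_point B x)" for x
  have cp: "closest_point B x \<in> B" for x by (rule closest_point_in_set[OF B(2,3)])
  have "dist (W x) (W y) \<le> K * dist x y" for x y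
    unfolding W_def
    using K(2)[OF cp[of x] cp[of y]] mult_left_mono[OF closest_point_lipschitz[OF B(1-3), of x y], of K] K(1)
    by linarith
  then obtain \<epsilon> y where y: "\<epsilon> > 0" "y 0 = y\<^sub>0" "\<And>s. \<bar>s\<bar> < \<epsilon> \<Longrightarrow> (y has_vector_derivative W (y s)) (at s)"
    using picard_lindeloef[OF K(1), where W = W and y\<^sub>0 = y\<^sub>0] by blast
  have "isCont y 0" using y(1) y(3)[of 0] has_vector_derivative_continuous by auto
  then obtain d where d: "d > 0" "\<And>s. dist s 0 < d \<Longrightarrow> dist (y s) (y 0) < r"
    using r(1) unfolding continuous_at_eps_delta by blast
  define e where "e = min d \<epsilon>"
  have yB: "y s \<in> ball y\<^sub>0 r" if "\<bar>s\<bar> < e" for s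
    using d(2)[of s] that y(2) by (simp add: e_def dist_commute)
  have yd: "(y has_vector_derivative V (y s)) (at s)" if "\<bar>s\<bar> < e" for s
  proof -
    have "y s \<in> B" using yB[OF that] by (auto simp: B_def)
    then show ?thesis using y(3)[of s] that closest_point_self[of "y s" B] by (simp add: W_def e_def)
  qed
  have yS: "y s \<in> S" if "\<bar>s\<bar> < e" for s using yB[OF that] r by auto
  show thesis
  proof
    show "e > 0" using d y by (simp add: e_def)
    show "smooth_on {- e<..<e} y"
      by (rule smooth_on_ode[OF _ S(1) V]) (use yS yd in auto)
  qed (use y yS yd in auto)
qed

text \<open>Total differentiability gives D(1, 1) = D(1, 0) + D(0, 1). It differentiates expressions
  in which the parameter occurs twice.\<close>

lemma has_real_derivative_diagonal:
  fixes m :: "real \<times> real \<Rightarrow> real"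
  assumes m: "m differentiable at (a, a)"
    and d: "((\<lambda>h. m (h, a)) has_real_derivative d\<^sub>1) (at a)" "((\<lambda>h. m (a, h)) has_real_derivative d\<^sub>2) (at a)"
  shows "((\<lambda>h. m (h, h)) has_real_derivative d\<^sub>1 + d\<^sub>2) (at a)"
proof -
  define D where "D = frechet_derivative m (at (a, a))"
  have D: "(m has_derivative D) (at (a, a))" using m by (simp add: D_def frechet_derivative_works)
  then have lin: "linear D" by (rule has_derivative_linear)
  have *: "((\<lambda>h. m (p h)) has_real_derivative D v) (at a)"
    if "(p has_vector_derivative v) (at a)" "p a = (a, a)" for p v
  proof -
    have "(m has_derivative D) (at (p a))" using D that by simp
    from has_derivative_compose[OF that(1)[unfolded has_vector_derivative_def] this]
    show ?thesis unfolding has_field_derivative_def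
      by (rule has_derivative_eq_rhs) (simp add: linear_cmul[OF lin] mult.commute fun_eq_iff)
  qed
  have "((\<lambda>h. m (h, a)) has_real_derivative D (1, 0)) (at a)"
    by (rule *) (auto intro!: derivative_eq_intros simp: has_vector_derivative_def)
  then have 1: "d\<^sub>1 = D (1, 0)" using d DERIV_unique by blast
  have "((\<lambda>h. m (a, h)) has_real_derivative D (0, 1)) (at a)"
    by (rule *) (auto intro!: derivative_eq_intros simp: has_vector_derivative_def)
  then have 2: "d\<^sub>2 = D (0, 1)" using d DERIV_unique by blast
  have "((\<lambda>h. m (h, h)) has_real_derivative D (1, 1)) (at a)"
    by (rule *) (auto intro!: derivative_eq_intros simp: has_vector_derivative_def)
  then show ?thesis using linear_add[OF lin, of "(1, 0)" "(0, 1)"] by (simp add: 1 2)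
qed

lemma smooth_on_along_curve:
  assumes A: "smooth_atlas A" and f: "smooth_map_on S euclidean_atlas A c" and S: "open S"
    and g: "smooth_fun A g"
  shows "smooth_on S (\<lambda>s. g (c s))"
  using smooth_map_on_compose[OF smooth_atlas_euclidean A smooth_atlas_euclidean S open_UNIV f, of g] g
  by (simp add: smooth_map_on_euclidean_iff smooth_fun_def smooth_map_on_UNIV)

section \<open>Derivations on a Lie group\<close>

context lie_group
begin

lemma smooth_map_mult:
  assumes B: "smooth_atlas B" and f: "smooth_map B A f" and g: "smooth_map B A g"
  shows "smooth_map B A (\<lambda>x. f x \<otimes> g x)"
  using smooth_map_compose[OF B smooth_atlas_prod[OF atlas atlas] atlas
      smooth_map_Pair[OF B atlas atlas f g] smooth_mult] by simp

lemma smooth_map_on_mult: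
  assumes B: "smooth_atlas B" and S: "open S" and f: "smooth_map_on S B A f" and g: "smooth_map_on S B A g"
  shows "smooth_map_on S B A (\<lambda>x. f x \<otimes> g x)"
  using smooth_map_on_compose[OF B smooth_atlas_prod[OF atlas atlas] atlas S open_UNIV
      smooth_map_on_Pair[OF B atlas atlas S f g], of "\<lambda>(x, y). x \<otimes> y"] smooth_mult
  by (simp add: smooth_map_on_UNIV)

lemma smooth_map_on_inv:
  assumes B: "smooth_atlas B" and S: "open S" and f: "smooth_map_on S B A f"
  shows "smooth_map_on S B A (\<lambda>x. inv (f x))"
  using smooth_map_on_compose[OF B atlas atlas S open_UNIV f, of "\<lambda>x. inv x"] smooth_inv
  by (simp add: smooth_map_on_UNIV)

lemma smooth_fun_left: "smooth_fun A f \<Longrightarrow> smooth_fun A (\<lambda>y. f (p \<otimes> y))"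
  by (rule smooth_fun_pullback[OF atlas atlas
        smooth_map_mult[OF atlas smooth_map_const[OF atlas atlas] smooth_map_ident[OF atlas]]])

lemma smooth_fun_right: "smooth_fun A f \<Longrightarrow> smooth_fun A (\<lambda>y. f (y \<otimes> p))"
  by (rule smooth_fun_pullback[OF atlas atlas
        smooth_map_mult[OF atlas smooth_map_ident[OF atlas] smooth_map_const[OF atlas atlas]]])

lemma group_simps [simp]:
  "x \<otimes> \<one> = x" "\<one> \<otimes> x = x" "inv x \<otimes> x = \<one>" "x \<otimes> inv x = \<one>" "x \<otimes> y \<otimes> z = x \<otimes> (y \<otimes> z)"
  "inv x \<otimes> (x \<otimes> y) = y" "x \<otimes> (inv x \<otimes> y) = y"
  using carrier_eq_UNIV by (auto simp: m_assoc simp flip: m_assoc)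

lemma lie_algebra_derivation: "X \<in> lie_algebra G A \<Longrightarrow> derivation_at A \<one> X"
  unfolding lie_algebra_def derivation_at_def by blast

text \<open>This derivation is the value at \<open>p\<close> of the left-invariant field of
  \<open>X\<close>.\<close>

lemma left_translate_derivation:
  assumes "derivation_at A \<one> X"
  shows "derivation_at A p (\<lambda>f. X (\<lambda>y. f (p \<otimes> y)))"
  unfolding derivation_at_def
proof (intro conjI allI impI)
  fix f g :: "'g \<Rightarrow> real" assume fg: "smooth_fun A f" "smooth_fun A g"
  show "X (\<lambda>y. f (p \<otimes> y) + g (p \<otimes> y)) = X (\<lambda>y. f (p \<otimes> y)) + X (\<lambda>y. g (p \<otimes> y))"
    by (rule derivation_atD(1)[OF assms fg[THEN smooth_fun_left]])
  show "X (\<lambda>y. f (p \<otimes> y) * g (p \<otimes> y)) = f p * X (\<lambda>y. g (p \<otimes> y)) + g p * X (\<lambda>y. f (p \<otimes> y))"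
    using derivation_atD(3)[OF assms fg[THEN smooth_fun_left]] by simp
next
  fix c and f :: "'g \<Rightarrow> real" assume f: "smooth_fun A f"
  show "X (\<lambda>y. c * f (p \<otimes> y)) = c * X (\<lambda>y. f (p \<otimes> y))"
    by (rule derivation_atD(2)[OF assms smooth_fun_left[OF f] smooth_fun_left[OF f]])
qed

text \<open>The coordinates of the tangent vector are the values of \<open>X\<close> on the
  coordinate functions, cut off so as to be defined on all of the group.\<close>

lemma tangent_vector:
  assumes X: "derivation_at A \<one> X" and U: "(U, \<phi>) \<in> A" "\<one> \<in> U"
  obtains v where "\<And>f. smooth_fun A f \<Longrightarrow> X f = frechet_derivative (f \<circ> inv_into U \<phi>) (at (\<phi> \<one>)) v"
proof -
  note c = smooth_atlasD[OF atlas U(1)]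
  obtain \<rho> :: "'g \<Rightarrow> real" and N where \<rho>: "open N" "\<one> \<in> N" "N \<subseteq> U" "\<And>x. x \<in> N \<Longrightarrow> \<rho> x = 1"
    "\<And>g :: 'e \<Rightarrow> real. smooth_on (\<phi> ` U) g \<Longrightarrow> smooth_fun A (\<lambda>x. if x \<in> U then \<rho> x * g (\<phi> x) else 0)"
    by (rule chart_bump[OF atlas U(1) c(1) order_refl U(2)]) blast
  have x: "smooth_fun A (\<lambda>x. if x \<in> U then \<rho> x * (\<phi> x \<bullet> b) else 0)" for b
    by (rule \<rho>(5)) (intro smooth_on_linear c bounded_linear_inner_left)
  define v where "v = (\<Sum>b\<in>Basis. X (\<lambda>x. if x \<in> U then \<rho> x * (\<phi> x \<bullet> b) else 0) *\<^sub>R b)"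
  show thesis
  proof
    fix f :: "'g \<Rightarrow> real" assume f: "smooth_fun A f"
    have "linear (frechet_derivative (f \<circ> inv_into U \<phi>) (at (\<phi> \<one>)))"
      using smooth_on_has_derivative[OF smooth_fun_chart[OF f U(1)]] U(2) has_derivative_linear by blast
    then show "X f = frechet_derivative (f \<circ> inv_into U \<phi>) (at (\<phi> \<one>)) v"
      using derivation_chart[OF atlas U(1) \<rho>(1,3,2,4) x X f]
      by (simp add: v_def linear_sum linear_cmul)
  qed
qed

lemma smooth_on_prod_chart:
  assumes B: "smooth_atlas B" and H: "smooth_fun (prod_atlas B A) H" and W: "(W, \<theta>) \<in> B" and U: "(U, \<phi>) \<in> A"
  shows "smooth_on (\<theta> ` W \<times> \<phi> ` U) (\<lambda>p. H (inv_into W \<theta> (fst p), inv_into U \<phi> (snd p)))"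
proof -
  have "(W \<times> U, map_prod \<theta> \<phi>) \<in> prod_atlas B A" using U W by (auto simp: prod_atlas_def)
  from smooth_fun_chart[OF H this]
  have "smooth_on (\<theta> ` W \<times> \<phi> ` U) (H \<circ> inv_into (W \<times> U) (map_prod \<theta> \<phi>))"
    by (simp add: map_prod_surj_on)
  then show ?thesis
    by (rule smooth_on_cong[OF open_Times[OF smooth_atlasD(2)[OF B W] smooth_atlasD(2)[OF atlas U]], rotated])
      (simp add: prod_chart_simps[OF B atlas W U])
qed

lemma derivation_slice:
  assumes v: "\<And>f. smooth_fun A f \<Longrightarrow> X f = frechet_derivative (f \<circ> inv_into U \<phi>) (at (\<phi> \<one>)) v"
    and U: "(U, \<phi>) \<in> A" "\<one> \<in> U"
    and B: "smooth_atlas B" and H: "smooth_fun (prod_atlas B A) H" and W: "(W, \<theta>) \<in> B" and u: "u \<in> \<theta> ` W"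
  shows "X (\<lambda>z. H (inv_into W \<theta> u, z)) =
    frechet_derivative (\<lambda>p. H (inv_into W \<theta> (fst p), inv_into U \<phi> (snd p))) (at (u, \<phi> \<one>)) (0, v)"
proof -
  define F where "F = (\<lambda>p. H (inv_into W \<theta> (fst p), inv_into U \<phi> (snd p)))"
  have F: "smooth_on (\<theta> ` W \<times> \<phi> ` U) F" unfolding F_def by (rule smooth_on_prod_chart[OF B H W U(1)])
  have "smooth_map A (prod_atlas B A) (\<lambda>z. (inv_into W \<theta> u, z))"
    by (intro smooth_map_Pair atlas B smooth_map_const smooth_map_ident)
  from smooth_fun_pullback[OF atlas smooth_atlas_prod[OF B atlas] this H]
  have "smooth_fun A (\<lambda>z. H (inv_into W \<theta> u, z))" .
  from v[OF this]
  have "X (\<lambda>z. H (inv_into W \<theta> u, z)) = frechet_derivative (\<lambda>w. F (u, w)) (at (\<phi> \<one>)) v"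
    by (simp add: F_def o_def)
  also have "((\<lambda>w. F (u, w)) has_derivative (\<lambda>h. frechet_derivative F (at (u, \<phi> \<one>)) (0, h))) (at (\<phi> \<one>))"
    by (rule has_derivative_compose[of "\<lambda>w. (u, w)" "\<lambda>h. (0, h)", OF _ smooth_on_has_derivative[OF F]])
      (use u U(2) in \<open>auto intro!: derivative_eq_intros\<close>)
  from frechet_derivative_at[OF this]
  have "frechet_derivative (\<lambda>w. F (u, w)) (at (\<phi> \<one>)) v = frechet_derivative F (at (u, \<phi> \<one>)) (0, v)"
    by metis
  finally show ?thesis by (simp add: F_def)
qed

text \<open>In charts, applying \<open>X\<close> in the second variable is a partial derivative in
  the fixed direction (0, v), hence smooth in the other variable. In particular the left-invariant
  field of \<open>X\<close> preserves smooth functions.\<close>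

lemma derivation_smooth_parameter:
  assumes X: "derivation_at A \<one> X" and B: "smooth_atlas B" and H: "smooth_fun (prod_atlas B A) H"
  shows "smooth_fun B (\<lambda>x. X (\<lambda>z. H (x, z)))"
proof (rule smooth_funI[OF B])
  fix W \<theta> assume W: "(W, \<theta>) \<in> B"
  obtain U \<phi> where U: "(U, \<phi>) \<in> A" "\<one> \<in> U" using smooth_atlas_cover[OF atlas] by blast
  obtain v where v: "\<And>f. smooth_fun A f \<Longrightarrow> X f = frechet_derivative (f \<circ> inv_into U \<phi>) (at (\<phi> \<one>)) v"
    by (rule tangent_vector[OF X U]) blast
  define F where "F = (\<lambda>p. H (inv_into W \<theta> (fst p), inv_into U \<phi> (snd p)))"
  have F: "smooth_on (\<theta> ` W \<times> \<phi> ` U) F" unfolding F_def by (rule smooth_on_prod_chart[OF B H W U(1)])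
  have o: "open (\<theta> ` W)" "open (\<theta> ` W \<times> \<phi> ` U)"
    using smooth_atlasD(2)[OF B W] smooth_atlasD(2)[OF atlas U(1)] by (auto intro: open_Times)
  have "smooth_on (\<theta> ` W) (\<lambda>u. frechet_derivative F (at (u, \<phi> \<one>)) (0, v))"
    by (rule smooth_on_compose[OF o _ smooth_on_Pair[OF o(1) smooth_on_ident[OF o(1)] smooth_on_const[OF o(1)]]
          smooth_on_imp_frechet[OF F]]) (use U in auto)
  then show "smooth_on (\<theta> ` W) ((\<lambda>x. X (\<lambda>z. H (x, z))) \<circ> inv_into W \<theta>)"
    by (rule smooth_on_cong[OF o(1), rotated]) (simp add: derivation_slice[OF v U B H W] F_def)
qed

text \<open>The group counterpart of \<open>has_real_derivative_diagonal\<close>: in a chart the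
  direction (v, v) splits into (v, 0) and (0, v).\<close>

lemma derivation_diagonal:
  assumes X: "derivation_at A \<one> X" and H: "smooth_fun (prod_atlas A A) H"
  shows "X (\<lambda>z. H (z, z)) = X (\<lambda>z. H (z, \<one>)) + X (\<lambda>z. H (\<one>, z))"
proof -
  obtain U \<phi> where U: "(U, \<phi>) \<in> A" "\<one> \<in> U" using smooth_atlas_cover[OF atlas] by blast
  obtain v where v: "\<And>f. smooth_fun A f \<Longrightarrow> X f = frechet_derivative (f \<circ> inv_into U \<phi>) (at (\<phi> \<one>)) v"
    by (rule tangent_vector[OF X U]) blast
  define F where "F = (\<lambda>p. H (inv_into U \<phi> (fst p), inv_into U \<phi> (snd p)))"
  have F: "smooth_on (\<phi> ` U \<times> \<phi> ` U) F" unfolding F_def by (rule smooth_on_prod_chart[OF atlas H U(1,1)])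
  define D where "D = frechet_derivative F (at (\<phi> \<one>, \<phi> \<one>))"
  have D: "(F has_derivative D) (at (\<phi> \<one>, \<phi> \<one>))"
    unfolding D_def using U(2) by (intro smooth_on_has_derivative[OF F]) auto
  then have lin: "linear D" by (rule has_derivative_linear)
  have inv1: "inv_into U \<phi> (\<phi> \<one>) = \<one>" using smooth_atlasD(4)[OF atlas U(1)] U(2) by simp
  have *: "X f = D (p' v)"
    if "smooth_fun A f" "f \<circ> inv_into U \<phi> = (\<lambda>w. F (p w))" "(p has_derivative p') (at (\<phi> \<one>))"
      "p (\<phi> \<one>) = (\<phi> \<one>, \<phi> \<one>)" for f p p'
  proof -
    have "((\<lambda>w. F (p w)) has_derivative (\<lambda>h. D (p' h))) (at (\<phi> \<one>))"
      by (rule has_derivative_compose[OF that(3)]) (use D that(4) in simp)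
    from frechet_derivative_at[OF this] show ?thesis using v[OF that(1)] that(2) by metis
  qed
  have sm: "smooth_fun A (\<lambda>z. H (f z, g z))" if "smooth_map A A f" "smooth_map A A g" for f g
    by (rule smooth_fun_pullback[OF atlas smooth_atlas_prod[OF atlas atlas] smooth_map_Pair[OF atlas atlas atlas that] H])
  note i = smooth_map_ident[OF atlas] smooth_map_const[OF atlas atlas]
  have "X (\<lambda>z. H (z, z)) = D (v, v)"
    by (rule *[OF sm[OF i(1,1)], where p = "\<lambda>w. (w, w)" and p' = "\<lambda>h. (h, h)"]) (auto simp: F_def intro!: derivative_eq_intros)
  moreover have "X (\<lambda>z. H (z, \<one>)) = D (v, 0)"
    by (rule *[OF sm[OF i(1,2)], where p = "\<lambda>w. (w, \<phi> \<one>)" and p' = "\<lambda>h. (h, 0)"])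
      (auto simp: F_def inv1 intro!: derivative_eq_intros)
  moreover have "X (\<lambda>z. H (\<one>, z)) = D (0, v)"
    by (rule *[OF sm[OF i(2,1)], where p = "\<lambda>w. (\<phi> \<one>, w)" and p' = "\<lambda>h. (0, h)"])
      (auto simp: F_def inv1 intro!: derivative_eq_intros)
  ultimately show ?thesis using linear_add[OF lin, of "(v, 0)" "(0, v)"] by simp
qed

end

section \<open>One-parameter subgroups\<close>

context lie_group
begin

lemma smooth_fun_mult_map: "smooth_fun A f \<Longrightarrow> smooth_fun (prod_atlas A A) (\<lambda>p. f (fst p \<otimes> snd p))"
  by (rule smooth_fun_pullback[OF smooth_atlas_prod[OF atlas atlas] atlas
        smooth_map_mult[OF smooth_atlas_prod[OF atlas atlas] smooth_map_fst[OF atlas atlas] smooth_map_snd[OF atlas atlas]]])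

lemma derivation_left_field:
  "derivation_at A \<one> X \<Longrightarrow> smooth_fun A f \<Longrightarrow> smooth_fun A (\<lambda>x. X (\<lambda>z. f (x \<otimes> z)))"
  using derivation_smooth_parameter[OF _ atlas smooth_fun_mult_map] by fastforce

text \<open>The function g(x y^(-1)) is constant on the diagonal, so its two partial contributions
  cancel.\<close>

lemma derivation_inverse:
  assumes X: "derivation_at A \<one> X" and g: "smooth_fun A g"
  shows "X (\<lambda>y. g (inv y)) = - X g"
proof -
  have P: "smooth_atlas (prod_atlas A A)" by (rule smooth_atlas_prod[OF atlas atlas])
  have "smooth_map (prod_atlas A A) A (\<lambda>p. fst p \<otimes> inv (snd p))"
    by (rule smooth_map_mult[OF P smooth_map_fst[OF atlas atlas]
          smooth_map_compose[OF P atlas atlas smooth_map_snd[OF atlas atlas] smooth_inv]])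
  from smooth_fun_pullback[OF P atlas this g]
  have "smooth_fun (prod_atlas A A) (\<lambda>p. g (fst p \<otimes> inv (snd p)))" .
  from derivation_diagonal[OF X this] show ?thesis
    using derivation_const[OF atlas X, of "g \<one>"] by simp
qed

text \<open>An integral curve of the left-invariant field through the identity, with the
  differential equation tested on smooth functions instead of written in coordinates.\<close>

definition local_flow :: "(('g \<Rightarrow> real) \<Rightarrow> real) \<Rightarrow> real \<Rightarrow> (real \<Rightarrow> 'g) \<Rightarrow> bool" where
  "local_flow X \<epsilon> c \<longleftrightarrow> \<epsilon> > 0 \<and> c 0 = \<one> \<and> smooth_map_on {- \<epsilon><..<\<epsilon>} euclidean_atlas A c \<and>
     (\<forall>f s. smooth_fun A f \<longrightarrow> \<bar>s\<bar> < \<epsilon> \<longrightarrow>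
        ((\<lambda>s. f (c s)) has_real_derivative X (\<lambda>y. f (c s \<otimes> y))) (at s))"

text \<open>\<open>V\<close> collects the coordinates of the left-invariant field. The equation is
  solved inside the image of \<open>N\<close>, where the cutoff is 1: there
  \<open>derivation_chart\<close> applies at every point of the curve and turns the coordinate
  equation into the tested one.\<close>

lemma ex_local_flow:
  assumes X: "derivation_at A \<one> X"
  obtains \<epsilon> c where "local_flow X \<epsilon> c"
proof -
  obtain U \<phi> where U: "(U, \<phi>) \<in> A" "\<one> \<in> U" using smooth_atlas_cover[OF atlas] by blast
  note c = smooth_atlasD[OF atlas U(1)]
  obtain \<rho> :: "'g \<Rightarrow> real" and N where \<rho>: "open N" "\<one> \<in> N" "N \<subseteq> U" "\<And>x. x \<in> N \<Longrightarrow> \<rho> x = 1"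
    "\<And>g :: 'e \<Rightarrow> real. smooth_on (\<phi> ` U) g \<Longrightarrow> smooth_fun A (\<lambda>x. if x \<in> U then \<rho> x * g (\<phi> x) else 0)"
    by (rule chart_bump[OF atlas U(1) c(1) order_refl U(2)]) blast
  define xb where "xb b = (\<lambda>x. if x \<in> U then \<rho> x * (\<phi> x \<bullet> b) else 0)" for b
  have x: "smooth_fun A (xb b)" for b
    unfolding xb_def by (rule \<rho>(5)) (intro smooth_on_linear c bounded_linear_inner_left)
  define V where "V y = (\<Sum>b\<in>Basis. ((\<lambda>x. X (\<lambda>z. xb b (x \<otimes> z))) \<circ> inv_into U \<phi>) y *\<^sub>R b)" for y
  have V: "smooth_on (\<phi> ` U) V" unfolding V_def
    by (intro smooth_on_sum smooth_on_scaleR smooth_on_const c(2)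
        smooth_fun_chart[OF derivation_left_field[OF X x] U(1)])
  have oN: "open (\<phi> ` N)" by (rule open_chart_image[OF atlas U(1) \<rho>(1,3)])
  obtain \<epsilon> y where y: "\<epsilon> > 0" "y 0 = \<phi> \<one>" "\<And>s. \<bar>s\<bar> < \<epsilon> \<Longrightarrow> y s \<in> \<phi> ` N"
    "\<And>s. \<bar>s\<bar> < \<epsilon> \<Longrightarrow> (y has_vector_derivative V (y s)) (at s)" "smooth_on {- \<epsilon><..<\<epsilon>} y"
  proof (rule smooth_ode_local_solution[OF oN, of "\<phi> \<one>" V])
    show "\<phi> \<one> \<in> \<phi> ` N" using \<rho>(2) by blast
    show "smooth_on (\<phi> ` N) V" by (rule smooth_on_subset[OF V]) (use \<rho>(3) in blast)
  qed blast
  have yU: "y s \<in> \<phi> ` U" if "\<bar>s\<bar> < \<epsilon>" for s using y(3)[OF that] \<rho>(3) by blast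
  define c where "c s = inv_into U \<phi> (y s)" for s
  have inj: "inv_into U \<phi> (\<phi> x) = x" if "x \<in> U" for x using smooth_atlasD(4)[OF atlas U(1)] that by simp
  have "local_flow X \<epsilon> c"
    unfolding local_flow_def
  proof (intro conjI allI impI)
    show "\<epsilon> > 0" by (rule y)
    show "c 0 = \<one>" using inj U(2) by (simp add: c_def y(2))
    show "smooth_map_on {- \<epsilon><..<\<epsilon>} euclidean_atlas A c" unfolding c_def
      by (rule smooth_map_on_compose[OF smooth_atlas_euclidean smooth_atlas_euclidean atlas _
            smooth_atlasD(2)[OF atlas U(1)] _ smooth_map_on_inv_chart[OF atlas U(1)]])
        (use y(5) yU in \<open>auto simp: smooth_map_on_euclidean_iff abs_less_iff\<close>)
    fix f :: "'g \<Rightarrow> real" and s :: real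
    assume f: "smooth_fun A f" and s: "\<bar>s\<bar> < \<epsilon>"
    obtain p where p: "p \<in> N" "y s = \<phi> p" using y(3)[OF s] by blast
    have cs: "c s = p" using p \<rho>(3) inj by (auto simp: c_def)
    define DF where "DF = frechet_derivative (f \<circ> inv_into U \<phi>) (at (\<phi> p))"
    have DF: "(f \<circ> inv_into U \<phi> has_derivative DF) (at (y s))"
      unfolding DF_def p(2) by (rule smooth_on_has_derivative[OF smooth_fun_chart[OF f U(1)]]) (use p \<rho> in auto)
    then have lin: "linear DF" by (rule has_derivative_linear)
    have "((\<lambda>s. (f \<circ> inv_into U \<phi>) (y s)) has_real_derivative DF (V (y s))) (at s)"
      unfolding has_field_derivative_def
      by (rule has_derivative_eq_rhs[OF has_derivative_compose[OF y(4)[OF s, unfolded has_vector_derivative_def] DF]])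
        (simp add: linear_cmul[OF lin] mult.commute fun_eq_iff)
    moreover have "DF (V (y s)) = X (\<lambda>y. f (c s \<otimes> y))"
    proof -
      have pU: "p \<in> U" using p \<rho>(3) by blast
      have "DF (V (y s)) = (\<Sum>b\<in>Basis. X (\<lambda>z. xb b (p \<otimes> z)) * DF b)"
        by (simp add: V_def p(2) inj[OF pU] linear_sum[OF lin] linear_cmul[OF lin])
      also have "\<dots> = X (\<lambda>y. f (p \<otimes> y))"
        using derivation_chart[OF atlas U(1) \<rho>(1,3) p(1) \<rho>(4) x[unfolded xb_def] left_translate_derivation[OF X, of p] f]
        by (simp add: xb_def DF_def)
      finally show ?thesis by (simp add: cs)
    qed
    ultimately show "((\<lambda>s. f (c s)) has_real_derivative X (\<lambda>y. f (c s \<otimes> y))) (at s)"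
      by (simp add: c_def o_def)
  qed
  then show thesis by (rule that)
qed

lemma inv_mult: "inv (x \<otimes> y) = inv y \<otimes> inv x"
  using carrier_eq_UNIV by (intro inv_mult_group) auto

lemma eq_if_mult_inv: "x \<otimes> inv y = z \<Longrightarrow> x = z \<otimes> y"
  by (metis group_simps(1,3,5))

text \<open>The quotient c(s + t) c(t)^(-1) has zero derivative in t when tested on any smooth
  function, hence equals its value c(s) at t = 0; smooth functions separate points.\<close>

lemma local_flow_add:
  assumes X: "derivation_at A \<one> X" and c: "local_flow X \<epsilon> c"
    and s: "\<bar>s\<bar> < \<epsilon> / 2" and t: "\<bar>t\<bar> < \<epsilon> / 2"
  shows "c (s + t) = c s \<otimes> c t"
proof -
  have \<epsilon>: "\<epsilon> > 0" and c0: "c 0 = \<one>" and csm: "smooth_map_on {- \<epsilon><..<\<epsilon>} euclidean_atlas A c"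
    and cd: "\<And>f s. smooth_fun A f \<Longrightarrow> \<bar>s\<bar> < \<epsilon> \<Longrightarrow>
        ((\<lambda>s. f (c s)) has_real_derivative X (\<lambda>y. f (c s \<otimes> y))) (at s)"
    using c by (auto simp: local_flow_def)
  define I where "I = {- (\<epsilon> / 2)<..<\<epsilon> / 2}"
  have oI: "open (I \<times> I)" by (auto simp: I_def intro: open_Times)
  have "f (c (s + t) \<otimes> inv (c t)) = f (c s)" if f: "smooth_fun A f" for f :: "'g \<Rightarrow> real"
  proof -
    define m where "m = (\<lambda>p. f (c (s + fst p) \<otimes> inv (c (snd p))))"
    have "smooth_map_on (I \<times> I) euclidean_atlas A (\<lambda>p. c (s + fst p) \<otimes> inv (c (snd p)))"
    proof (intro smooth_map_on_mult smooth_map_on_inv smooth_atlas_euclidean oI)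
      show "smooth_map_on (I \<times> I) euclidean_atlas A (\<lambda>p. c (s + fst p))"
        by (rule smooth_map_on_compose[OF smooth_atlas_euclidean smooth_atlas_euclidean atlas oI _ _ csm])
          (use s in \<open>auto simp: smooth_map_on_euclidean_iff I_def intro!: smooth_on_add smooth_on_const smooth_on_fst oI[unfolded I_def]\<close>)
      show "smooth_map_on (I \<times> I) euclidean_atlas A (\<lambda>p. c (snd p))"
        by (rule smooth_map_on_compose[OF smooth_atlas_euclidean smooth_atlas_euclidean atlas oI _ _ csm])
          (use \<epsilon> in \<open>auto simp: smooth_map_on_euclidean_iff I_def intro!: smooth_on_snd oI[unfolded I_def]\<close>)
    qed
    from smooth_on_along_curve[OF atlas this oI f] have m: "smooth_on (I \<times> I) m" by (simp add: m_def)
    have "((\<lambda>h. m (h, h)) has_real_derivative 0) (at \<tau>)" if \<tau>: "\<tau> \<in> I" for \<tau>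
    proof -
      define p a where "p = c (s + \<tau>)" and "a = inv (c \<tau>)"
      \<comment> \<open>Both occurrences of the parameter insert a factor at the same place between
        \<open>p\<close> and \<open>a\<close>: the first inserts y, the second its inverse. By
        \<open>derivation_inverse\<close> their contributions are X g and -X g.\<close>
      define g where "g y = f (p \<otimes> (y \<otimes> a))" for y
      have g: "smooth_fun A g" unfolding g_def using smooth_fun_right[OF smooth_fun_left[OF f]] by simp
      have "((\<lambda>h. f (c h \<otimes> a)) has_real_derivative X (\<lambda>y. f (c (s + \<tau>) \<otimes> y \<otimes> a))) (at (s + \<tau>))"
        by (rule cd[OF smooth_fun_right[OF f]]) (use s \<tau> in \<open>auto simp: I_def abs_less_iff\<close>)
      then have "((\<lambda>h. m (h, \<tau>)) has_real_derivative X g) (at \<tau>)"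
        using DERIV_shift[of "\<lambda>h. f (c h \<otimes> a)" _ \<tau> s] by (simp add: m_def g_def[abs_def] a_def p_def add.commute)
      moreover have "((\<lambda>h. m (\<tau>, h)) has_real_derivative - X g) (at \<tau>)"
      proof -
        have "smooth_fun A (\<lambda>q. f (p \<otimes> inv q))"
          by (rule smooth_fun_pullback[OF atlas atlas smooth_inv smooth_fun_left[OF f]])
        from cd[OF this, of \<tau>]
        have "((\<lambda>h. f (p \<otimes> inv (c h))) has_real_derivative X (\<lambda>y. f (p \<otimes> inv (c \<tau> \<otimes> y)))) (at \<tau>)"
          using \<tau> \<epsilon> by (auto simp: I_def abs_less_iff)
        moreover have "X (\<lambda>y. f (p \<otimes> inv (c \<tau> \<otimes> y))) = - X g"
          using derivation_inverse[OF X g] by (simp add: g_def a_def inv_mult)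
        ultimately show ?thesis by (simp add: m_def p_def)
      qed
      moreover have "m differentiable at (\<tau>, \<tau>)" using smooth_on_differentiable[OF m] \<tau> by blast
      ultimately show ?thesis using has_real_derivative_diagonal by fastforce
    qed
    then have "m (t, t) = m (0, 0)"
      using t \<epsilon> by (intro DERIV_isconst3[of "- (\<epsilon> / 2)" "\<epsilon> / 2" t 0 "\<lambda>h. m (h, h)"]) (auto simp: I_def abs_less_iff)
    moreover have "inv \<one> = \<one>" by simp
    ultimately show ?thesis by (simp add: m_def c0)
  qed
  then have "c (s + t) \<otimes> inv (c t) = c s"
    using smooth_fun_separates[OF atlas] by metis
  then show ?thesis by (rule eq_if_mult_inv)
qed

text \<open>The local homomorphism \<open>c\<close> is extended by \<gamma>(t) = c(t/n)^n for large
  n; any two admissible n are compared through their product. Smoothness near any point follows from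
  that near 0 by left translation.\<close>

lemma ex_one_parameter_subgroup:
  assumes X: "derivation_at A \<one> X"
  obtains \<gamma> where "one_parameter_subgroup G A X \<gamma>"
proof -
  obtain \<epsilon> c where c: "local_flow X \<epsilon> c" by (rule ex_local_flow[OF X])
  have \<epsilon>: "\<epsilon> > 0" and c0: "c 0 = \<one>" and csm: "smooth_map_on {- \<epsilon><..<\<epsilon>} euclidean_atlas A c"
    and cd: "\<And>f s. smooth_fun A f \<Longrightarrow> \<bar>s\<bar> < \<epsilon> \<Longrightarrow>
        ((\<lambda>s. f (c s)) has_real_derivative X (\<lambda>y. f (c s \<otimes> y))) (at s)"
    using c by (auto simp: local_flow_def)
  have carr [simp]: "x \<in> carrier G" for x using carrier_eq_UNIV by simp
  have cadd: "c (s + t) = c s \<otimes> c t" if "\<bar>s\<bar> < \<epsilon> / 2" "\<bar>t\<bar> < \<epsilon> / 2" for s t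
    by (rule local_flow_add[OF X c that])
  have pow: "c (real m * r) = c r [^] m" if "real m * \<bar>r\<bar> < \<epsilon> / 2" for m r
    using that
  proof (induction m)
    case (Suc m)
    have "real m * \<bar>r\<bar> + \<bar>r\<bar> < \<epsilon> / 2" using Suc.prems by (simp add: algebra_simps)
    moreover have "0 \<le> real m * \<bar>r\<bar>" "0 \<le> \<bar>r\<bar>" by auto
    ultimately have "real m * \<bar>r\<bar> < \<epsilon> / 2" "\<bar>r\<bar> < \<epsilon> / 2" by linarith+
    then show ?case using Suc.IH cadd[of "real m * r" r] by (simp add: algebra_simps abs_mult)
  qed (simp add: c0)
  have indep: "c (t / real n) [^] n = c (t / real m) [^] m"
    if "n > 0" "m > 0" "\<bar>t\<bar> / real n < \<epsilon> / 2" "\<bar>t\<bar> / real m < \<epsilon> / 2" for t n m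
  proof -
    have *: "c (t / real k) [^] k = c (t / (real k * real l)) [^] (l * k)"
      if "k > 0" "l > 0" "\<bar>t\<bar> / real k < \<epsilon> / 2" for k l :: nat
      using pow[of l "t / (real k * real l)"] that by (simp add: nat_pow_pow abs_mult field_simps)
    show ?thesis using *[of n m] *[of m n] that by (simp add: mult.commute)
  qed
  \<comment> \<open>This explicit n makes |t|/n smaller than \<epsilon>/2, where \<open>c\<close> is
    additive.\<close>
  define \<gamma> where "\<gamma> t = (let n = Suc (nat \<lceil>2 * \<bar>t\<bar> / \<epsilon>\<rceil>) in c (t / real n) [^] n)" for t
  have \<gamma>: "\<gamma> t = c (t / real n) [^] n" if "n > 0" "\<bar>t\<bar> / real n < \<epsilon> / 2" for t n
  proof -
    define k where "k = Suc (nat \<lceil>2 * \<bar>t\<bar> / \<epsilon>\<rceil>)"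
    have "2 * \<bar>t\<bar> / \<epsilon> < real k" "real k > 0" unfolding k_def by linarith+
    then have "\<bar>t\<bar> / real k < \<epsilon> / 2" using \<epsilon> by (simp add: field_simps)
    then show ?thesis using indep[of k n t] that by (simp add: \<gamma>_def Let_def k_def)
  qed
  have \<gamma>_small: "\<gamma> t = c t" if "\<bar>t\<bar> < \<epsilon> / 2" for t
    using \<gamma>[of 1 t] that by simp
  have hom: "\<gamma> (s + t) = \<gamma> s \<otimes> \<gamma> t" for s t
  proof -
    define n where "n = Suc (nat \<lceil>2 * (\<bar>s\<bar> + \<bar>t\<bar>) / \<epsilon>\<rceil>)"
    have "2 * (\<bar>s\<bar> + \<bar>t\<bar>) / \<epsilon> < real n" "real n > 0" unfolding n_def by linarith+
    then have n: "(\<bar>s\<bar> + \<bar>t\<bar>) / real n < \<epsilon> / 2" "n > 0" using \<epsilon> by (auto simp: field_simps)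
    have "\<bar>s\<bar> / real n \<le> (\<bar>s\<bar> + \<bar>t\<bar>) / real n" "\<bar>t\<bar> / real n \<le> (\<bar>s\<bar> + \<bar>t\<bar>) / real n"
      "\<bar>s + t\<bar> / real n \<le> (\<bar>s\<bar> + \<bar>t\<bar>) / real n" by (auto intro!: divide_right_mono)
    with n have b: "\<bar>s\<bar> / real n < \<epsilon> / 2" "\<bar>t\<bar> / real n < \<epsilon> / 2" "\<bar>s + t\<bar> / real n < \<epsilon> / 2" by linarith+
    have st: "c (s / real n + t / real n) = c (s / real n) \<otimes> c (t / real n)"
      "c (t / real n + s / real n) = c (t / real n) \<otimes> c (s / real n)"
      using b by (intro cadd; simp add: abs_divide)+
    \<comment> \<open>Commutativity comes from that of addition in the parameter, and lets the n-th
      power of the product be split.\<close>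
    then have comm: "c (s / real n) \<otimes> c (t / real n) = c (t / real n) \<otimes> c (s / real n)"
      by (simp add: add.commute)
    have "\<gamma> (s + t) = (c (s / real n) \<otimes> c (t / real n)) [^] n"
      using \<gamma>[OF n(2) b(3)] st(1) by (simp add: add_divide_distrib)
    also have "\<dots> = c (s / real n) [^] n \<otimes> c (t / real n) [^] n"
      by (rule pow_mult_distrib[OF comm]) auto
    finally show ?thesis using \<gamma>[OF n(2) b(1)] \<gamma>[OF n(2) b(2)] by simp
  qed
  have "one_parameter_subgroup G A X \<gamma>"
    unfolding one_parameter_subgroup_def
  proof (intro conjI allI impI)
    show "smooth_map euclidean_atlas A \<gamma>"
      unfolding smooth_map_on_UNIV[symmetric]
    proof (rule smooth_map_on_local)
      fix t\<^sub>0 :: real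
      define T where "T = ball t\<^sub>0 (\<epsilon> / 2)"
      have T: "open T" by (simp add: T_def)
      have "smooth_map_on T euclidean_atlas A (\<lambda>t. c (t - t\<^sub>0))"
        by (rule smooth_map_on_compose[OF smooth_atlas_euclidean smooth_atlas_euclidean atlas T _ _ csm])
          (use \<epsilon> in \<open>auto simp: smooth_map_on_euclidean_iff T_def dist_real_def abs_if split: if_splits
            intro!: smooth_on_diff smooth_on_const smooth_on_ident\<close>)
      then have "smooth_map_on T euclidean_atlas A (\<lambda>t. \<gamma> t\<^sub>0 \<otimes> c (t - t\<^sub>0))"
        by (intro smooth_map_on_mult smooth_atlas_euclidean T
            smooth_map_on_of_smooth_map[OF smooth_map_const[OF smooth_atlas_euclidean atlas]])
      then have "smooth_map_on T euclidean_atlas A \<gamma>"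
      proof (rule smooth_map_on_cong[OF smooth_atlas_euclidean atlas T])
        fix t assume "t \<in> T"
        then have "\<gamma> (t - t\<^sub>0) = c (t - t\<^sub>0)" by (intro \<gamma>_small) (simp add: T_def dist_real_def abs_minus_commute)
        then show "\<gamma> t\<^sub>0 \<otimes> c (t - t\<^sub>0) = \<gamma> t" using hom[of t\<^sub>0 "t - t\<^sub>0"] by simp
      qed
      then show "\<exists>T. open T \<and> t\<^sub>0 \<in> T \<and> smooth_map_on T euclidean_atlas A \<gamma>"
        using T \<epsilon> by (intro exI[of _ T]) (auto simp: T_def)
    qed
    show "\<gamma> (s + t) = \<gamma> s \<otimes> \<gamma> t" for s t by (rule hom)
    fix f :: "'g \<Rightarrow> real" assume f: "smooth_fun A f"
    have "((\<lambda>s. f (c s)) has_real_derivative X f) (at 0)" using cd[OF f, of 0] \<epsilon> by (simp add: c0)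
    then show "((\<lambda>s. f (\<gamma> s)) has_real_derivative X f) (at 0)"
      by (rule has_field_derivative_transform_within_open[of _ _ _ "{- (\<epsilon> / 2)<..<\<epsilon> / 2}"])
        (use \<epsilon> \<gamma>_small in \<open>auto simp: abs_less_iff\<close>)
  qed
  then show thesis by (rule that)
qed

section \<open>Uniqueness of one-parameter subgroups and the exponential map\<close>

lemma one_parameter_subgroup_0: "one_parameter_subgroup G A X \<gamma> \<Longrightarrow> \<gamma> 0 = \<one>"
proof -
  assume "one_parameter_subgroup G A X \<gamma>"
  then have "\<gamma> (0 + 0) = \<gamma> 0 \<otimes> \<gamma> 0" unfolding one_parameter_subgroup_def by blast
  then have "inv \<gamma> 0 \<otimes> \<gamma> 0 = inv \<gamma> 0 \<otimes> (\<gamma> 0 \<otimes> \<gamma> 0)" by simp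
  then show ?thesis by simp
qed

text \<open>The curve \<gamma>(s) \<eta>(-s) is constant. The definition gives derivatives at 0
  only, so the homomorphism property moves the base point s into the test function, as left and
  right factors.\<close>

lemma one_parameter_subgroup_unique:
  assumes \<gamma>: "one_parameter_subgroup G A X \<gamma>" and \<eta>: "one_parameter_subgroup G A X \<eta>"
  shows "\<gamma> = \<eta>"
proof
  fix s
  note g = \<gamma>[unfolded one_parameter_subgroup_def] and e = \<eta>[unfolded one_parameter_subgroup_def]
  have gh: "\<gamma> (s + t) = \<gamma> s \<otimes> \<gamma> t" "\<eta> (s + t) = \<eta> s \<otimes> \<eta> t" for s t using g e by blast+
  have 0: "\<gamma> 0 = \<one>" "\<eta> 0 = \<one>" using \<gamma> \<eta> by (auto intro: one_parameter_subgroup_0)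
  have "f (\<gamma> s \<otimes> \<eta> (- s)) = f \<one>" if f: "smooth_fun A f" for f :: "'g \<Rightarrow> real"
  proof -
    have "((\<lambda>h. f (\<gamma> h \<otimes> \<eta> (- h))) has_real_derivative 0) (at s)" for s
    proof -
      define F where "F y = f (\<gamma> s \<otimes> (y \<otimes> \<eta> (- s)))" for y
      have F: "smooth_fun A F" unfolding F_def using smooth_fun_right[OF smooth_fun_left[OF f]] by simp
      define m where "m = (\<lambda>p :: real \<times> real. F (\<gamma> (fst p) \<otimes> \<eta> (- snd p)))"
      have E: "smooth_atlas (euclidean_atlas :: (real \<times> real, _) chart set)" by (rule smooth_atlas_euclidean)
      have "smooth_map euclidean_atlas A (\<lambda>p :: real \<times> real. \<gamma> (fst p) \<otimes> \<eta> (- snd p))"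
      proof (intro smooth_map_mult[OF E])
        show "smooth_map euclidean_atlas A (\<lambda>p :: real \<times> real. \<gamma> (fst p))"
          by (rule smooth_map_compose[OF E smooth_atlas_euclidean atlas])
            (use g in \<open>auto simp: smooth_map_euclidean_iff smooth_on_fst\<close>)
        show "smooth_map euclidean_atlas A (\<lambda>p :: real \<times> real. \<eta> (- snd p))"
          by (rule smooth_map_compose[OF E smooth_atlas_euclidean atlas])
            (use e in \<open>auto simp: smooth_map_euclidean_iff intro!: smooth_on_minus smooth_on_snd\<close>)
      qed
      from smooth_fun_pullback[OF E atlas this F] have "smooth_on UNIV m"
        by (simp add: m_def smooth_fun_def smooth_map_euclidean_iff)
      then have md: "m differentiable at (0, 0)" using smooth_on_differentiable by blast
      have "((\<lambda>h. m (h, 0)) has_real_derivative X F) (at 0)" using g F by (simp add: m_def 0)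
      moreover have "((\<lambda>h. m (0, h)) has_real_derivative - X F) (at 0)"
        using DERIV_mirror[of "\<lambda>h. F (\<eta> h)" "X F" 0] e F by (simp add: m_def 0)
      ultimately have d: "((\<lambda>h. m (h, h)) has_real_derivative 0) (at 0)"
        using has_real_derivative_diagonal[OF md] by fastforce
      have "m (h, h) = f (\<gamma> (s + h) \<otimes> \<eta> (- (s + h)))" for h
      proof -
        have "- (s + h) = - h + - s" by simp
        then have "\<eta> (- (s + h)) = \<eta> (- h) \<otimes> \<eta> (- s)" using gh(2) by presburger
        then show ?thesis unfolding gh(1) by (simp add: m_def F_def)
      qed
      then show ?thesis
        using d DERIV_shift[of "\<lambda>h. f (\<gamma> h \<otimes> \<eta> (- h))" 0 0 s] by (simp add: add.commute)
    qed
    then show ?thesis using DERIV_isconst_all[of "\<lambda>h. f (\<gamma> h \<otimes> \<eta> (- h))" s 0] by (simp add: 0)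
  qed
  then have "\<gamma> s \<otimes> \<eta> (- s) = \<one>" using smooth_fun_separates[OF atlas] by metis
  then have "\<gamma> s \<otimes> \<eta> (- s) \<otimes> \<eta> s = \<eta> s" by simp
  moreover have "\<eta> (- s) \<otimes> \<eta> s = \<one>" using gh(2)[of "- s" s] 0 by simp
  ultimately show "\<gamma> s = \<eta> s" by simp
qed

text \<open>Rescaling time by s turns the subgroup of X into one for sX; uniqueness makes it the
  value of the definite description in \<open>lie_exp\<close>, evaluated at 1.\<close>

lemma lie_exp_eq:
  assumes \<gamma>: "one_parameter_subgroup G A X \<gamma>"
  shows "lie_exp G A (\<lambda>g. s * X g) = \<gamma> s"
proof -
  have "one_parameter_subgroup G A (\<lambda>g. s * X g) (\<lambda>r. \<gamma> (s * r))"
    unfolding one_parameter_subgroup_def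
  proof (intro conjI allI impI)
    show "smooth_map euclidean_atlas A (\<lambda>r. \<gamma> (s * r))"
      by (rule smooth_map_compose[OF smooth_atlas_euclidean smooth_atlas_euclidean atlas])
        (use \<gamma> in \<open>auto simp: one_parameter_subgroup_def smooth_map_euclidean_iff
          intro!: smooth_on_mult smooth_on_const smooth_on_ident\<close>)
    show "\<gamma> (s * (r + t)) = \<gamma> (s * r) \<otimes> \<gamma> (s * t)" for r t
      using \<gamma> by (simp add: one_parameter_subgroup_def distrib_left)
    fix f :: "'g \<Rightarrow> real" assume "smooth_fun A f"
    then have 1: "((\<lambda>s. f (\<gamma> s)) has_real_derivative X f) (at (s * 0))"
      using \<gamma> by (simp add: one_parameter_subgroup_def)
    have 2: "((\<lambda>r. s * r) has_real_derivative s) (at 0)" by (auto intro!: derivative_eq_intros)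
    show "((\<lambda>r. f (\<gamma> (s * r))) has_real_derivative s * X f) (at 0)"
      using DERIV_chain2[of "\<lambda>s. f (\<gamma> s)" "X f" "\<lambda>r. s * r" 0 s, OF 1 2] by (simp add: mult.commute)
  qed
  then have "(THE \<gamma>. one_parameter_subgroup G A (\<lambda>g. s * X g) \<gamma>) = (\<lambda>r. \<gamma> (s * r))"
    using one_parameter_subgroup_unique by (intro the_equality) auto
  then show ?thesis by (simp add: lie_exp_def)
qed

end

section \<open>Derivatives and integrals with respect to a real parameter\<close>

text \<open>A derivative on a manifold times the line that needs no chart; along a flow parameter it
  will express both derivatives occurring in the operator.\<close>

definition partial_last :: "('m \<times> real \<Rightarrow> 'b::real_normed_vector) \<Rightarrow> 'm \<times> real \<Rightarrow> 'b" where
  "partial_last \<Psi> q = vector_derivative (\<lambda>r. \<Psi> (fst q, r)) (at (snd q))"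

lemma smooth_on_prod_euclidean_chart:
  assumes A: "smooth_atlas A" and \<Psi>: "smooth_fun (prod_atlas A euclidean_atlas) \<Psi>" and U: "(U, \<phi>) \<in> A"
  shows "smooth_on (\<phi> ` U \<times> UNIV) (\<lambda>p. \<Psi> (inv_into U \<phi> (fst p), snd p))"
proof -
  have E: "(UNIV, id) \<in> euclidean_atlas" by (simp add: euclidean_atlas_def)
  have "(U \<times> UNIV, map_prod \<phi> id) \<in> prod_atlas A euclidean_atlas"
    using U E unfolding prod_atlas_def by blast
  from smooth_fun_chart[OF \<Psi> this]
  have "smooth_on (\<phi> ` U \<times> UNIV) (\<Psi> \<circ> inv_into (U \<times> UNIV) (map_prod \<phi> id))"
    by (simp add: map_prod_surj_on)
  then show ?thesis
    by (rule smooth_on_cong[OF open_Times[OF smooth_atlasD(2)[OF A U] open_UNIV], rotated])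
      (simp add: prod_chart_simps[OF A smooth_atlas_euclidean U E] inv_into_UNIV_id)
qed

lemma smooth_fun_partial_last:
  fixes \<Psi> :: "'m::topological_space \<times> real \<Rightarrow> 'b::euclidean_space"
  assumes A: "smooth_atlas A" and \<Psi>: "smooth_fun (prod_atlas A euclidean_atlas) \<Psi>"
  shows "((\<lambda>r. \<Psi> (p, r)) has_vector_derivative partial_last \<Psi> (p, s)) (at s)"
    and "smooth_fun (prod_atlas A euclidean_atlas) (partial_last \<Psi>)"
proof -
  have *: "((\<lambda>r. \<Psi> (inv_into U \<phi> y, r)) has_vector_derivative
      frechet_derivative (\<lambda>p. \<Psi> (inv_into U \<phi> (fst p), snd p)) (at (y, s)) (0, 1)) (at s)"
    if U: "(U, \<phi>) \<in> A" "y \<in> \<phi> ` U" for U \<phi> y s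
  proof -
    define F where "F = (\<lambda>p. \<Psi> (inv_into U \<phi> (fst p), snd p))"
    have "(F has_derivative frechet_derivative F (at (y, s))) (at (y, s))"
      unfolding F_def by (rule smooth_on_has_derivative[OF smooth_on_prod_euclidean_chart[OF A \<Psi> U(1)]]) (use U in auto)
    moreover from this have lin: "linear (frechet_derivative F (at (y, s)))" by (rule has_derivative_linear)
    moreover have "((\<lambda>r. (y, r)) has_derivative (\<lambda>h. (0, h))) (at s)" by (auto intro!: derivative_eq_intros)
    ultimately have d: "((\<lambda>r. F (y, r)) has_derivative (\<lambda>h. frechet_derivative F (at (y, s)) (0, h))) (at s)"
      using has_derivative_compose by blast
    have "frechet_derivative F (at (y, s)) (0, h) = h *\<^sub>R frechet_derivative F (at (y, s)) (0, 1)" for h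
      using linear_cmul[OF lin, of h "(0, 1)"] by simp
    then have "(\<lambda>h. frechet_derivative F (at (y, s)) (0, h)) = (\<lambda>h. h *\<^sub>R frechet_derivative F (at (y, s)) (0, 1))"
      by (rule ext)
    from has_derivative_eq_rhs[OF d this] show ?thesis unfolding has_vector_derivative_def F_def by simp
  qed
  show "((\<lambda>r. \<Psi> (p, r)) has_vector_derivative partial_last \<Psi> (p, s)) (at s)"
  proof -
    obtain U \<phi> where U: "(U, \<phi>) \<in> A" "p \<in> U" using smooth_atlas_cover[OF A] by blast
    have "inv_into U \<phi> (\<phi> p) = p" using smooth_atlasD(4)[OF A U(1)] U(2) by simp
    with *[OF U(1) imageI[OF U(2)], of s] have "(\<lambda>r. \<Psi> (p, r)) differentiable at s"
      using differentiableI_vector by auto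
    then show ?thesis unfolding partial_last_def fst_conv snd_conv vector_derivative_works .
  qed
  show "smooth_fun (prod_atlas A euclidean_atlas) (partial_last \<Psi>)"
  proof (rule smooth_funI[OF smooth_atlas_prod[OF A smooth_atlas_euclidean]])
    fix P \<pi> assume "(P, \<pi>) \<in> prod_atlas A (euclidean_atlas :: (real, real) chart set)"
    then obtain U \<phi> V \<psi> where U: "(U, \<phi>) \<in> A" and V: "(V, \<psi>) \<in> (euclidean_atlas :: (real, real) chart set)"
      and P: "P = U \<times> V" "\<pi> = map_prod \<phi> \<psi>" by (rule prod_atlasE)
    define F where "F = (\<lambda>p. \<Psi> (inv_into U \<phi> (fst p), snd p))"
    have F: "smooth_on (\<phi> ` U \<times> UNIV) (\<lambda>p. frechet_derivative F (at p) (0, 1))"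
      unfolding F_def by (rule smooth_on_imp_frechet[OF smooth_on_prod_euclidean_chart[OF A \<Psi> U]])
    have VV: "V = UNIV" "\<psi> = id" using V by (auto simp: euclidean_atlas_def)
    have "\<pi> ` P = \<phi> ` U \<times> UNIV" by (simp add: P VV map_prod_surj_on)
    moreover have "frechet_derivative F (at q) (0, 1) = (partial_last \<Psi> \<circ> inv_into P \<pi>) q"
      if q: "q \<in> \<phi> ` U \<times> UNIV" for q
    proof -
      have "inv_into P \<pi> q = (inv_into U \<phi> (fst q), snd q)"
        using q prod_chart_simps[OF A smooth_atlas_euclidean U V] by (simp add: P VV inv_into_UNIV_id)
      moreover have "vector_derivative (\<lambda>r. \<Psi> (inv_into U \<phi> (fst q), r)) (at (snd q)) = frechet_derivative F (at q) (0, 1)"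
        using vector_derivative_at[OF *[OF U, of "fst q" "snd q"]] q by (auto simp: F_def)
      ultimately show ?thesis by (simp add: partial_last_def)
    qed
    ultimately show "smooth_on (\<pi> ` P) (partial_last \<Psi> \<circ> inv_into P \<pi>)"
      using smooth_on_cong[OF open_Times[OF smooth_atlasD(2)[OF A U] open_UNIV] _ F, of "partial_last \<Psi> \<circ> inv_into P \<pi>"]
      by simp
  qed
qed

lemma smooth_fun_slice:
  assumes A: "smooth_atlas A" and \<Psi>: "smooth_fun (prod_atlas A euclidean_atlas) \<Psi>"
  shows "smooth_fun A (\<lambda>p. \<Psi> (p, s))"
  by (rule smooth_fun_pullback[OF A smooth_atlas_prod[OF A smooth_atlas_euclidean]
        smooth_map_Pair[OF A A smooth_atlas_euclidean smooth_map_ident[OF A] smooth_map_const[OF A smooth_atlas_euclidean]] \<Psi>])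

lemma smooth_fun_integral:
  fixes \<Psi> :: "'m::topological_space \<times> real \<Rightarrow> 'b::euclidean_space"
  assumes A: "smooth_atlas A" and \<Psi>: "smooth_fun (prod_atlas A euclidean_atlas) \<Psi>"
  shows "smooth_fun A (\<lambda>p. integral {a..b} (\<lambda>s. \<Psi> (p, s)))"
proof (rule smooth_funI[OF A])
  fix U \<phi> assume U: "(U, \<phi>) \<in> A"
  show "smooth_on (\<phi> ` U) ((\<lambda>p. integral {a..b} (\<lambda>s. \<Psi> (p, s))) \<circ> inv_into U \<phi>)"
    using smooth_on_integral[OF smooth_atlasD(2)[OF A U] smooth_on_prod_euclidean_chart[OF A \<Psi> U], of a b]
    by (simp add: o_def)
qed

text \<open>The mean value inequality twice, first for g' and then for g minus its linear part; the
  constant is not sharp.\<close>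

lemma norm_taylor_quadratic:
  fixes g :: "real \<Rightarrow> 'b::euclidean_space"
  assumes g: "\<And>r. (g has_vector_derivative g' r) (at r)" and g': "\<And>r. (g' has_vector_derivative g'' r) (at r)"
    and C: "\<And>r. \<bar>r\<bar> \<le> \<bar>h\<bar> \<Longrightarrow> norm (g'' r) \<le> C"
  shows "norm (g h - g 0 - h *\<^sub>R g' 0) \<le> C * h\<^sup>2"
proof -
  define S where "S = {- \<bar>h\<bar>..\<bar>h\<bar>}"
  have S: "convex S" "0 \<in> S" "h \<in> S" by (auto simp: S_def)
  have on: "onorm (\<lambda>x. x *\<^sub>R v) \<le> B" if "norm v \<le> B" for v :: 'b and B
    using mult_right_mono[OF that abs_ge_zero] by (intro onorm_le) (simp add: mult.commute)
  have 1: "norm (g' r - g' 0) \<le> C * \<bar>r\<bar>" if "r \<in> S" for r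
  proof -
    have "norm (g' r - g' 0) \<le> C * norm (r - 0)"
    proof (rule differentiable_bound[OF S(1) _ _ that S(2)])
      show "(g' has_derivative (\<lambda>x. x *\<^sub>R g'' r)) (at r within S)" for r
        using has_derivative_at_withinI[OF g'[unfolded has_vector_derivative_def]] .
      show "onorm (\<lambda>x. x *\<^sub>R g'' r) \<le> C" if "r \<in> S" for r
        using that by (intro on C) (auto simp: S_def)
    qed
    then show ?thesis by simp
  qed
  have C0: "C \<ge> 0" using C[of 0] norm_ge_zero[of "g'' 0"] by linarith
  have 2: "((\<lambda>r. g r - r *\<^sub>R g' 0) has_vector_derivative g' r - g' 0) (at r within S)" for r
    by (rule has_vector_derivative_at_within) (use g[of r] in \<open>auto intro!: derivative_eq_intros\<close>)
  have "norm ((g h - h *\<^sub>R g' 0) - (g 0 - 0 *\<^sub>R g' 0)) \<le> (C * \<bar>h\<bar>) * norm (h - 0)"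
  proof (rule differentiable_bound[OF S(1) _ _ S(3,2)])
    show "((\<lambda>r. g r - r *\<^sub>R g' 0) has_derivative (\<lambda>x. x *\<^sub>R (g' r - g' 0))) (at r within S)" for r
      using 2 by (simp add: has_vector_derivative_def)
    show "onorm (\<lambda>x. x *\<^sub>R (g' r - g' 0)) \<le> C * \<bar>h\<bar>" if "r \<in> S" for r
    proof (rule on)
      have "C * \<bar>r\<bar> \<le> C * \<bar>h\<bar>" using that C0 by (intro mult_left_mono) (auto simp: S_def abs_le_iff)
      then show "norm (g' r - g' 0) \<le> C * \<bar>h\<bar>" using 1[OF that] by linarith
    qed
  qed
  then show ?thesis by (simp add: algebra_simps power2_eq_square abs_mult_self_eq)
qed

text \<open>Uniformity over a compact set allows the expansion to be integrated over the
  group.\<close>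

lemma smooth_fun_taylor_uniform:
  fixes \<Psi> :: "'m::topological_space \<times> real \<Rightarrow> 'b::euclidean_space"
  assumes A: "smooth_atlas A" and \<Psi>: "smooth_fun (prod_atlas A euclidean_atlas) \<Psi>" and K: "compact K"
  obtains C where "C \<ge> 0" "\<And>p h. p \<in> K \<Longrightarrow> \<bar>h\<bar> \<le> 1 \<Longrightarrow>
    norm (\<Psi> (p, h) - \<Psi> (p, 0) - h *\<^sub>R partial_last \<Psi> (p, 0)) \<le> C * h\<^sup>2"
proof -
  note d1 = smooth_fun_partial_last[OF A \<Psi>]
  note d2 = smooth_fun_partial_last[OF A d1(2)]
  have "compact (partial_last (partial_last \<Psi>) ` (K \<times> {-1..1}))"
    by (intro compact_continuous_image continuous_on_subset[OF smooth_fun_continuous[OF d2(2)]] compact_Times K compact_Icc) auto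
  then obtain C where C: "\<And>q. q \<in> K \<times> {-1..1} \<Longrightarrow> norm (partial_last (partial_last \<Psi>) q) \<le> C"
    using compact_imp_bounded by (force simp: bounded_iff)
  show thesis
  proof
    show "max C 0 \<ge> 0" by simp
    fix p and h :: real assume "p \<in> K" "\<bar>h\<bar> \<le> 1"
    then show "norm (\<Psi> (p, h) - \<Psi> (p, 0) - h *\<^sub>R partial_last \<Psi> (p, 0)) \<le> max C 0 * h\<^sup>2"
      by (intro norm_taylor_quadratic[OF d1(1) d2(1)] max.coboundedI1 C) auto
  qed
qed

section \<open>A singular integral\<close>

text \<open>Roots of points with Re z >= 0 lie in the sector |arg| <= pi/4, since the square of the
  root has real part Re^2 - Im^2.\<close>

lemma csqrt_sector:
  assumes "Re z \<ge> 0"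
  shows "\<bar>Im (csqrt z)\<bar> \<le> Re (csqrt z)" "cmod (csqrt z) \<le> 2 * Re (csqrt z)"
proof -
  have r: "Re (csqrt z) \<ge> 0" using csqrt_principal[of z] by auto
  have "(Re (csqrt z))\<^sup>2 - (Im (csqrt z))\<^sup>2 = Re z"
    using power2_csqrt[of z] by (metis Re_power2)
  then have "(Im (csqrt z))\<^sup>2 \<le> (Re (csqrt z))\<^sup>2" using assms by linarith
  then show 1: "\<bar>Im (csqrt z)\<bar> \<le> Re (csqrt z)" using r by (simp add: abs_le_square_iff[symmetric])
  show "cmod (csqrt z) \<le> 2 * Re (csqrt z)" using cmod_le[of "csqrt z"] r 1 by simp
qed

text \<open>Two points a, b of the sector |arg| <= pi/4 have nonnegative real scalar product, so |a
  - b| <= |a + b|; multiply by |a - b|.\<close>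

lemma csqrt_hoelder:
  assumes "Re z \<ge> 0" "Re w \<ge> 0"
  shows "(cmod (csqrt z - csqrt w))\<^sup>2 \<le> cmod (z - w)"
proof -
  define a b where "a = csqrt z" and "b = csqrt w"
  have s: "\<bar>Im a\<bar> \<le> Re a" "\<bar>Im b\<bar> \<le> Re b" using csqrt_sector(1) assms by (auto simp: a_def b_def)
  then have "\<bar>Im a\<bar> * \<bar>Im b\<bar> \<le> Re a * Re b" by (intro mult_mono) auto
  then have "0 \<le> Re a * Re b + Im a * Im b" unfolding abs_mult[symmetric] by linarith
  then have "(cmod (a - b))\<^sup>2 \<le> (cmod (a + b))\<^sup>2"
    unfolding cmod_power2 by (simp add: power2_eq_square algebra_simps)
  then have "cmod (a - b) \<le> cmod (a + b)" by (rule power2_le_imp_le) simp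
  then have "cmod (a - b) * cmod (a - b) \<le> cmod (a - b) * cmod (a + b)" by (intro mult_left_mono) auto
  also have "\<dots> = cmod (a\<^sup>2 - b\<^sup>2)" by (simp add: norm_mult[symmetric] power2_eq_square algebra_simps)
  also have "\<dots> = cmod (z - w)" by (simp add: a_def b_def)
  finally show ?thesis by (simp add: a_def b_def power2_eq_square)
qed

lemma continuous_on_csqrt_right_half_plane: "continuous_on {z. Re z \<ge> 0} csqrt"
  unfolding continuous_on_iff
proof (intro ballI allI impI)
  fix z :: complex and e :: real assume z: "z \<in> {z. Re z \<ge> 0}" and e: "e > 0"
  have "dist (csqrt w) (csqrt z) < e" if "w \<in> {z. Re z \<ge> 0}" "dist w z < e\<^sup>2" for w
  proof -
    have "(cmod (csqrt w - csqrt z))\<^sup>2 < e\<^sup>2"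
      using csqrt_hoelder[of w z] that z by (simp add: dist_norm)
    then show ?thesis using e by (simp add: dist_norm power2_less_imp_less)
  qed
  then show "\<exists>d>0. \<forall>w\<in>{z. Re z \<ge> 0}. dist w z < d \<longrightarrow> dist (csqrt w) (csqrt z) < e"
    using e by (intro exI[of _ "e\<^sup>2"]) auto
qed

text \<open>The difference of the roots is (z - w)/c, and c and its inverse stay in the sector |arg|
  <= pi/4. So for a purely imaginary increment the imaginary part of the difference has the sign of
  \<open>d\<close>, with a lower bound that excludes cancellation.\<close>

lemma csqrt_difference:
  assumes "Re z \<ge> 0" "Re w \<ge> 0" "z - w = \<i> * complex_of_real d"
  defines "c \<equiv> csqrt z + csqrt w"
  shows "Im (csqrt z - csqrt w) = d * Re (inverse c)" "Re (inverse c) \<ge> 0" "cmod c \<le> 2 * Re c"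
    "c \<noteq> 0 \<Longrightarrow> 1 / (2 * cmod c) \<le> Re (inverse c)"
proof -
  define a b where "a = csqrt z" and "b = csqrt w"
  have c: "c = a + b" by (simp add: c_def a_def b_def)
  have s: "\<bar>Im a\<bar> \<le> Re a" "\<bar>Im b\<bar> \<le> Re b" using csqrt_sector(1) assms by (auto simp: a_def b_def)
  then have sc: "\<bar>Im c\<bar> \<le> Re c" by (simp add: c)
  then show "cmod c \<le> 2 * Re c" using cmod_le[of c] by linarith
  show "Re (inverse c) \<ge> 0" using sc by (auto simp: zero_le_divide_iff)
  show "Im (csqrt z - csqrt w) = d * Re (inverse c)"
  proof (cases "c = 0")
    case True
    then have "Re a = 0" "Re b = 0" using s by (auto simp: c complex_eq_iff)
    then have "a = 0" "b = 0" using s by (auto simp: complex_eq_iff)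
    then show ?thesis using True by (simp add: a_def b_def)
  next
    case False
    have "(a - b) * c = z - w" by (simp add: c a_def b_def algebra_simps flip: power2_eq_square)
    then have "a - b = \<i> * complex_of_real d * inverse c" using False assms(3) by (simp add: field_simps)
    then show ?thesis by (simp add: a_def b_def)
  qed
  show "1 / (2 * cmod c) \<le> Re (inverse c)" if "c \<noteq> 0"
  proof -
    have "1 / (2 * cmod c) = cmod c / (2 * (cmod c)\<^sup>2)" using that by (simp add: power2_eq_square)
    also have "\<dots> \<le> (2 * Re c) / (2 * (cmod c)\<^sup>2)"
      using \<open>cmod c \<le> 2 * Re c\<close> by (intro divide_right_mono) auto
    also have "\<dots> = Re c / (cmod c)\<^sup>2" by (rule mult_divide_mult_cancel_left) simp
    also have "\<dots> = Re (inverse c)" by (simp add: cmod_power2)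
    finally show ?thesis .
  qed
qed

text \<open>The derivative at \<open>0\<close> would be \<open>\<integral> \<i> F'(s) / (2 csqrt (\<dots>)) ds\<close>, whose integrand has modulus
  comparable to \<open>1 / \<bar>s\<bar>\<close> and argument in a fixed sector; so the difference quotients diverge like
  \<open>ln (1 / r)\<close>.\<close>

lemma singular_integral_not_differentiable:
  fixes F :: "real \<Rightarrow> real"
  assumes F: "smooth_on UNIV F" "F 0 = 0" "(F has_real_derivative 1) (at 0)" and \<kappa>: "\<kappa> > 0" and R: "R > 0"
    and w: "\<And>r. w r = integral {- R..R} (\<lambda>s. csqrt (Complex (\<kappa> * s\<^sup>2) (F (r + s) - s)))"
    and d: "(w has_vector_derivative D) (at 0)"
  shows False
proof -
  define Z where "Z r s = Complex (\<kappa> * s\<^sup>2) (F (r + s) - s)" for r s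
  have ReZ: "Re (Z r s) \<ge> 0" for r s using \<kappa> by (simp add: Z_def)
  define F1 where "F1 r = frechet_derivative F (at r) 1" for r
  define F2 where "F2 r = frechet_derivative F1 (at r) 1" for r
  have F1s: "smooth_on UNIV F1" unfolding F1_def by (rule smooth_on_imp_frechet[OF F(1)])
  have dF: "(F has_vector_derivative F1 r) (at r)" for r
    unfolding F1_def by (rule smooth_on_has_vector_derivative[OF F(1)]) simp
  have dF1: "(F1 has_vector_derivative F2 r) (at r)" for r
    unfolding F2_def by (rule smooth_on_has_vector_derivative[OF F1s]) simp
  have F10: "F1 0 = 1"
    using dF[of 0] F(3) DERIV_unique by (auto simp: has_real_derivative_iff_has_vector_derivative[symmetric])
  have c1: "continuous_on S F1" for S using smooth_on_continuous_on[OF F1s] continuous_on_subset by blast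
  have c2: "continuous_on S F2" for S
    unfolding F2_def using smooth_on_continuous_on[OF smooth_on_imp_frechet[OF F1s]] continuous_on_subset by blast
  obtain M where "\<forall>y\<in>F2 ` {-2..2}. norm y \<le> M"
    using compact_imp_bounded[OF compact_continuous_image[OF c2 compact_Icc, of "-2" 2]] unfolding bounded_iff by blast
  then have M: "norm (F2 v) \<le> M" if "v \<in> {-2..2}" for v using that by blast
  have M0: "M \<ge> 0" using M[of 0] norm_ge_zero[of "F2 0"] by simp
  have quad: "\<bar>F v - v\<bar> \<le> M * v\<^sup>2" if "\<bar>v\<bar> \<le> 2" for v
  proof -
    have "norm (F v - F 0 - v *\<^sub>R F1 0) \<le> M * v\<^sup>2"
      by (rule norm_taylor_quadratic[OF dF dF1 M]) (use that in auto)
    then show ?thesis using F10 F(2) by simp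
  qed
  obtain M1 where "\<forall>y\<in>F1 ` {- (R + 1)..R + 1}. norm y \<le> M1"
    using compact_imp_bounded[OF compact_continuous_image[OF c1 compact_Icc, of "- (R + 1)" "R + 1"]]
    unfolding bounded_iff by blast
  then have M1: "norm (F1 v) \<le> M1" if "v \<in> {- (R + 1)..R + 1}" for v using that by blast
  have M10: "M1 \<ge> 0" using M1[of 0] norm_ge_zero[of "F1 0"] R by auto
  have "isCont F1 0" using c1[of UNIV] by (simp add: continuous_on_eq_continuous_at)
  then obtain d0 where d0: "d0 > 0" "\<And>v. dist v 0 < d0 \<Longrightarrow> dist (F1 v) (F1 0) < 1 / 2"
    unfolding continuous_at_eps_delta by (meson half_gt_zero zero_less_one)
  \<comment> \<open>The three bounds keep arguments of \<open>F\<close> in the ranges of the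
    estimates by \<open>M\<close> and \<open>M1\<close>, the interval up to \<eta> inside [-R, R],
    and arguments up to 2 \<eta> where F' >= 1/2.\<close>
  define \<eta> where "\<eta> = min (min 1 R) (d0 / 3)"
  have \<eta>: "\<eta> > 0" "\<eta> \<le> 1" "\<eta> \<le> R" "2 * \<eta> < d0" using d0 R by (auto simp: \<eta>_def)
  have F1h: "F1 v \<ge> 1 / 2" if "\<bar>v\<bar> \<le> 2 * \<eta>" for v
  proof -
    have "\<bar>F1 v - 1\<bar> < 1 / 2" using d0(2)[of v] that \<eta>(4) F10 by (simp add: dist_real_def)
    then show ?thesis by linarith
  qed
  have mvt: "\<exists>\<xi>. s \<le> \<xi> \<and> \<xi> \<le> s + r \<and> F (r + s) - F s = r * F1 \<xi>" if "r > 0" for r s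
    using MVT2[of s "s + r" F F1] dF that
    by (auto simp: has_real_derivative_iff_has_vector_derivative add.commute) (metis less_eq_real_def)
  \<comment> \<open>If sqrt r <= s <= \<eta>, then |F(r + s) - s| <= r + M (2 s)^2 <= (1 + 4 M) s^2,
    and the real part adds \<kappa> s^2; so the root has modulus at most N s.\<close>
  define N where "N = sqrt (1 + 4 * M + \<kappa>)"
  have N: "N > 0" "N\<^sup>2 = 1 + 4 * M + \<kappa>" using M0 \<kappa> by (auto simp: N_def add_pos_nonneg)
  \<comment> \<open>For |s| > \<eta> the real part of \<open>Z\<close> is bounded below, so the
    integrand of the difference is O(r) there.\<close>
  define K where "K = 4 * M1 / (sqrt \<kappa> * \<eta>)"
  have K: "K \<ge> 0" using M10 \<kappa> \<eta> by (simp add: K_def)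
  define g where "g r s = Im (csqrt (Z r s) - csqrt (Z 0 s))" for r s
  have contZ: "continuous_on S (\<lambda>s. csqrt (Z r s))" for r S
  proof (rule continuous_on_compose2[OF continuous_on_csqrt_right_half_plane])
    have "continuous_on S (\<lambda>s. F (r + s))"
      by (rule continuous_on_compose2[OF smooth_on_continuous_on[OF F(1)]]) (auto intro!: continuous_intros)
    then show "continuous_on S (Z r)" unfolding Z_def Complex_eq by (intro continuous_intros)
  qed (use ReZ in auto)
  have contg: "continuous_on S (g r)" for r S unfolding g_def by (intro continuous_intros contZ)
  have g_eq: "g r s = (F (r + s) - F s) * Re (inverse (csqrt (Z r s) + csqrt (Z 0 s)))" for r s
    unfolding g_def by (rule csqrt_difference(1)[OF ReZ ReZ]) (simp add: Z_def complex_eq_iff)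
  note inv_nonneg = csqrt_difference(2)[OF ReZ ReZ]
  have g_low: "g r s \<ge> - K * r" if r: "0 < r" "r \<le> \<eta>" and s: "\<bar>s\<bar> \<le> R" for r s
  proof (cases "\<bar>s\<bar> \<le> \<eta>")
    case True
    obtain \<xi> where \<xi>: "s \<le> \<xi>" "\<xi> \<le> s + r" "F (r + s) - F s = r * F1 \<xi>" using mvt r by blast
    then have "F1 \<xi> \<ge> 1 / 2" using True r by (intro F1h) auto
    then have "F (r + s) - F s \<ge> 0" using \<xi> r by simp
    moreover have "Re (inverse (csqrt (Z r s) + csqrt (Z 0 s))) \<ge> 0"
      by (rule csqrt_difference(2)[OF ReZ ReZ, where d = "F (r + s) - F s"]) (simp add: Z_def complex_eq_iff)
    ultimately have "g r s \<ge> 0" unfolding g_eq by (rule mult_nonneg_nonneg)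
    moreover have "- K * r \<le> 0" using K r by simp
    ultimately show ?thesis by linarith
  next
    case False
    define c where "c = csqrt (Z r s) + csqrt (Z 0 s)"
    obtain \<xi> where \<xi>: "s \<le> \<xi>" "\<xi> \<le> s + r" "F (r + s) - F s = r * F1 \<xi>" using mvt r by blast
    have "norm (F1 \<xi>) \<le> M1" using \<xi> r s \<eta> by (intro M1) auto
    then have diff: "\<bar>F (r + s) - F s\<bar> \<le> r * M1" using r unfolding \<xi>(3) abs_mult by (simp add: mult_left_mono)
    have "\<kappa> * \<eta>\<^sup>2 \<le> \<kappa> * s\<^sup>2"
      using False \<eta> \<kappa> by (intro mult_left_mono) (auto simp: abs_le_square_iff[symmetric])
    also have "\<dots> \<le> cmod (Z r s)" using complex_Re_le_cmod[of "Z r s"] by (simp add: Z_def)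
    finally have "sqrt (\<kappa> * \<eta>\<^sup>2) \<le> sqrt (cmod (Z r s))" by simp
    then have "sqrt \<kappa> * \<eta> \<le> cmod (csqrt (Z r s))" using \<eta> by (simp add: real_sqrt_mult norm_csqrt)
    then have "sqrt \<kappa> * \<eta> / 2 \<le> Re (csqrt (Z r s))" using csqrt_sector(2)[OF ReZ, of r s] by linarith
    moreover have "Re (csqrt (Z 0 s)) \<ge> 0" using csqrt_sector(1)[OF ReZ, of 0 s] by linarith
    ultimately have Rc: "sqrt \<kappa> * \<eta> / 2 \<le> cmod c" using complex_Re_le_cmod[of c]
      unfolding c_def plus_complex.sel by linarith
    have pos: "sqrt \<kappa> * \<eta> / 2 > 0" using \<kappa> \<eta> by simp
    have "\<bar>Re (inverse c)\<bar> \<le> cmod (inverse c)" by (rule abs_Re_le_cmod)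
    also have "\<dots> = inverse (cmod c)" by (rule norm_inverse)
    also have "\<dots> \<le> inverse (sqrt \<kappa> * \<eta> / 2)" by (rule le_imp_inverse_le[OF Rc pos])
    also have "\<dots> = 2 / (sqrt \<kappa> * \<eta>)" by (simp add: inverse_eq_divide)
    finally have "\<bar>g r s\<bar> \<le> (r * M1) * (2 / (sqrt \<kappa> * \<eta>))"
      unfolding g_eq abs_mult c_def[symmetric] using diff r M10 by (intro mult_mono) auto
    also have "\<dots> \<le> K * r" using M10 \<kappa> \<eta> r by (simp add: K_def field_simps)
    finally show ?thesis by linarith
  qed
  \<comment> \<open>The increment of \<open>F\<close> is at least r/2, and the sum of the two roots
    has modulus at most 2 N s, so its inverse has real part at least 1/(4 N s). Below sqrt r this
    modulus bound fails, hence the lower limit.\<close>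
  have g_big: "g r s \<ge> r / (8 * N) * inverse s" if r: "0 < r" and s: "sqrt r \<le> s" "s \<le> \<eta>" for r s
  proof -
    define c where "c = csqrt (Z r s) + csqrt (Z 0 s)"
    have s0: "s > 0" using r s(1) real_sqrt_gt_zero[OF r] by linarith
    have rs: "r \<le> s\<^sup>2" using s(1) r s0 by (metis less_imp_le real_sqrt_le_iff real_sqrt_abs abs_of_pos)
    have "s \<le> 1" using s(2) \<eta>(2) by linarith
    then have "s * s \<le> s" using s0 by (intro mult_left_le) auto
    then have rs': "r \<le> s" using rs by (simp add: power2_eq_square)
    have bnd: "cmod (Z r' s) \<le> N\<^sup>2 * s\<^sup>2" if r': "0 \<le> r'" "r' \<le> s\<^sup>2" "r' \<le> s" for r'
    proof -
      have "\<bar>F (r' + s) - (r' + s)\<bar> \<le> M * (r' + s)\<^sup>2"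
        using r' s0 s(2) \<eta>(2) by (intro quad) auto
      also have "\<dots> \<le> M * (2 * s)\<^sup>2" using r' s0 M0 by (intro mult_left_mono power_mono) auto
      finally have "\<bar>F (r' + s) - s\<bar> \<le> s\<^sup>2 + 4 * M * s\<^sup>2" using r' by (simp add: power_mult_distrib abs_le_iff)
      moreover have "cmod (Z r' s) \<le> \<bar>Re (Z r' s)\<bar> + \<bar>Im (Z r' s)\<bar>" by (rule cmod_le)
      ultimately have "cmod (Z r' s) \<le> \<kappa> * s\<^sup>2 + (s\<^sup>2 + 4 * M * s\<^sup>2)" using \<kappa> by (simp add: Z_def abs_mult)
      then show ?thesis unfolding N(2) by (simp add: algebra_simps)
    qed
    have cs: "cmod (csqrt (Z r' s)) \<le> N * s" if "0 \<le> r'" "r' \<le> s\<^sup>2" "r' \<le> s" for r'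
    proof -
      have "sqrt (cmod (Z r' s)) \<le> sqrt ((N * s)\<^sup>2)" using bnd[OF that] by (simp add: power_mult_distrib)
      then show ?thesis using N s0 by (simp add: norm_csqrt)
    qed
    have "cmod c \<le> N * s + N * s"
      unfolding c_def using cs[of r] cs[of 0] rs rs' r s0 by (intro norm_triangle_mono) auto
    then have cb: "cmod c \<le> 2 * (N * s)" by simp
    have c0: "c \<noteq> 0"
    proof
      assume "c = 0"
      have "Re (csqrt (Z r s)) \<ge> 0" "Re (csqrt (Z 0 s)) \<ge> 0"
        using csqrt_sector(1)[OF ReZ, of r s] csqrt_sector(1)[OF ReZ, of 0 s] by linarith+
      moreover have "Re (csqrt (Z r s)) + Re (csqrt (Z 0 s)) = 0"
        using \<open>c = 0\<close> unfolding c_def plus_complex.sel(1)[symmetric] by (rule arg_cong[of _ 0 Re, simplified])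
      ultimately have "cmod (csqrt (Z r s)) \<le> 0" using csqrt_sector(2)[OF ReZ, of r s] by linarith
      then have "Re (Z r s) = 0" by simp
      then show False using \<kappa> s0 by (simp add: Z_def)
    qed
    obtain \<xi> where \<xi>: "s \<le> \<xi>" "\<xi> \<le> s + r" "F (r + s) - F s = r * F1 \<xi>" using mvt r by blast
    have "F1 \<xi> \<ge> 1 / 2" using \<xi> s rs' s0 by (intro F1h) auto
    then have F: "r / 2 \<le> F (r + s) - F s" using r unfolding \<xi>(3) by simp
    have "1 / (2 * cmod c) \<le> Re (inverse c)"
      unfolding c_def by (rule csqrt_difference(4)[OF ReZ ReZ, where d = "F (r + s) - F s"])
        (use c0 in \<open>simp_all add: c_def Z_def complex_eq_iff\<close>)
    moreover have "1 / (2 * (2 * (N * s))) \<le> 1 / (2 * cmod c)"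
      using cb c0 by (intro divide_left_mono) (auto simp: N s0)
    ultimately have "1 / (4 * N * s) \<le> Re (inverse c)" by (simp add: mult.assoc)
    then have "(r / 2) * (1 / (4 * N * s)) \<le> g r s"
      unfolding g_eq c_def[symmetric] using F r N s0 by (intro mult_mono) auto
    then show ?thesis by (simp add: field_simps)
  qed
  have main: "r * ((ln \<eta> - ln (sqrt r)) / (8 * N) - 2 * R * K) \<le> Im (w r - w 0)"
    if r: "0 < r" "r \<le> \<eta>" "sqrt r \<le> \<eta>" for r
  proof -
    have sr: "sqrt r > 0" using r by simp
    have int: "(\<lambda>s. csqrt (Z r s)) integrable_on {- R..R}" for r
      by (rule integrable_continuous_real[OF contZ])
    have "w r - w 0 = integral {- R..R} (\<lambda>s. csqrt (Z r s) - csqrt (Z 0 s))"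
      unfolding w Z_def[symmetric] by (rule Henstock_Kurzweil_Integration.integral_diff[symmetric, OF int int])
    then have "Im (w r - w 0) = integral {- R..R} (g r)"
      unfolding g_def
      using integral_linear[OF integrable_diff[OF int[of r] int[of 0]] bounded_linear_Im] by (simp add: o_def)
    moreover have "integral {- R..R} (\<lambda>s. g r s + K * r) = integral {- R..R} (g r) + K * r * (2 * R)"
      using R by (subst Henstock_Kurzweil_Integration.integral_add)
        (auto intro!: integrable_continuous_real contg continuous_intros simp: algebra_simps)
    \<comment> \<open>After adding K r the integrand is nonnegative on [-R, R], so dropping
      everything outside [sqrt r, \<eta>] only lowers the integral; what remains carries the
      logarithm.\<close>
    moreover have "integral {sqrt r..\<eta>} (\<lambda>s. g r s + K * r) \<le> integral {- R..R} (\<lambda>s. g r s + K * r)"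
    proof (rule integral_subset_le)
      show "{sqrt r..\<eta>} \<subseteq> {- R..R}"
      proof
        fix s assume "s \<in> {sqrt r..\<eta>}"
        then have "sqrt r \<le> s" "s \<le> \<eta>" by auto
        then show "s \<in> {- R..R}" unfolding atLeastAtMost_iff using sr \<eta>(3) R by linarith
      qed
      show "\<forall>s\<in>{- R..R}. 0 \<le> g r s + K * r"
      proof
        fix s assume "s \<in> {- R..R}"
        then have "\<bar>s\<bar> \<le> R" by auto
        from g_low[OF r(1,2) this] show "0 \<le> g r s + K * r" by linarith
      qed
    qed (auto intro!: integrable_continuous_real contg continuous_intros)
    moreover have "r / (8 * N) * (ln \<eta> - ln (sqrt r)) \<le> integral {sqrt r..\<eta>} (\<lambda>s. g r s + K * r)"
    proof -
      have "(ln has_vector_derivative inverse x) (at x within {sqrt r..\<eta>})" if "x \<in> {sqrt r..\<eta>}" for x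
      proof -
        have "sqrt r \<le> x" using that by simp
        then have "x > 0" using sr by linarith
        then have "(ln has_real_derivative inverse x) (at x)"
          by (auto intro!: derivative_eq_intros simp: field_simps)
        then show ?thesis
          by (simp add: has_real_derivative_iff_has_vector_derivative has_vector_derivative_at_within)
      qed
      from fundamental_theorem_of_calculus[OF r(3) this]
      have "(inverse has_integral ln \<eta> - ln (sqrt r)) {sqrt r..\<eta>}" .
      from has_integral_mult_right[OF this, of "r / (8 * N)"]
      have hi: "((\<lambda>s. r / (8 * N) * inverse s) has_integral r / (8 * N) * (ln \<eta> - ln (sqrt r))) {sqrt r..\<eta>}" .
      have "((\<lambda>s. g r s + K * r) has_integral integral {sqrt r..\<eta>} (\<lambda>s. g r s + K * r)) {sqrt r..\<eta>}"
        by (intro integrable_integral integrable_continuous_real continuous_intros contg)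
      from has_integral_le[OF hi this] show ?thesis
        using g_big[OF r(1)] K r by (smt (verit) atLeastAtMost_iff mult_nonneg_nonneg)
    qed
    ultimately have "r / (8 * N) * (ln \<eta> - ln (sqrt r)) - K * r * (2 * R) \<le> Im (w r - w 0)" by linarith
    then show ?thesis by (simp add: algebra_simps)
  qed
  obtain e where e: "e > 0" "\<And>r. norm (r - 0) < e \<Longrightarrow> norm (w r - w 0 - (r - 0) *\<^sub>R D) \<le> 1 * norm (r - 0)"
    using d unfolding has_vector_derivative_def has_derivative_at_alt by (metis zero_less_one)
  have up: "Im (w r - w 0) \<le> r * (norm D + 1)" if "0 < r" "r < e" for r
  proof -
    have "norm (w r - w 0) \<le> norm (w r - w 0 - r *\<^sub>R D) + norm (r *\<^sub>R D)"
      by (metis diff_add_cancel norm_triangle_ineq)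
    also have "\<dots> \<le> r + r * norm D" using e(2)[of r] that by simp
    finally show ?thesis using abs_Im_le_cmod[of "w r - w 0"] by (simp add: algebra_simps)
  qed
  \<comment> \<open>Chosen so that at r = \<rho>^2, where sqrt r = \<rho>, the logarithm exceeds
    what \<open>main\<close> subtracts by |D| + 2, while differentiability permits only |D| +
    1.\<close>
  define T where "T = 8 * N * (2 * R * K + norm D + 2)"
  define \<rho> where "\<rho> = min (min (\<eta> * exp (- T)) (min \<eta> 1)) (e / 2)"
  have \<rho>: "\<rho> > 0" "\<rho> \<le> \<eta>" "\<rho> \<le> 1" "\<rho> < e" "\<rho> \<le> \<eta> * exp (- T)"
    using \<eta> e by (auto simp: \<rho>_def)
  have \<rho>2: "0 < \<rho>\<^sup>2" "\<rho>\<^sup>2 \<le> \<rho>" "sqrt (\<rho>\<^sup>2) = \<rho>" using \<rho> by (auto simp: power2_eq_square mult_left_le)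
  have "ln \<rho> \<le> ln (\<eta> * exp (- T))" using \<rho> \<eta> by simp
  also have "\<dots> = ln \<eta> - T" using \<eta> by (simp add: ln_mult)
  finally have "T \<le> ln \<eta> - ln \<rho>" by simp
  then have "2 * R * K + norm D + 2 \<le> (ln \<eta> - ln \<rho>) / (8 * N)"
    using N by (simp add: T_def field_simps)
  then have "\<rho>\<^sup>2 * (norm D + 2) \<le> \<rho>\<^sup>2 * ((ln \<eta> - ln \<rho>) / (8 * N) - 2 * R * K)"
    by (intro mult_left_mono) auto
  also have "\<dots> \<le> Im (w (\<rho>\<^sup>2) - w 0)" using main[of "\<rho>\<^sup>2"] \<rho> \<rho>2 by simp
  also have "\<dots> \<le> \<rho>\<^sup>2 * (norm D + 1)" using \<rho> \<rho>2 by (intro up) auto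
  finally have "norm D + 2 \<le> norm D + 1" using \<rho>2 by (simp only: mult_le_cancel_left_pos)
  then show False by simp
qed

section \<open>Integration by parts against Haar measure\<close>

locale haar_flow = lie_group G A for G :: "('g::t2_space, 'x) monoid_scheme" (structure)
  and A :: "('g, 'e::euclidean_space) chart set" +
  fixes \<mu> :: "'g measure" and X :: "('g \<Rightarrow> real) \<Rightarrow> real" and \<gamma> :: "real \<Rightarrow> 'g"
  assumes compact_group: "compact (UNIV :: 'g set)"
    and haar: "haar_measure G \<mu>"
    and flow: "one_parameter_subgroup G A X \<gamma>"
begin

abbreviation TG :: "(real \<times> 'g, real \<times> 'e) chart set" where "TG \<equiv> prod_atlas euclidean_atlas A"

abbreviation TGR :: "((real \<times> 'g) \<times> real, (real \<times> 'e) \<times> real) chart set" where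
  "TGR \<equiv> prod_atlas TG euclidean_atlas"

lemma TG: "smooth_atlas TG" by (rule smooth_atlas_prod[OF smooth_atlas_euclidean atlas])

lemma TGE: "smooth_atlas TGR"
  by (rule smooth_atlas_prod[OF TG smooth_atlas_euclidean])

lemma \<gamma>: "smooth_map euclidean_atlas A \<gamma>" "\<gamma> (s + t) = \<gamma> s \<otimes> \<gamma> t" "\<gamma> 0 = \<one>"
  using flow one_parameter_subgroup_0[OF flow] by (auto simp: one_parameter_subgroup_def)

sublocale prob: prob_space \<mu> using haar by (simp add: haar_measure_def)

lemma sets_\<mu>: "sets \<mu> = sets borel" using haar by (simp add: haar_measure_def)

lemma space_\<mu>: "space \<mu> = UNIV" using sets_eq_imp_space_eq[OF sets_\<mu>] by simp

lemma measurable_\<mu>: "f \<in> borel_measurable \<mu>"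
  if "continuous_on UNIV f" for f :: "'g \<Rightarrow> 'b::topological_space"
  using borel_measurable_continuous_onI[OF that] measurable_cong_sets[OF sets_\<mu> refl] by blast

lemma integrable_\<mu>:
  fixes f :: "'g \<Rightarrow> 'b::{banach, second_countable_topology}"
  assumes "continuous_on UNIV f"
  shows "integrable \<mu> f"
proof -
  have "bounded (range f)" by (intro compact_imp_bounded compact_continuous_image assms compact_group)
  then obtain B where "\<And>x. norm (f x) \<le> B" by (auto simp: bounded_iff)
  then show ?thesis by (intro prob.integrable_const_bound[of _ B] measurable_\<mu> assms) auto
qed

lemma continuous_mult_left: "continuous_on UNIV (\<lambda>x. g \<otimes> x)"
  by (rule smooth_map_continuous[OF smooth_map_mult[OF atlas smooth_map_const[OF atlas atlas] smooth_map_ident[OF atlas]]])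

lemma continuous_mult_right: "continuous_on UNIV (\<lambda>x. x \<otimes> g)"
  by (rule smooth_map_continuous[OF smooth_map_mult[OF atlas smooth_map_ident[OF atlas] smooth_map_const[OF atlas atlas]]])

lemma integral_right_translate:
  fixes f :: "'g \<Rightarrow> 'b::{banach, second_countable_topology}"
  assumes "continuous_on UNIV f"
  shows "(LINT x|\<mu>. f (x \<otimes> g)) = (LINT x|\<mu>. f x)"
proof -
  have "integral\<^sup>L (distr \<mu> borel (\<lambda>x. x \<otimes> g)) f = (LINT x|\<mu>. f (x \<otimes> g))"
    by (intro integral_distr measurable_\<mu> continuous_mult_right borel_measurable_continuous_onI assms)
  moreover have "distr \<mu> borel (\<lambda>x. x \<otimes> g) = \<mu>" using haar by (simp add: haar_measure_def)
  ultimately show ?thesis by simp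
qed

text \<open>Haar measure has full support, because finitely many translates of a nonempty open set cover
  the compact group.\<close>

lemma open_null_empty:
  assumes O: "open S" "emeasure \<mu> S = 0"
  shows "S = {}"
proof (rule ccontr)
  assume "S \<noteq> {}"
  then obtain p where p: "p \<in> S" by blast
  define T where "T x = {y. (p \<otimes> inv x) \<otimes> y \<in> S}" for x
  have T: "open (T x)" "x \<in> T x" for x
    using p open_vimage[OF O(1) continuous_mult_left, of "p \<otimes> inv x"] by (simp_all add: T_def vimage_def)
  have null: "emeasure \<mu> (T x) = 0" for x
  proof -
    have "emeasure (distr \<mu> borel (\<lambda>y. (p \<otimes> inv x) \<otimes> y)) S = emeasure \<mu> ((\<lambda>y. (p \<otimes> inv x) \<otimes> y) -` S \<inter> space \<mu>)"
      using O(1) by (intro emeasure_distr measurable_\<mu> continuous_mult_left) auto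
    moreover have "distr \<mu> borel (\<lambda>y. (p \<otimes> inv x) \<otimes> y) = \<mu>" using haar by (simp only: haar_measure_def)
    ultimately show ?thesis using O(2) by (simp add: T_def space_\<mu> vimage_def)
  qed
  obtain F where F: "finite F" "UNIV \<subseteq> (\<Union>x\<in>F. T x)"
    by (rule compactE_image[OF compact_group, of UNIV T]) (use T in auto)
  have "emeasure \<mu> (\<Union>x\<in>F. T x) \<le> (\<Sum>x\<in>F. emeasure \<mu> (T x))"
    by (rule emeasure_subadditive_finite[OF F(1)]) (use T in \<open>auto simp: sets_\<mu>\<close>)
  then have "emeasure \<mu> (\<Union>x\<in>F. T x) = 0" using null by simp
  moreover have "(\<Union>x\<in>F. T x) = space \<mu>" using F(2) by (auto simp: space_\<mu>)
  ultimately show False using prob.emeasure_space_1 by simp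
qed

section \<open>The pairing by integration over the group and one period\<close>

definition gint :: "(real \<times> 'g \<Rightarrow> complex) \<Rightarrow> real \<Rightarrow> complex" where
  "gint k t = (LINT x|\<mu>. k (t, x))"

definition J :: "(real \<times> 'g \<Rightarrow> complex) \<Rightarrow> complex" where
  "J k = (LINT t:{0..2 * pi}|lborel. (LINT x|\<mu>. k (t, x)))"

lemma continuous_slice: "continuous_on UNIV (\<lambda>x. k (t, x))" if "continuous_on UNIV k" for k :: "real \<times> 'g \<Rightarrow> 'b::topological_space"
  by (rule continuous_on_compose2[OF that]) (auto intro!: continuous_intros)

lemma norm_gint: "norm (gint k t) \<le> M" if "continuous_on UNIV k" "\<And>x. norm (k (t, x)) \<le> M"
proof -
  have "norm (gint k t) \<le> (LINT x|\<mu>. norm (k (t, x)))" unfolding gint_def by (rule integral_norm_bound)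
  also have "\<dots> \<le> (LINT x|\<mu>. M)"
    by (intro integral_mono integrable_\<mu> continuous_on_norm continuous_slice that) auto
  finally show ?thesis using prob.prob_space by simp
qed

lemma continuous_integral_slice:
  fixes k :: "real \<times> 'g \<Rightarrow> 'b::{banach, second_countable_topology}"
  assumes "continuous_on UNIV k"
  shows "continuous_on UNIV (\<lambda>t. LINT x|\<mu>. k (t, x))"
proof (rule continuous_at_imp_continuous_on, rule ballI, rule continuous_at_sequentiallyI)
  fix t :: real and u :: "nat \<Rightarrow> real" assume u: "u \<longlonglongrightarrow> t"
  have "bounded (range u)" using u convergent_imp_bounded by blast
  then obtain B where B: "range u \<subseteq> {-B..B}" by (metis bounded_subset_cbox_symmetric cbox_interval)
  have "bounded (k ` ({-B..B} \<times> UNIV))"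
    by (intro compact_imp_bounded compact_continuous_image continuous_on_subset[OF assms] compact_Times compact_Icc compact_group) auto
  then obtain M where M: "\<And>q. q \<in> {-B..B} \<times> UNIV \<Longrightarrow> norm (k q) \<le> M" by (force simp: bounded_iff)
  show "(\<lambda>n. LINT x|\<mu>. k (u n, x)) \<longlonglongrightarrow> (LINT x|\<mu>. k (t, x))"
  proof (rule integral_dominated_convergence[where w = "\<lambda>x. M"])
    show "AE x in \<mu>. (\<lambda>n. k (u n, x)) \<longlonglongrightarrow> k (t, x)"
    proof (rule AE_I2)
      fix x
      have "isCont k (t, x)" using assms by (simp add: continuous_on_eq_continuous_at)
      then show "(\<lambda>n. k (u n, x)) \<longlonglongrightarrow> k (t, x)"
        by (rule isCont_tendsto_compose) (auto intro!: tendsto_intros u)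
    qed
    show "AE x in \<mu>. norm (k (u n, x)) \<le> M" for n using B by (intro AE_I2 M) blast
  qed (auto intro!: measurable_\<mu> continuous_slice assms)
qed

lemma continuous_gint: "continuous_on S (gint k)" if "continuous_on UNIV k"
  using continuous_on_subset[OF continuous_integral_slice[OF that]] by (simp add: gint_def[abs_def])

lemma J_eq: "J k = integral {0..2 * pi} (gint k)" if "continuous_on UNIV k"
proof -
  have "set_integrable lborel {0..2 * pi} (gint k)"
    unfolding set_integrable_def by (rule borel_integrable_compact[OF compact_Icc continuous_gint[OF that]])
  from set_borel_integral_eq_integral(2)[OF this] show ?thesis by (simp add: J_def gint_def[abs_def])
qed

lemma gint_add: "gint (\<lambda>p. k p + l p) t = gint k t + gint l t"
  if "continuous_on UNIV k" "continuous_on UNIV l"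
  unfolding gint_def by (intro Bochner_Integration.integral_add integrable_\<mu> continuous_slice that)

lemma gint_cmult: "gint (\<lambda>p. c * k p) t = c * gint k t" if "continuous_on UNIV k"
  unfolding gint_def by (intro Bochner_Integration.integral_mult_right integrable_\<mu> continuous_slice that)

lemma J_add: "J (\<lambda>p. k p + l p) = J k + J l" if "continuous_on UNIV k" "continuous_on UNIV l"
proof -
  have "gint (\<lambda>p. k p + l p) = (\<lambda>t. gint k t + gint l t)" by (intro ext gint_add that)
  then show ?thesis using that
    by (simp add: J_eq continuous_on_add Henstock_Kurzweil_Integration.integral_add integrable_continuous_real continuous_gint)
qed

lemma J_cmult: "J (\<lambda>p. c * k p) = c * J k" if "continuous_on UNIV k"
proof -
  have "gint (\<lambda>p. c * k p) = (\<lambda>t. c * gint k t)" by (intro ext gint_cmult that)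
  then show ?thesis using that by (simp add: J_eq continuous_on_mult_left)
qed

lemma J_diff: "J (\<lambda>p. k p - l p) = J k - J l" if "continuous_on UNIV k" "continuous_on UNIV l"
  using J_add[OF that(1) continuous_on_mult_left[OF that(2), of "- 1"]] J_cmult[OF that(2), of "- 1"] by simp

lemma norm_J: "norm (J k) \<le> M * (2 * pi)"
  if "continuous_on UNIV k" "\<And>t x. 0 \<le> t \<Longrightarrow> t \<le> 2 * pi \<Longrightarrow> norm (k (t, x)) \<le> M"
proof -
  have "norm (integral {0..2 * pi} (gint k)) \<le> M * (2 * pi - 0)"
    by (rule integral_bound) (use that in \<open>auto intro: norm_gint continuous_gint\<close>)
  then show ?thesis using that by (simp add: J_eq)
qed

text \<open>The group integral of |k|^2 is continuous and nonnegative in t, so a vanishing integral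
  makes it 0 at every t. Full support of Haar measure then improves vanishing almost everywhere on
  the slice to everywhere.\<close>

lemma J_definite:
  assumes k: "continuous_on UNIV k" and z: "J (\<lambda>p. k p * cnj (k p)) = 0" and t: "0 \<le> t" "t \<le> 2 * pi"
  shows "k (t, x) = 0"
proof -
  define m where "m p = (norm (k p))\<^sup>2" for p
  have m: "continuous_on UNIV m" unfolding m_def by (intro continuous_intros k)
  have km: "k p * cnj (k p) = complex_of_real (m p)" for p unfolding m_def by (rule complex_norm_square[symmetric])
  have int: "integrable \<mu> (\<lambda>x. m (t, x))" by (rule integrable_\<mu>[OF continuous_slice[OF m]])
  define d where "d t = (LINT x|\<mu>. m (t, x))" for t
  have d: "continuous_on S d" for S
    unfolding d_def using continuous_integral_slice[OF m] continuous_on_subset by blast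
  have gd: "gint (\<lambda>p. complex_of_real (m p)) t = complex_of_real (d t)" for t
    unfolding gint_def d_def by (rule integral_of_real) (rule integrable_\<mu>[OF continuous_slice[OF m]])
  have cm: "continuous_on UNIV (\<lambda>p. complex_of_real (m p))" by (intro continuous_intros m)
  have "integral {0..2 * pi} (\<lambda>t. complex_of_real (d t)) = 0"
    using z J_eq[OF cm] by (simp add: km gd[abs_def])
  moreover have "((\<lambda>t. complex_of_real (d t)) has_integral complex_of_real (integral {0..2 * pi} d)) {0..2 * pi}"
    using has_integral_linear[OF integrable_integral[OF integrable_continuous_real[OF d]] bounded_linear_of_real]
    by (simp add: o_def)
  ultimately have "integral {0..2 * pi} d = 0" by (simp add: integral_unique)
  then have "(d has_integral 0) (cbox 0 (2 * pi))"
    using integrable_integral[OF integrable_continuous_real[OF d], of 0 "2 * pi"] by simp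
  then have "d t = 0"
    by (rule has_integral_0_cbox_imp_0[rotated 2])
      (use t d pi_gt_zero in \<open>auto simp: d_def m_def not_le intro!: integral_nonneg_AE\<close>)
  then have "AE x in \<mu>. m (t, x) = 0"
    unfolding d_def
    using integral_nonneg_eq_0_iff_AE[OF int] by (simp add: m_def)
  moreover have o: "open {x. m (t, x) \<noteq> 0}"
    by (rule open_Collect_neq[OF continuous_slice[OF m] continuous_on_const])
  ultimately have "emeasure \<mu> {x. m (t, x) \<noteq> 0} = 0"
    by (subst (asm) AE_iff_measurable[OF _ refl]) (auto simp: sets_\<mu> space_\<mu>)
  from open_null_empty[OF o this] show ?thesis by (auto simp: m_def)
qed

text \<open>Adding the flow time as an extra real variable makes the derivative along the field a
  partial derivative at time 0, which is smooth by the results on \<open>partial_last\<close>;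
  \<open>flow_T\<close> does the same for time translation.\<close>

definition flow_X :: "(real \<times> 'g \<Rightarrow> 'b) \<Rightarrow> (real \<times> 'g) \<times> real \<Rightarrow> 'b" where
  "flow_X w q = w (fst (fst q), snd (fst q) \<otimes> \<gamma> (snd q))"

definition flow_T :: "(real \<times> 'g \<Rightarrow> 'b) \<Rightarrow> (real \<times> 'g) \<times> real \<Rightarrow> 'b" where
  "flow_T w q = w (fst (fst q) + snd q, snd (fst q))"

definition D_X :: "(real \<times> 'g \<Rightarrow> 'b::real_normed_vector) \<Rightarrow> real \<times> 'g \<Rightarrow> 'b" where
  "D_X w p = partial_last (flow_X w) (p, 0)"

definition D_T :: "(real \<times> 'g \<Rightarrow> 'b::real_normed_vector) \<Rightarrow> real \<times> 'g \<Rightarrow> 'b" where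
  "D_T w p = partial_last (flow_T w) (p, 0)"

lemma smooth_proj:
  "smooth_map TGR euclidean_atlas (\<lambda>q. fst (fst q))"
  "smooth_map TGR A (\<lambda>q. snd (fst q))"
  "smooth_map TGR euclidean_atlas (\<lambda>q. snd q)"
  using smooth_map_compose[OF TGE TG smooth_atlas_euclidean smooth_map_fst[OF TG smooth_atlas_euclidean] smooth_map_fst[OF smooth_atlas_euclidean atlas]]
    smooth_map_compose[OF TGE TG atlas smooth_map_fst[OF TG smooth_atlas_euclidean] smooth_map_snd[OF smooth_atlas_euclidean atlas]]
    smooth_map_snd[OF TG smooth_atlas_euclidean] by auto

lemma smooth_map_mult_flow:
  "smooth_map TGR A (\<lambda>q. snd (fst q) \<otimes> \<gamma> (snd q))"
  by (rule smooth_map_mult[OF TGE smooth_proj(2) smooth_map_compose[OF TGE smooth_atlas_euclidean atlas smooth_proj(3) \<gamma>(1)]])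

lemma smooth_flow_X: "smooth_fun TG w \<Longrightarrow> smooth_fun TGR (flow_X w)"
  unfolding flow_X_def[abs_def]
  by (rule smooth_fun_pullback[OF TGE TG smooth_map_Pair[OF TGE smooth_atlas_euclidean atlas smooth_proj(1) smooth_map_mult_flow]])

lemma smooth_flow_T: "smooth_fun TG w \<Longrightarrow> smooth_fun TGR (flow_T w)"
  unfolding flow_T_def[abs_def]
proof (rule smooth_fun_pullback[OF TGE TG smooth_map_Pair[OF TGE smooth_atlas_euclidean atlas _ smooth_proj(2)]])
  show "smooth_map TGR euclidean_atlas (\<lambda>q. fst (fst q) + snd q)"
    using smooth_fun_add[OF TGE] smooth_proj(1,3) unfolding smooth_fun_def by blast
qed

lemma smooth_D_X: "smooth_fun TG w \<Longrightarrow> smooth_fun TG (D_X w)" for w :: "real \<times> 'g \<Rightarrow> 'b::euclidean_space"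
  unfolding D_X_def[abs_def] by (rule smooth_fun_slice[OF TG smooth_fun_partial_last(2)[OF TG smooth_flow_X]])

lemma smooth_D_T: "smooth_fun TG w \<Longrightarrow> smooth_fun TG (D_T w)" for w :: "real \<times> 'g \<Rightarrow> 'b::euclidean_space"
  unfolding D_T_def[abs_def] by (rule smooth_fun_slice[OF TG smooth_fun_partial_last(2)[OF TG smooth_flow_T]])

lemma D_X_derivative:
  fixes w :: "real \<times> 'g \<Rightarrow> 'b::euclidean_space"
  assumes "smooth_fun TG w"
  shows "((\<lambda>s. w (t, x \<otimes> \<gamma> s)) has_vector_derivative D_X w (t, x)) (at 0)"
  using smooth_fun_partial_last(1)[OF TG smooth_flow_X[OF assms], of "(t, x)" 0] by (simp add: flow_X_def D_X_def)

lemma D_T_derivative: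
  fixes w :: "real \<times> 'g \<Rightarrow> 'b::euclidean_space"
  assumes "smooth_fun TG w"
  shows "((\<lambda>s. w (s, x)) has_vector_derivative D_T w (t, x)) (at t)"
proof -
  have "((\<lambda>s. w (t + s, x)) has_vector_derivative D_T w (t, x)) (at (t - t))"
    using smooth_fun_partial_last(1)[OF TG smooth_flow_T[OF assms], of "(t, x)" 0] by (simp add: flow_T_def D_T_def)
  moreover have "((\<lambda>s. s - t) has_vector_derivative 1) (at t)" by (auto intro!: derivative_eq_intros)
  ultimately show ?thesis
    using vector_diff_chain_at[of "\<lambda>s. s - t" 1 t "\<lambda>s. w (t + s, x)" "D_T w (t, x)"] by (simp add: o_def)
qed

lemma vector_derivative_t_eq:
  fixes w :: "real \<times> 'g \<Rightarrow> 'b::euclidean_space"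
  assumes "smooth_fun TG w"
  shows "vector_derivative (\<lambda>s. w (s, x)) (at t) = D_T w (t, x)"
  by (rule vector_derivative_at[OF D_T_derivative[OF assms]])

lemma D_mult:
  fixes v w :: "real \<times> 'g \<Rightarrow> complex"
  assumes v: "smooth_fun TG v" and w: "smooth_fun TG w"
  shows "D_X (\<lambda>p. v p * w p) p = v p * D_X w p + D_X v p * w p"
    "D_T (\<lambda>p. v p * w p) p = v p * D_T w p + D_T v p * w p"
proof -
  obtain t x where p: "p = (t, x)" by (cases p)
  note vw = smooth_fun_mult[OF TG v w]
  show "D_X (\<lambda>p. v p * w p) p = v p * D_X w p + D_X v p * w p"
    using vector_derivative_unique_at[OF D_X_derivative[OF vw, of t x]
        has_vector_derivative_mult[OF D_X_derivative[OF v, of t x] D_X_derivative[OF w, of t x]]]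
    by (simp add: p \<gamma>(3))
  show "D_T (\<lambda>p. v p * w p) p = v p * D_T w p + D_T v p * w p"
    using vector_derivative_unique_at[OF D_T_derivative[OF vw, of x t]
        has_vector_derivative_mult[OF D_T_derivative[OF v, of x t] D_T_derivative[OF w, of x t]]]
    by (simp add: p)
qed

lemma continuous_smooth: "smooth_fun TG w \<Longrightarrow> continuous_on UNIV w"
  by (rule smooth_fun_continuous)

text \<open>Right invariance cancels the zeroth-order terms of the Taylor expansion along the flow,
  leaving |h| |gint(D_X w)| <= C h^2 for all small h.\<close>

lemma gint_D_X:
  assumes w: "smooth_fun TG w"
  shows "gint (D_X w) t = 0"
proof -
  note sf = smooth_flow_X[OF w]
  have "compact ({t} \<times> (UNIV :: 'g set))" by (intro compact_Times compact_group) auto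
  then obtain C where C: "C \<ge> 0" "\<And>p h. p \<in> {t} \<times> (UNIV :: 'g set) \<Longrightarrow> \<bar>h\<bar> \<le> 1 \<Longrightarrow>
      norm (flow_X w (p, h) - flow_X w (p, 0) - h *\<^sub>R D_X w p) \<le> C * h\<^sup>2"
    unfolding D_X_def by (rule smooth_fun_taylor_uniform[OF TG sf]) blast
  have cw: "continuous_on UNIV w" and cD: "continuous_on UNIV (D_X w)"
    using w smooth_D_X[OF w] by (auto intro: continuous_smooth)
  have "norm (gint (D_X w) t) \<le> C * h" if h: "0 < h" "h \<le> 1" for h
  proof -
    define k where "k p = w (fst p, snd p \<otimes> \<gamma> h) + (- 1) * w p + (- h) * D_X w p" for p
    have cs: "continuous_on UNIV (\<lambda>p :: real \<times> 'g. w (fst p, snd p \<otimes> \<gamma> h))"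
      by (intro continuous_on_compose2[OF cw] continuous_on_Pair
          continuous_on_compose2[OF continuous_mult_right] continuous_intros) auto
    have c2: "continuous_on UNIV (\<lambda>p. (- 1) * w p)" "continuous_on UNIV (\<lambda>p. complex_of_real (- h) * D_X w p)"
      by (intro continuous_on_mult_left cw cD)+
    have ck: "continuous_on UNIV k" unfolding k_def[abs_def]
      by (rule continuous_on_add[OF continuous_on_add[OF cs c2(1)] c2(2)])
    have "norm (gint k t) \<le> C * h\<^sup>2"
      using C(2)[of "(t, _)" h] h
      by (intro norm_gint ck) (simp add: k_def flow_X_def \<gamma>(3) scaleR_conv_of_real)
    moreover have "gint k t = (- h) * gint (D_X w) t"
    proof -
      have "gint (\<lambda>p. w (fst p, snd p \<otimes> \<gamma> h)) t = gint w t"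
        unfolding gint_def using integral_right_translate[OF continuous_slice[OF cw]] by simp
      moreover have "gint k t = gint (\<lambda>p. w (fst p, snd p \<otimes> \<gamma> h)) t + (- 1) * gint w t + complex_of_real (- h) * gint (D_X w) t"
        unfolding k_def
        by (subst gint_add[OF continuous_on_add[OF cs c2(1)] c2(2)], subst gint_add[OF cs c2(1)],
            subst gint_cmult[OF cw], subst gint_cmult[OF cD]) simp
      ultimately show ?thesis by simp
    qed
    ultimately have "h * norm (gint (D_X w) t) \<le> h * (C * h)"
      using h by (simp add: norm_mult power2_eq_square algebra_simps)
    then show ?thesis using h by simp
  qed
  note b = this
  have "norm (gint (D_X w) t) \<le> e" if e: "e > 0" for e
  proof -
    define h where "h = min 1 (e / (C + 1))"
    have h: "0 < h" "h \<le> 1" using e C(1) by (auto simp: h_def)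
    have "C * h \<le> C * (e / (C + 1))" using C(1) by (intro mult_left_mono) (auto simp: h_def)
    also have "\<dots> \<le> e" using C(1) e by (simp add: field_simps)
    finally show ?thesis using b[OF h] by linarith
  qed
  then have "norm (gint (D_X w) t) \<le> 0" by (meson dense_ge)
  then show ?thesis by simp
qed

text \<open>Integrating the uniform Taylor expansion over the group bounds the error of the linear
  approximation by C h^2.\<close>

lemma gint_D_T:
  assumes w: "smooth_fun TG w"
  shows "(gint w has_vector_derivative gint (D_T w) t) (at t)"
proof -
  note sf = smooth_flow_T[OF w]
  have "compact ({t} \<times> (UNIV :: 'g set))" by (intro compact_Times compact_group) auto
  then obtain C where C: "C \<ge> 0" "\<And>p h. p \<in> {t} \<times> (UNIV :: 'g set) \<Longrightarrow> \<bar>h\<bar> \<le> 1 \<Longrightarrow>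
      norm (flow_T w (p, h) - flow_T w (p, 0) - h *\<^sub>R D_T w p) \<le> C * h\<^sup>2"
    unfolding D_T_def by (rule smooth_fun_taylor_uniform[OF TG sf]) blast
  have cw: "continuous_on UNIV w" and cD: "continuous_on UNIV (D_T w)"
    using w smooth_D_T[OF w] by (auto intro: continuous_smooth)
  have b: "norm (gint w (t + h) - gint w t - h *\<^sub>R gint (D_T w) t) \<le> C * h\<^sup>2" if h: "\<bar>h\<bar> \<le> 1" for h
  proof -
    define k where "k p = w (fst p + h, snd p) + (- 1) * w p + (- h) * D_T w p" for p
    have cs: "continuous_on UNIV (\<lambda>p :: real \<times> 'g. w (fst p + h, snd p))"
      by (intro continuous_on_compose2[OF cw] continuous_on_Pair continuous_intros) auto
    have c2: "continuous_on UNIV (\<lambda>p. (- 1) * w p)" "continuous_on UNIV (\<lambda>p. complex_of_real (- h) * D_T w p)"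
      by (intro continuous_on_mult_left cw cD)+
    have ck: "continuous_on UNIV k" unfolding k_def[abs_def]
      by (rule continuous_on_add[OF continuous_on_add[OF cs c2(1)] c2(2)])
    have "norm (gint k t) \<le> C * h\<^sup>2"
      using C(2)[of "(t, _)" h] h
      by (intro norm_gint ck) (simp add: k_def flow_T_def scaleR_conv_of_real)
    moreover have "gint k t = gint w (t + h) - gint w t - h *\<^sub>R gint (D_T w) t"
    proof -
      have "gint (\<lambda>p. w (fst p + h, snd p)) t = gint w (t + h)" unfolding gint_def by simp
      moreover have "gint k t = gint (\<lambda>p. w (fst p + h, snd p)) t + (- 1) * gint w t + complex_of_real (- h) * gint (D_T w) t"
        unfolding k_def
        by (subst gint_add[OF continuous_on_add[OF cs c2(1)] c2(2)], subst gint_add[OF cs c2(1)],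
            subst gint_cmult[OF cw], subst gint_cmult[OF cD]) simp
      ultimately show ?thesis by (simp add: scaleR_conv_of_real)
    qed
    ultimately show ?thesis by simp
  qed
  show ?thesis unfolding has_vector_derivative_def
  proof (rule has_derivativeI_sandwich[of 1])
    show "norm (gint w y - gint w t - (y - t) *\<^sub>R gint (D_T w) t) / norm (y - t) \<le> C * \<bar>y - t\<bar>"
      if "y \<noteq> t" "dist y t < 1" for y
      using b[of "y - t"] that by (simp add: dist_real_def divide_le_eq power2_eq_square mult.assoc)
    show "((\<lambda>y. C * \<bar>y - t\<bar>) \<longlongrightarrow> 0) (at t)" by (auto intro!: tendsto_eq_intros)
  qed (auto intro: bounded_linear_scaleR_left)
qed

lemma J_D_X: "smooth_fun TG w \<Longrightarrow> J (D_X w) = 0"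
proof -
  assume w: "smooth_fun TG w"
  then have "gint (D_X w) = (\<lambda>t. 0)" by (intro ext gint_D_X)
  then show ?thesis by (simp add: J_eq continuous_smooth smooth_D_X w)
qed

lemma J_D_T:
  assumes w: "w \<in> TG_smooth A"
  shows "J (D_T w) = 0"
proof -
  have sw: "smooth_fun TG w" and per: "\<And>t x. w (t + 2 * pi, x) = w (t, x)" using w by (auto simp: TG_smooth_def)
  have "(gint (D_T w) has_integral gint w (2 * pi) - gint w 0) {0..2 * pi}"
    by (rule fundamental_theorem_of_calculus)
      (auto intro: has_vector_derivative_at_within gint_D_T[OF sw])
  moreover have "gint w (2 * pi) = gint w 0" using per[of 0] by (simp add: gint_def)
  ultimately show ?thesis using J_eq[OF continuous_smooth[OF smooth_D_T[OF sw]]] by (simp add: integral_unique)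
qed

lemma TG_smooth_mult: "v \<in> TG_smooth A \<Longrightarrow> w \<in> TG_smooth A \<Longrightarrow> (\<lambda>p. v p * w p) \<in> TG_smooth A"
  by (auto simp: TG_smooth_def intro: smooth_fun_mult TG)

text \<open>The derivative of a product integrates to zero: along the field by invariance of Haar
  measure, in time by periodicity.\<close>

lemma J_by_parts:
  assumes v: "v \<in> TG_smooth A" and w: "w \<in> TG_smooth A"
  shows "J (\<lambda>p. v p * D_X w p) = - J (\<lambda>p. D_X v p * w p)"
    "J (\<lambda>p. v p * D_T w p) = - J (\<lambda>p. D_T v p * w p)"
proof -
  have sv: "smooth_fun TG v" and sw: "smooth_fun TG w" using v w by (auto simp: TG_smooth_def)
  have c: "continuous_on UNIV (\<lambda>p. f p * g p)" if "smooth_fun TG f" "smooth_fun TG g" for f g :: "real \<times> 'g \<Rightarrow> complex"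
    by (intro continuous_on_mult continuous_smooth that)
  show "J (\<lambda>p. v p * D_X w p) = - J (\<lambda>p. D_X v p * w p)"
    using J_D_X[OF smooth_fun_mult[OF TG sv sw]] J_add[OF c[OF sv smooth_D_X[OF sw]] c[OF smooth_D_X[OF sv] sw]]
    by (simp add: D_mult[OF sv sw, abs_def] eq_neg_iff_add_eq_0)
  show "J (\<lambda>p. v p * D_T w p) = - J (\<lambda>p. D_T v p * w p)"
    using J_D_T[OF TG_smooth_mult[OF v w]] J_add[OF c[OF sv smooth_D_T[OF sw]] c[OF smooth_D_T[OF sv] sw]]
    by (simp add: D_mult[OF sv sw, abs_def] eq_neg_iff_add_eq_0)
qed

end

section \<open>A singular solution\<close>

lemma circle_smooth_bounded:
  fixes h :: "real \<Rightarrow> 'b::real_normed_vector"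
  assumes "circle_smooth h"
  obtains M where "M \<ge> 0" "\<And>t. norm (h t) \<le> M"
proof -
  have c: "continuous_on {0..2 * pi} h"
    using assms smooth_on_continuous_on continuous_on_subset unfolding circle_smooth_def by blast
  obtain M where "\<forall>y\<in>h ` {0..2 * pi}. norm y \<le> M"
    using compact_imp_bounded[OF compact_continuous_image[OF c compact_Icc]] unfolding bounded_iff by blast
  then have M: "norm (h t) \<le> M" if "t \<in> {0..2 * pi}" for t using that by blast
  have "norm (h t) \<le> M" for t
  proof -
    obtain n where n: "0 \<le> t - 2 * pi * of_int n" "t - 2 * pi * of_int n < 0 + 2 * pi"
      by (rule periodize_point[of 0 t])
    then have "norm (h (t - 2 * pi * of_int n)) \<le> M" by (intro M) auto
    moreover have "h (t - 2 * pi * of_int n) = h t"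
      by (rule periodic_int) (use assms in \<open>simp add: circle_smooth_def\<close>)
    ultimately show ?thesis by simp
  qed
  moreover from this[of 0] have "M \<ge> 0" using norm_ge_zero order_trans by blast
  ultimately show thesis by (rule that[rotated])
qed

lemma circle_smooth_derivative:
  assumes E: "circle_smooth E"
  shows "(E has_vector_derivative vector_derivative E (at t)) (at t)"
    "circle_smooth (\<lambda>t. vector_derivative E (at t))"
proof -
  have d: "(E has_vector_derivative frechet_derivative E (at t) 1) (at t)" for t
    using E smooth_on_has_vector_derivative[of UNIV E t] by (simp add: circle_smooth_def)
  then have v: "vector_derivative E (at t) = frechet_derivative E (at t) 1" for t
    by (rule vector_derivative_at)
  show "(E has_vector_derivative vector_derivative E (at t)) (at t)" unfolding v by (rule d)
  have "frechet_derivative E (at (t + 2 * pi)) 1 = frechet_derivative E (at t) 1" for t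
  proof -
    have "((\<lambda>s. s + 2 * pi) has_vector_derivative 1) (at t)" by (auto intro!: derivative_eq_intros)
    from vector_diff_chain_at[OF this d]
    have "((\<lambda>s. E (s + 2 * pi)) has_vector_derivative frechet_derivative E (at (t + 2 * pi)) 1) (at t)"
      by (simp add: o_def)
    moreover have "(\<lambda>s. E (s + 2 * pi)) = E" using E by (auto simp: circle_smooth_def)
    ultimately show ?thesis using d vector_derivative_unique_at by metis
  qed
  then show "circle_smooth (\<lambda>t. vector_derivative E (at t))"
    using E by (simp add: circle_smooth_def v smooth_on_imp_frechet)
qed

context haar_flow
begin

section \<open>Test functions and limits under the pairing\<close>

lemma smooth_time: "smooth_on UNIV h \<Longrightarrow> smooth_fun TG (\<lambda>p. h (fst p))" for h :: "real \<Rightarrow> 'b::euclidean_space"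
  by (rule smooth_fun_pullback[OF TG smooth_atlas_euclidean smooth_map_fst[OF smooth_atlas_euclidean atlas]])
    (simp add: smooth_fun_def smooth_map_euclidean_iff)

lemma TG_smooth_time: "circle_smooth h \<Longrightarrow> (\<lambda>p. h (fst p)) \<in> TG_smooth A" for h :: "real \<Rightarrow> complex"
  by (simp add: TG_smooth_def circle_smooth_def smooth_time)

lemma TG_smooth_add: "v \<in> TG_smooth A \<Longrightarrow> w \<in> TG_smooth A \<Longrightarrow> (\<lambda>p. v p + w p) \<in> TG_smooth A"
  by (auto simp: TG_smooth_def intro: smooth_fun_add TG)

lemma TG_smooth_diff: "v \<in> TG_smooth A \<Longrightarrow> w \<in> TG_smooth A \<Longrightarrow> (\<lambda>p. v p - w p) \<in> TG_smooth A"
  by (auto simp: TG_smooth_def intro: smooth_fun_diff TG)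

lemma TG_smooth_cnj: "v \<in> TG_smooth A \<Longrightarrow> (\<lambda>p. cnj (v p)) \<in> TG_smooth A"
  by (auto simp: TG_smooth_def intro: smooth_fun_linear_comp TG bounded_linear_cnj)

lemma TG_smooth_continuous: "v \<in> TG_smooth A \<Longrightarrow> continuous_on UNIV v"
  by (auto simp: TG_smooth_def intro: continuous_smooth)

abbreviation period_cell :: "(real \<times> 'g) set" where "period_cell \<equiv> {0..2 * pi} \<times> UNIV"

lemma bounded_on_cell:
  fixes k :: "real \<times> 'g \<Rightarrow> complex"
  assumes "continuous_on UNIV k"
  obtains M where "M > 0" "\<And>p. p \<in> period_cell \<Longrightarrow> norm (k p) \<le> M"
proof -
  have "compact (k ` period_cell)"
    by (intro compact_continuous_image continuous_on_subset[OF assms] compact_Times compact_Icc compact_group) auto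
  then obtain M where M: "M > 0" "\<forall>y\<in>k ` period_cell. norm y \<le> M"
    using compact_imp_bounded[THEN bounded_pos[THEN iffD1]] by blast
  then show thesis using that by blast
qed

lemma J_tendsto:
  assumes k: "\<And>n. continuous_on UNIV (k n)" and l: "continuous_on UNIV l" and \<psi>: "continuous_on UNIV \<psi>"
    and u: "uniform_limit period_cell k l sequentially"
  shows "(\<lambda>n. J (\<lambda>p. k n p * \<psi> p)) \<longlonglongrightarrow> J (\<lambda>p. l p * \<psi> p)"
proof (rule tendstoI)
  fix e :: real assume e: "e > 0"
  obtain M where M: "M > 0" "\<And>p. p \<in> period_cell \<Longrightarrow> norm (\<psi> p) \<le> M" using bounded_on_cell[OF \<psi>] by blast
  define d where "d = e / (M * (2 * pi) * 2)"
  have d: "d > 0" using e M by (simp add: d_def)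
  have "\<forall>\<^sub>F n in sequentially. \<forall>p\<in>period_cell. dist (k n p) (l p) < d"
    using u d unfolding uniform_limit_iff by blast
  then show "\<forall>\<^sub>F n in sequentially. dist (J (\<lambda>p. k n p * \<psi> p)) (J (\<lambda>p. l p * \<psi> p)) < e"
  proof eventually_elim
    case (elim n)
    have c: "continuous_on UNIV (\<lambda>p. k n p * \<psi> p)" "continuous_on UNIV (\<lambda>p. l p * \<psi> p)"
      using k l \<psi> by (auto intro: continuous_on_mult)
    have "norm (J (\<lambda>p. k n p * \<psi> p - l p * \<psi> p)) \<le> d * M * (2 * pi)"
    proof (rule norm_J)
      fix t x assume t: "0 \<le> (t::real)" "t \<le> 2 * pi"
      have "norm (k n (t, x) * \<psi> (t, x) - l (t, x) * \<psi> (t, x)) = dist (k n (t, x)) (l (t, x)) * norm (\<psi> (t, x))"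
        by (simp add: dist_norm norm_mult[symmetric] algebra_simps)
      also have "\<dots> \<le> d * M" using elim M t d by (intro mult_mono) (auto intro: less_imp_le)
      finally show "norm (k n (t, x) * \<psi> (t, x) - l (t, x) * \<psi> (t, x)) \<le> d * M" .
    qed (intro continuous_on_diff c)
    also have "d * M * (2 * pi) = e / 2" using M by (simp add: d_def)
    finally show ?case using e by (simp add: J_diff[OF c] dist_norm)
  qed
qed

text \<open>Only the empty list of directions is used. Convergence is uniform on compact sets within
  a chart, and by compactness finitely many of them cover the group.\<close>

lemma smooth_converges_uniform:
  assumes "smooth_converges TG F f"
  shows "uniform_limit period_cell F f sequentially"
proof -
  have "\<exists>N. open N \<and> x \<in> N \<and> uniform_limit ({0..2 * pi} \<times> N) F f sequentially" for x :: 'g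
  proof -
    obtain U \<phi> where U: "(U, \<phi>) \<in> A" "x \<in> U" using smooth_atlas_cover[OF atlas] by blast
    note c = smooth_atlasD[OF atlas U(1)]
    obtain r where r: "r > 0" "cball (\<phi> x) r \<subseteq> \<phi> ` U" using c(2) U(2) open_contains_cball by (metis imageI)
    define N where "N = U \<inter> \<phi> -` ball (\<phi> x) r"
    have N: "open N" "x \<in> N"
      using c(1,5) U(2) r by (auto simp: N_def continuous_on_open_vimage Int_commute)
    have E: "(UNIV, id) \<in> (euclidean_atlas :: (real, real) chart set)" by (simp add: euclidean_atlas_def)
    have ch: "(UNIV \<times> U, map_prod id \<phi>) \<in> TG" using U E unfolding prod_atlas_def by blast
    have im: "map_prod id \<phi> ` (UNIV \<times> U) = UNIV \<times> \<phi> ` U" by (simp add: map_prod_surj_on)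
    have K: "compact ({0..2 * pi} \<times> cball (\<phi> x) r)" "{0..2 * pi} \<times> cball (\<phi> x) r \<subseteq> map_prod id \<phi> ` (UNIV \<times> U)"
      using r by (auto simp: im intro: compact_Times)
    define i where "i = inv_into (UNIV \<times> U) (map_prod (id :: real \<Rightarrow> real) \<phi>)"
    have "uniform_limit ({0..2 * pi} \<times> cball (\<phi> x) r) (\<lambda>n. dir_deriv [] (F n \<circ> i)) (dir_deriv [] (f \<circ> i)) sequentially"
      using assms ch K unfolding smooth_converges_def i_def by blast
    then have u: "uniform_limit ({0..2 * pi} \<times> cball (\<phi> x) r) (\<lambda>n. F n \<circ> i) (f \<circ> i) sequentially" by simp
    have i: "i (t, \<phi> y) = (t, y)" if "y \<in> U" for t y
      using prod_chart_simps[OF smooth_atlas_euclidean atlas E U(1), of "(t, \<phi> y)"] that c(4)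
      by (simp add: i_def inv_into_UNIV_id)
    have "uniform_limit ({0..2 * pi} \<times> N) F f sequentially"
      unfolding uniform_limit_iff
    proof (intro allI impI)
      fix e :: real assume "e > 0"
      then have "\<forall>\<^sub>F n in sequentially. \<forall>q\<in>{0..2 * pi} \<times> cball (\<phi> x) r. dist ((F n \<circ> i) q) ((f \<circ> i) q) < e"
        using u unfolding uniform_limit_iff by blast
      then show "\<forall>\<^sub>F n in sequentially. \<forall>p\<in>{0..2 * pi} \<times> N. dist (F n p) (f p) < e"
      proof eventually_elim
        case (elim n)
        show ?case
        proof
          fix p assume p: "p \<in> {0..2 * pi} \<times> N"
          then have "(fst p, \<phi> (snd p)) \<in> {0..2 * pi} \<times> cball (\<phi> x) r" by (auto simp: N_def)
          with elim have "dist ((F n \<circ> i) (fst p, \<phi> (snd p))) ((f \<circ> i) (fst p, \<phi> (snd p))) < e" by blast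
          then show "dist (F n p) (f p) < e" using p i[of "snd p" "fst p"] by (auto simp: N_def)
        qed
      qed
    qed
    then show ?thesis using N by blast
  qed
  then obtain N where N: "\<And>x. open (N x)" "\<And>x. x \<in> N x"
    "\<And>x. uniform_limit ({0..2 * pi} \<times> N x) F f sequentially" by metis
  obtain S where S: "finite S" "UNIV \<subseteq> (\<Union>x\<in>S. N x)"
    by (rule compactE_image[OF compact_group, of UNIV N]) (use N in auto)
  have "uniform_limit (\<Union>((\<lambda>x. {0..2 * pi} \<times> N x) ` S)) F f sequentially"
    by (rule uniform_limit_on_Union) (use S N in auto)
  moreover have "\<Union>((\<lambda>x. {0..2 * pi} \<times> N x) ` S) = period_cell" using S by auto
  ultimately show ?thesis by simp
qed

lemma J_distribution:
  assumes "continuous_on UNIV k"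
  shows "(\<lambda>\<phi>. J (\<lambda>p. k p * \<phi> p)) \<in> distributions A"
  unfolding distributions_def
proof (intro CollectI conjI ballI allI impI)
  have c: "continuous_on UNIV (\<lambda>p. k p * f p)" if "f \<in> TG_smooth A" for f
    by (intro continuous_on_mult assms TG_smooth_continuous that)
  show "J (\<lambda>p. k p * (f p + g p)) = J (\<lambda>p. k p * f p) + J (\<lambda>p. k p * g p)"
    if "f \<in> TG_smooth A" "g \<in> TG_smooth A" for f g
    using J_add[OF c[OF that(1)] c[OF that(2)]] by (simp add: distrib_left)
  show "J (\<lambda>p. k p * (a * f p)) = a * J (\<lambda>p. k p * f p)" if "f \<in> TG_smooth A" for a f
    using J_cmult[OF c[OF that], of a] by (simp add: mult.left_commute)
  show "(\<lambda>n. J (\<lambda>p. k p * F n p)) \<longlonglongrightarrow> J (\<lambda>p. k p * f p)"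
    if "\<forall>n. F n \<in> TG_smooth A" "f \<in> TG_smooth A" "smooth_converges TG F f" for F f
    using J_tendsto[OF _ _ assms smooth_converges_uniform[OF that(3)]] that(1,2)
    by (simp add: TG_smooth_continuous mult.commute)
qed

text \<open>The operator acts by transposition, so the coefficient appears inside the field; it
  depends on t alone and comes out again.\<close>

lemma L_op_J:
  fixes b :: "real \<Rightarrow> real" and a0 :: real
  assumes \<phi>: "\<phi> \<in> TG_smooth A" and c: "c = (\<lambda>t. complex_of_real a0 + \<i> * complex_of_real (b t))"
  shows "L_op G A X a0 b q (\<lambda>\<phi>. J (\<lambda>p. k p * \<phi> p)) \<phi> =
    - J (\<lambda>p. k p * D_T \<phi> p) - J (\<lambda>p. k p * (c (fst p) * D_X \<phi> p)) + q * J (\<lambda>p. k p * \<phi> p)"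
proof -
  have s\<phi>: "smooth_fun TG \<phi>" using \<phi> by (simp add: TG_smooth_def)
  have 1: "(\<lambda>(t, x). vector_derivative (\<lambda>s. \<phi> (s, x)) (at t)) = D_T \<phi>"
    by (auto simp: vector_derivative_t_eq[OF s\<phi>])
  have 2: "(\<lambda>(t, x). left_inv_field G A X (\<lambda>y. c t * \<phi> (t, y)) x) = (\<lambda>p. c (fst p) * D_X \<phi> p)"
  proof (rule ext, clarify)
    fix t :: real and x :: 'g
    have "((\<lambda>s. c t * \<phi> (t, x \<otimes> \<gamma> s)) has_vector_derivative c t * D_X \<phi> (t, x)) (at 0)"
      by (rule has_vector_derivative_mult_right[OF D_X_derivative[OF s\<phi>]])
    then show "left_inv_field G A X (\<lambda>y. c t * \<phi> (t, y)) x = c (fst (t, x)) * D_X \<phi> (t, x)"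
      unfolding left_inv_field_def lie_exp_eq[OF flow] by (simp add: vector_derivative_at)
  qed
  show ?thesis
    unfolding L_op_def dist_dt_def dist_mult_def dist_field_def 1
    by (simp only: c[symmetric, THEN fun_cong] prod.case 2) (simp add: c)
qed

end

lemma has_vector_derivative_integral_param:
  fixes \<Psi> :: "real \<times> real \<Rightarrow> complex"
  assumes \<Psi>: "smooth_on UNIV \<Psi>"
  shows "((\<lambda>r. integral {a..b} (\<lambda>s. \<Psi> (s, r))) has_vector_derivative
    integral {a..b} (\<lambda>s. vector_derivative (\<lambda>r. \<Psi> (s, r)) (at r\<^sub>0))) (at r\<^sub>0)"
proof -
  have sf: "smooth_fun (prod_atlas euclidean_atlas euclidean_atlas) \<Psi>"
    using \<Psi> by (simp add: prod_atlas_euclidean smooth_fun_def smooth_map_euclidean_iff)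
  note d = smooth_fun_partial_last[OF smooth_atlas_euclidean sf]
  have cp: "continuous_on S (partial_last \<Psi>)" for S
    using smooth_fun_continuous[OF d(2)] continuous_on_subset by blast
  have c\<Psi>: "continuous_on S \<Psi>" for S using smooth_on_continuous_on[OF \<Psi>] continuous_on_subset by blast
  have "((\<lambda>r. integral (cbox a b) (\<lambda>s. \<Psi> (s, r))) has_vector_derivative
      integral (cbox a b) (\<lambda>s. partial_last \<Psi> (s, r\<^sub>0))) (at r\<^sub>0 within UNIV)"
  proof (rule leibniz_rule_vector_derivative)
    show "(\<lambda>s. \<Psi> (s, r)) integrable_on cbox a b" for r
      by (intro integrable_continuous continuous_on_compose2[OF c\<Psi>[of UNIV]]) (auto intro!: continuous_intros)
    show "continuous_on (UNIV \<times> cbox a b) (\<lambda>(r, s). partial_last \<Psi> (s, r))"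
      unfolding case_prod_beta'
      by (intro continuous_on_compose2[OF cp[of UNIV]]) (auto intro!: continuous_intros)
  qed (use d(1) in auto)
  then show ?thesis by (simp add: partial_last_def)
qed

text \<open>The bound on \<kappa> \<beta> lets \<beta> absorb half of itself in Re Z; the bound on
  \<open>R\<close> keeps |s + \<alpha>| >= 1 at both ends of the integration.\<close>

locale singular_solution = haar_flow G A \<mu> X \<gamma>
  for G :: "('g::t2_space, 'x) monoid_scheme" (structure)
    and A :: "('g, 'e::euclidean_space) chart set" and \<mu> X \<gamma> +
  fixes f :: "'g \<Rightarrow> real" and \<alpha> \<beta> b :: "real \<Rightarrow> real" and E :: "real \<Rightarrow> complex"
    and a0 t\<^sub>0 \<delta> \<kappa> R :: real and q :: complex
  assumes f: "smooth_fun A f" "f \<one> = 0" "X f = 1"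
    and \<alpha>: "circle_smooth \<alpha>" and \<beta>: "circle_smooth \<beta>" and E: "circle_smooth E" and b: "circle_smooth b"
    and \<delta>: "\<delta> > 0" and \<beta>_nonneg: "\<And>t. \<beta> t \<ge> 0"
    and at_t0: "\<alpha> t\<^sub>0 = 0" "\<beta> t\<^sub>0 = 0" "E t\<^sub>0 \<noteq> 0"
    and d\<alpha>: "\<And>t. E t \<noteq> 0 \<Longrightarrow> (\<alpha> has_vector_derivative a0) (at t)"
    and d\<beta>: "\<And>t. E t \<noteq> 0 \<Longrightarrow> (\<beta> has_vector_derivative b t) (at t)"
    and nz: "\<And>t. vector_derivative E (at t) + q * E t \<noteq> 0 \<Longrightarrow> \<delta> \<le> \<beta> t"
    and \<kappa>: "\<kappa> > 0" "\<And>t. \<kappa> * \<beta> t \<le> 1 / 2"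
    and R: "\<And>t. \<bar>\<alpha> t\<bar> + 1 \<le> R"
begin

definition zeta :: "complex \<Rightarrow> complex" where
  "zeta w = - \<i> * w + complex_of_real \<kappa> * w\<^sup>2"

definition wpt :: "real \<Rightarrow> real \<Rightarrow> complex" where
  "wpt t s = complex_of_real (s + \<alpha> t) + \<i> * complex_of_real (\<beta> t)"

definition Z :: "(real \<times> 'g) \<times> real \<Rightarrow> complex" where
  "Z p = \<i> * complex_of_real (f (snd (fst p) \<otimes> \<gamma> (snd p))) + zeta (wpt (fst (fst p)) (snd p))"

definition c :: "real \<Rightarrow> complex" where "c t = complex_of_real a0 + \<i> * complex_of_real (b t)"

definition E1 :: "real \<Rightarrow> complex" where "E1 t = vector_derivative E (at t) + q * E t"

text \<open>For \<epsilon> > 0 the argument of the root has positive real part and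
  \<open>W \<epsilon>\<close> is smooth; \<open>W 0\<close> is the singular integral itself.\<close>

definition W :: "real \<Rightarrow> real \<times> 'g \<Rightarrow> complex" where
  "W \<epsilon> p = integral {- R..R} (\<lambda>s. csqrt (complex_of_real \<epsilon> + Z (p, s)))"

definition B :: "real \<Rightarrow> real \<times> 'g \<Rightarrow> complex" where
  "B \<epsilon> p = csqrt (complex_of_real \<epsilon> + Z (p, R)) - csqrt (complex_of_real \<epsilon> + Z (p, - R))"

definition V :: "real \<Rightarrow> real \<times> 'g \<Rightarrow> complex" where "V \<epsilon> p = E (fst p) * W \<epsilon> p"

text \<open>The image of \<open>V \<epsilon>\<close> under the operator: the first term comes from
  E' + q E, the second from the endpoints of the integral over s.\<close>

definition P :: "real \<Rightarrow> real \<times> 'g \<Rightarrow> complex" where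
  "P \<epsilon> p = E1 (fst p) * W \<epsilon> p + E (fst p) * c (fst p) * B \<epsilon> p"

section \<open>Lower bounds for the real part of Z\<close>

lemma R_pos: "R > 0" using R[of 0] by linarith

lemma Re_Z: "Re (Z ((t, x), s)) = \<beta> t - \<kappa> * (\<beta> t)\<^sup>2 + \<kappa> * (s + \<alpha> t)\<^sup>2"
  by (simp add: Z_def zeta_def wpt_def Re_power2 algebra_simps)

text \<open>The square of i \<beta> costs \<kappa> \<beta>^2, at most \<beta>/2 by the choice of
  \<kappa>.\<close>

lemma Re_Z_lower: "\<beta> t / 2 + \<kappa> * (s + \<alpha> t)\<^sup>2 \<le> Re (Z ((t, x), s))"
proof -
  have "\<kappa> * \<beta> t * \<beta> t \<le> 1 / 2 * \<beta> t" by (intro mult_right_mono \<kappa> \<beta>_nonneg)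
  then show ?thesis by (simp add: Re_Z power2_eq_square algebra_simps)
qed

lemma Re_Z_nonneg: "Re (Z p) \<ge> 0"
proof -
  obtain t x s where p: "p = ((t, x), s)" by (metis prod.exhaust)
  have "0 \<le> \<beta> t / 2 + \<kappa> * (s + \<alpha> t)\<^sup>2" using \<beta>_nonneg[of t] \<kappa>(1) by simp
  then show ?thesis using Re_Z_lower[of t s x] by (simp add: p)
qed

lemma Re_Z_ends: "\<kappa> \<le> Re (Z (p, R))" "\<kappa> \<le> Re (Z (p, - R))"
proof -
  obtain t x where p: "p = (t, x)" by (metis prod.exhaust)
  have "1 \<le> \<bar>R + \<alpha> t\<bar>" "1 \<le> \<bar>- R + \<alpha> t\<bar>" using R[of t] by (auto simp: abs_if split: if_splits)
  then have "1\<^sup>2 \<le> (R + \<alpha> t)\<^sup>2" "1\<^sup>2 \<le> (- R + \<alpha> t)\<^sup>2"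
    unfolding abs_le_square_iff[symmetric] by simp_all
  then have "\<kappa> * 1 \<le> \<kappa> * (R + \<alpha> t)\<^sup>2" "\<kappa> * 1 \<le> \<kappa> * (- R + \<alpha> t)\<^sup>2"
    using \<kappa>(1) by (intro mult_left_mono; simp)+
  then show "\<kappa> \<le> Re (Z (p, R))" "\<kappa> \<le> Re (Z (p, - R))"
    using Re_Z_lower[of t R x] Re_Z_lower[of t "- R" x] \<beta>_nonneg[of t] unfolding p by linarith+
qed

lemma smooth_Z: "smooth_fun TGR Z"
proof -
  have t: "smooth_fun TGR (\<lambda>p. h (fst (fst p)))"
    if "circle_smooth h" for h :: "real \<Rightarrow> real"
    by (rule smooth_fun_compose[OF TGE]) (use smooth_proj(1) that in \<open>auto simp: smooth_fun_def circle_smooth_def\<close>)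
  have s: "smooth_fun TGR (\<lambda>p. snd p)"
    using smooth_proj(3) by (simp add: smooth_fun_def)
  have of_real: "smooth_fun TGR (\<lambda>p. complex_of_real (h p))"
    if "smooth_fun TGR h" for h
    by (rule smooth_fun_linear_comp[OF TGE that bounded_linear_of_real])
  have fs: "smooth_fun TGR (\<lambda>p. f (snd (fst p) \<otimes> \<gamma> (snd p)))"
    by (rule smooth_fun_pullback[OF TGE atlas smooth_map_mult_flow f(1)])
  show ?thesis
    unfolding Z_def[abs_def] zeta_def wpt_def power2_eq_square
    by (intro smooth_fun_add smooth_fun_mult smooth_fun_const of_real fs t s \<alpha> \<beta> TGE)
qed

lemma smooth_h_Z:
  "smooth_on UNIV h \<Longrightarrow> smooth_fun TGR (\<lambda>p. h (Z p))"
  for h :: "complex \<Rightarrow> complex"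
  by (rule smooth_fun_compose[OF TGE smooth_Z])

lemma Z_periodic: "Z ((t + 2 * pi, x), s) = Z ((t, x), s)"
  using \<alpha> \<beta> by (simp add: Z_def wpt_def circle_smooth_def)

text \<open>A function smooth on the whole plane that agrees on the range of \<open>Z\<close> with
  the root of \<epsilon> + Z.\<close>

definition csqrt_shift :: "real \<Rightarrow> complex \<Rightarrow> complex" where
  "csqrt_shift \<epsilon> z = csqrt_cut \<epsilon> (complex_of_real \<epsilon> + z)"

lemma smooth_csqrt_shift: "\<epsilon> > 0 \<Longrightarrow> smooth_on UNIV (csqrt_shift \<epsilon>)"
  unfolding csqrt_shift_def[abs_def]
  by (rule smooth_on_compose[OF open_UNIV open_UNIV _ _ smooth_on_csqrt_cut])
    (auto intro!: smooth_on_add smooth_on_const smooth_on_ident)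

lemma csqrt_shift_Z: "\<epsilon> > 0 \<Longrightarrow> csqrt_shift \<epsilon> (Z p) = csqrt (complex_of_real \<epsilon> + Z p)"
  unfolding csqrt_shift_def by (rule csqrt_cut_eq) (use Re_Z_nonneg[of p] in auto)

lemma W_csqrt_shift: "\<epsilon> > 0 \<Longrightarrow> W \<epsilon> p = integral {- R..R} (\<lambda>s. csqrt_shift \<epsilon> (Z (p, s)))"
  by (simp add: W_def csqrt_shift_Z)

lemma smooth_W:
  assumes "\<epsilon> > 0"
  shows "smooth_fun TG (W \<epsilon>)"
proof -
  have "W \<epsilon> = (\<lambda>p. integral {- R..R} (\<lambda>s. csqrt_shift \<epsilon> (Z (p, s))))" by (rule ext) (rule W_csqrt_shift[OF assms])
  then show ?thesis using smooth_fun_integral[OF TG smooth_h_Z[OF smooth_csqrt_shift[OF assms]], of "- R" R] by simp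
qed

lemma circle_E1: "circle_smooth E1"
  using circle_smooth_derivative(2)[OF E] E unfolding circle_smooth_def E1_def
  by (auto intro!: smooth_on_add smooth_on_mult smooth_on_const)

lemma circle_c: "circle_smooth c"
proof -
  have bs: "smooth_on UNIV b" using b by (simp add: circle_smooth_def)
  have "smooth_on UNIV (\<lambda>t. complex_of_real a0 + \<i> * complex_of_real (b t))"
    by (intro smooth_on_mult smooth_on_add smooth_on_const open_UNIV
        smooth_on_linear_comp[OF open_UNIV bounded_linear_of_real bs])
  then show ?thesis using b by (simp add: circle_smooth_def c_def[abs_def])
qed

lemma circle_Ec: "circle_smooth (\<lambda>t. E t * c t)"
  using E circle_c by (simp add: circle_smooth_def smooth_on_mult)

lemma TG_V: "\<epsilon> > 0 \<Longrightarrow> V \<epsilon> \<in> TG_smooth A"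
proof -
  assume "\<epsilon> > 0"
  then have "W \<epsilon> \<in> TG_smooth A" by (simp add: TG_smooth_def smooth_W) (simp add: W_def Z_periodic)
  then show ?thesis unfolding V_def[abs_def] by (intro TG_smooth_mult TG_smooth_time E)
qed

text \<open>The root is needed only away from its singularity: where \<open>E1\<close> is nonzero,
  \<beta> >= \<delta> and hence Re Z >= \<delta>/2, and at the endpoints Re Z >= \<kappa>. There it
  may be replaced by a globally smooth cut-off root.\<close>

lemma TG_P0: "P 0 \<in> TG_smooth A"
proof -
  define w where "w p = integral {- R..R} (\<lambda>s. csqrt_cut (\<delta> / 2) (Z (p, s)))" for p
  define e where "e p = csqrt_cut \<kappa> (Z (p, R)) - csqrt_cut \<kappa> (Z (p, - R))" for p
  have "smooth_fun TG w" unfolding w_def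
    by (rule smooth_fun_integral[OF TG smooth_h_Z[OF smooth_on_csqrt_cut]]) (use \<delta> in simp)
  then have w: "w \<in> TG_smooth A" by (simp add: TG_smooth_def) (simp add: w_def Z_periodic)
  have "smooth_fun TG e" unfolding e_def
    by (intro smooth_fun_diff TG smooth_fun_slice[OF TG smooth_h_Z[OF smooth_on_csqrt_cut]] \<kappa>)
  then have e: "e \<in> TG_smooth A" by (simp add: TG_smooth_def) (simp add: e_def Z_periodic)
  have "P 0 p = E1 (fst p) * w p + (E (fst p) * c (fst p)) * e p" for p
  proof -
    have "B 0 p = e p" by (simp add: B_def e_def csqrt_cut_eq[OF \<kappa>(1)] Re_Z_ends)
    moreover have "W 0 p = w p" if n: "E1 (fst p) \<noteq> 0"
    proof -
      have "csqrt_cut (\<delta> / 2) (Z (p, s)) = csqrt (Z (p, s))" for s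
      proof (rule csqrt_cut_eq)
        have "0 \<le> \<kappa> * (s + \<alpha> (fst p))\<^sup>2" using \<kappa>(1) by simp
        then show "\<delta> / 2 \<le> Re (Z (p, s))"
          using nz[of "fst p"] n Re_Z_lower[of "fst p" s "snd p"] unfolding E1_def by simp
      qed (use \<delta> in simp)
      then show ?thesis by (simp add: W_def w_def)
    qed
    ultimately show ?thesis by (cases "E1 (fst p) = 0") (auto simp: P_def)
  qed
  then have "P 0 = (\<lambda>p. E1 (fst p) * w p + (E (fst p) * c (fst p)) * e p)" by (rule ext)
  then show ?thesis
    using TG_smooth_add[OF TG_smooth_mult[OF TG_smooth_time[OF circle_E1] w] TG_smooth_mult[OF TG_smooth_time[OF circle_Ec] e]]
    by simp
qed

end

context singular_solution
begin

text \<open>Since \<open>\<alpha>' + \<i> \<beta>' = a0 + \<i> b\<close> on the support of \<open>E\<close>, the function \<open>Z\<close> satisfies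
  \<open>(\<partial>\<^sub>t + (a0 + \<i> b) X) Z = (a0 + \<i> b) \<partial>\<^sub>s Z\<close>; hence so does every holomorphic function of \<open>Z\<close>, and
  the integral over \<open>s\<close> only leaves boundary terms.\<close>

lemma transport_W:
  assumes \<epsilon>: "\<epsilon> > 0" and Et: "E t \<noteq> 0"
  shows "D_T (W \<epsilon>) (t, x) + c t * D_X (W \<epsilon>) (t, x) = c t * B \<epsilon> (t, x)"
proof -
  define H where "H z = csqrt (complex_of_real \<epsilon> + z)" for z
  define H' where "H' s = inverse (2 * csqrt (complex_of_real \<epsilon> + Z ((t, x), s)))" for s
  define F where "F v = f (x \<otimes> \<gamma> v)" for v
  have xg: "smooth_map euclidean_atlas A (\<lambda>v. x \<otimes> \<gamma> v)"
    by (intro smooth_map_mult smooth_atlas_euclidean \<gamma> smooth_map_const atlas)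
  have Fs: "smooth_on UNIV F"
    using smooth_fun_pullback[OF smooth_atlas_euclidean atlas xg f(1)]
    by (simp add: F_def[abs_def] smooth_fun_def smooth_map_euclidean_iff)
  define F' where "F' v = frechet_derivative F (at v) 1" for v
  have dF: "(F has_vector_derivative F' v) (at v)" for v
    unfolding F'_def by (rule smooth_on_has_vector_derivative[OF Fs]) simp
  define z' where "z' s = - \<i> + complex_of_real \<kappa> * (2 * wpt t s)" for s
  have dH: "(H has_field_derivative H' s) (at (Z ((t, x), s)))" for s
  proof -
    have "complex_of_real \<epsilon> + Z ((t, x), s) \<notin> \<real>\<^sub>\<le>\<^sub>0"
      using Re_Z_nonneg[of "((t, x), s)"] \<epsilon> by (auto simp: complex_nonpos_Reals_iff)
    then show ?thesis unfolding H_def[abs_def] H'_def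
      by (auto intro!: derivative_eq_intros simp: inverse_eq_divide)
  qed
  have dzeta: "(zeta has_field_derivative z' s) (at (wpt t s))" for s
    unfolding zeta_def[abs_def] z'_def by (auto intro!: derivative_eq_intros)
  \<comment> \<open>All three derivatives of H(Z) carry the common factor \<open>H'\<close>, so the
    transport identity reduces to one between the derivatives of \<open>Z\<close>.\<close>
  have cH: "((\<lambda>r. H (g r)) has_vector_derivative g' * H' s) (at r)"
    if "(g has_vector_derivative g') (at r)" "g r = Z ((t, x), s)" for g g' r s
    using field_vector_diff_chain_at[OF that(1), of H "H' s"] dH[of s] that(2) by (simp add: o_def)
  \<comment> \<open>Since x exp(rX) exp(sX) = x exp((r + s)X), moving x along the field only shifts
    the argument of \<open>F\<close>.\<close>
  have hX: "((\<lambda>r. H (Z ((t, x \<otimes> \<gamma> r), s))) has_vector_derivative (\<i> * complex_of_real (F' s)) * H' s) (at 0)" for s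
  proof (rule cH)
    have "((\<lambda>r. r + s) has_vector_derivative 1) (at 0)" by (auto intro!: derivative_eq_intros)
    from vector_diff_chain_at[OF this, of F "F' s"] dF[of s]
    have "((\<lambda>r. F (r + s)) has_vector_derivative F' s) (at 0)" by (simp add: o_def)
    then have "((\<lambda>r. \<i> * complex_of_real (F (r + s)) + zeta (wpt t s)) has_vector_derivative \<i> * complex_of_real (F' s)) (at 0)"
      by (auto intro!: derivative_eq_intros has_vector_derivative_of_real
          simp: has_real_derivative_iff_has_vector_derivative)
    moreover have "Z ((t, x \<otimes> \<gamma> r), s) = \<i> * complex_of_real (F (r + s)) + zeta (wpt t s)" for r
      by (simp add: Z_def F_def \<gamma>(2))
    ultimately show "((\<lambda>r. Z ((t, x \<otimes> \<gamma> r), s)) has_vector_derivative \<i> * complex_of_real (F' s)) (at 0)" by simp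
    show "Z ((t, x \<otimes> \<gamma> 0), s) = Z ((t, x), s)" by (simp add: \<gamma>(3))
  qed
  have hT: "((\<lambda>r. H (Z ((r, x), s))) has_vector_derivative (c t * z' s) * H' s) (at t)" for s
  proof (rule cH)
    have "((\<lambda>r. wpt r s) has_vector_derivative c t) (at t)" unfolding wpt_def c_def
      using d\<alpha>[OF Et] d\<beta>[OF Et]
      by (auto intro!: derivative_eq_intros has_vector_derivative_of_real
          simp: has_real_derivative_iff_has_vector_derivative)
    from field_vector_diff_chain_at[OF this dzeta]
    have "((\<lambda>r. zeta (wpt r s)) has_vector_derivative c t * z' s) (at t)" by (simp add: o_def)
    then show "((\<lambda>r. Z ((r, x), s)) has_vector_derivative c t * z' s) (at t)"
      unfolding Z_def by (auto intro!: derivative_eq_intros)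
  qed simp
  have hS: "((\<lambda>s. H (Z ((t, x), s))) has_vector_derivative (\<i> * complex_of_real (F' s) + z' s) * H' s) (at s)" for s
  proof (rule cH)
    have "((\<lambda>s. wpt t s) has_vector_derivative 1) (at s)" unfolding wpt_def
      by (auto intro!: derivative_eq_intros has_vector_derivative_of_real)
    from field_vector_diff_chain_at[OF this dzeta]
    have z: "((\<lambda>s. zeta (wpt t s)) has_vector_derivative z' s) (at s)" by (simp add: o_def)
    have "((\<lambda>s. \<i> * complex_of_real (F s)) has_vector_derivative \<i> * complex_of_real (F' s)) (at s)"
      using dF[of s] by (auto intro!: derivative_eq_intros has_vector_derivative_of_real
          simp: has_real_derivative_iff_has_vector_derivative)
    from has_vector_derivative_add[OF this z]
    show "((\<lambda>s. Z ((t, x), s)) has_vector_derivative \<i> * complex_of_real (F' s) + z' s) (at s)"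
      by (simp add: Z_def F_def)
  qed simp
  have HZ: "csqrt (complex_of_real \<epsilon> + Z p) = csqrt_shift \<epsilon> (Z p)" for p using csqrt_shift_Z[OF \<epsilon>] by simp
  have pull: "smooth_on UNIV (\<lambda>p :: real \<times> real. csqrt_shift \<epsilon> (Z ((\<tau> (snd p), \<xi> (snd p)), fst p)))"
    if "smooth_map euclidean_atlas euclidean_atlas \<tau>" "smooth_map euclidean_atlas A \<xi>" for \<tau> \<xi>
  proof -
    have E2: "smooth_atlas (euclidean_atlas :: (real \<times> real, _) chart set)" by (rule smooth_atlas_euclidean)
    have sn: "smooth_map (euclidean_atlas :: (real \<times> real, _) chart set) euclidean_atlas snd"
      and fs: "smooth_map (euclidean_atlas :: (real \<times> real, _) chart set) euclidean_atlas fst"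
      by (simp_all add: smooth_map_euclidean_iff smooth_on_snd smooth_on_fst)
    have "smooth_map (euclidean_atlas :: (real \<times> real, _) chart set) TGR
        (\<lambda>p. ((\<tau> (snd p), \<xi> (snd p)), fst p))"
      by (intro smooth_map_Pair E2 TG smooth_atlas_euclidean atlas fs
          smooth_map_compose[OF E2 smooth_atlas_euclidean _ sn] that)
    from smooth_fun_pullback[OF E2 TGE this smooth_h_Z[OF smooth_csqrt_shift[OF \<epsilon>]]] show ?thesis
      by (simp add: smooth_fun_def smooth_map_euclidean_iff)
  qed
  have DX: "D_X (W \<epsilon>) (t, x) = integral {- R..R} (\<lambda>s. (\<i> * complex_of_real (F' s)) * H' s)"
  proof -
    have "smooth_on UNIV (\<lambda>p :: real \<times> real. csqrt_shift \<epsilon> (Z ((t, x \<otimes> \<gamma> (snd p)), fst p)))"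
      by (rule pull[OF smooth_map_const[OF smooth_atlas_euclidean smooth_atlas_euclidean] xg])
    from has_vector_derivative_integral_param[OF this, of "- R" R 0]
    have "((\<lambda>r. W \<epsilon> (t, x \<otimes> \<gamma> r)) has_vector_derivative integral {- R..R} (\<lambda>s. (\<i> * complex_of_real (F' s)) * H' s)) (at 0)"
      using vector_derivative_at[OF hX] by (simp add: W_def HZ[symmetric] H_def)
    with D_X_derivative[OF smooth_W[OF \<epsilon>], of t x] show ?thesis by (rule vector_derivative_unique_at)
  qed
  have DT: "D_T (W \<epsilon>) (t, x) = integral {- R..R} (\<lambda>s. (c t * z' s) * H' s)"
  proof -
    have "smooth_on UNIV (\<lambda>p :: real \<times> real. csqrt_shift \<epsilon> (Z ((snd p, x), fst p)))"
      by (rule pull[OF smooth_map_ident[OF smooth_atlas_euclidean] smooth_map_const[OF smooth_atlas_euclidean atlas]])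
    from has_vector_derivative_integral_param[OF this, of "- R" R t]
    have "((\<lambda>r. W \<epsilon> (r, x)) has_vector_derivative integral {- R..R} (\<lambda>s. (c t * z' s) * H' s)) (at t)"
      using vector_derivative_at[OF hT] by (simp add: W_def HZ[symmetric] H_def)
    with D_T_derivative[OF smooth_W[OF \<epsilon>], of x t] show ?thesis by (rule vector_derivative_unique_at)
  qed
  have FTC: "((\<lambda>s. (\<i> * complex_of_real (F' s) + z' s) * H' s) has_integral B \<epsilon> (t, x)) {- R..R}"
    using fundamental_theorem_of_calculus[of "- R" R "\<lambda>s. H (Z ((t, x), s))", OF _ has_vector_derivative_at_within[OF hS]] R_pos
    by (simp add: B_def H_def)
  have cZ: "continuous_on S (\<lambda>s. complex_of_real \<epsilon> + Z ((t, x), s))" for S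
  proof -
    have "continuous_on UNIV (\<lambda>s. Z ((t, x), s))"
      by (rule continuous_on_compose2[OF smooth_fun_continuous[OF smooth_Z]]) (auto intro!: continuous_intros)
    then show ?thesis using continuous_on_subset by (intro continuous_intros) blast
  qed
  have cH': "continuous_on S H'" for S
  proof -
    have "Re (complex_of_real \<epsilon> + Z ((t, x), s)) > 0" for s using Re_Z_nonneg[of "((t, x), s)"] \<epsilon> by simp
    then have "csqrt (complex_of_real \<epsilon> + Z ((t, x), s)) \<noteq> 0" for s by (metis csqrt_eq_0 less_irrefl zero_complex.sel(1))
    moreover have "continuous_on S (\<lambda>s. csqrt (complex_of_real \<epsilon> + Z ((t, x), s)))"
      by (rule continuous_on_compose2[OF continuous_on_csqrt_right_half_plane cZ])
        (use Re_Z_nonneg \<epsilon> in \<open>auto simp: add_nonneg_nonneg\<close>)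
    ultimately show ?thesis unfolding H'_def by (intro continuous_intros) auto
  qed
  have cF': "continuous_on S F'" for S
    unfolding F'_def using smooth_on_continuous_on[OF smooth_on_imp_frechet[OF Fs]] continuous_on_subset by blast
  have cz': "continuous_on S z'" for S unfolding z'_def wpt_def by (intro continuous_intros)
  have i1: "(\<lambda>s. (c t * z' s) * H' s) integrable_on {- R..R}"
    and i2: "(\<lambda>s. (\<i> * complex_of_real (F' s)) * H' s) integrable_on {- R..R}"
    by (intro integrable_continuous_real continuous_intros cF' cz' cH')+
  have "D_T (W \<epsilon>) (t, x) + c t * D_X (W \<epsilon>) (t, x) =
      integral {- R..R} (\<lambda>s. (c t * z' s) * H' s + c t * ((\<i> * complex_of_real (F' s)) * H' s))"
    unfolding DX DT
    using Henstock_Kurzweil_Integration.integral_add[OF i1 integrable_on_mult_right[OF i2, of "c t"]] by simp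
  also have "\<dots> = integral {- R..R} (\<lambda>s. c t * ((\<i> * complex_of_real (F' s) + z' s) * H' s))"
    by (intro arg_cong[of _ _ "integral {- R..R}"] ext) (simp add: algebra_simps)
  also have "\<dots> = c t * B \<epsilon> (t, x)" using FTC by (simp add: integral_unique)
  finally show ?thesis .
qed

lemma D_time: "smooth_on UNIV h \<Longrightarrow> D_X (\<lambda>p. h (fst p)) p = 0"
  "smooth_on UNIV h \<Longrightarrow> D_T (\<lambda>p. h (fst p)) p = vector_derivative h (at (fst p))" for h :: "real \<Rightarrow> complex"
proof -
  assume h: "smooth_on UNIV h"
  obtain t x where p: "p = (t, x)" by (cases p)
  have "((\<lambda>s. h t) has_vector_derivative D_X (\<lambda>p. h (fst p)) (t, x)) (at 0)"
    using D_X_derivative[OF smooth_time[OF h], of t x] by simp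
  then show "D_X (\<lambda>p. h (fst p)) p = 0"
    unfolding p by (rule vector_derivative_unique_at) (rule has_vector_derivative_const)
  show "D_T (\<lambda>p. h (fst p)) p = vector_derivative h (at (fst p))"
    using vector_derivative_at[OF D_T_derivative[OF smooth_time[OF h], of x t]] by (simp add: p)
qed

text \<open>By the product rule \<open>transport_W\<close> enters multiplied by \<open>E\<close>, so
  it is used only where \<open>E\<close> is nonzero.\<close>

lemma transport_V:
  assumes \<epsilon>: "\<epsilon> > 0"
  shows "D_T (V \<epsilon>) p + c (fst p) * D_X (V \<epsilon>) p + q * V \<epsilon> p = P \<epsilon> p"
proof -
  have Es: "smooth_on UNIV E" using E by (simp add: circle_smooth_def)
  note m = D_mult[OF smooth_time[OF Es] smooth_W[OF \<epsilon>], of p]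
  have "D_T (V \<epsilon>) p = E (fst p) * D_T (W \<epsilon>) p + vector_derivative E (at (fst p)) * W \<epsilon> p"
    "D_X (V \<epsilon>) p = E (fst p) * D_X (W \<epsilon>) p"
    using m by (simp_all add: V_def[abs_def] D_time[OF Es])
  then have "D_T (V \<epsilon>) p + c (fst p) * D_X (V \<epsilon>) p + q * V \<epsilon> p =
      E (fst p) * (D_T (W \<epsilon>) p + c (fst p) * D_X (W \<epsilon>) p) + E1 (fst p) * W \<epsilon> p"
    by (simp add: V_def E1_def algebra_simps)
  also have "E (fst p) * (D_T (W \<epsilon>) p + c (fst p) * D_X (W \<epsilon>) p) = E (fst p) * (c (fst p) * B \<epsilon> p)"
    using transport_W[OF \<epsilon>, of "fst p" "snd p"] by (cases "E (fst p) = 0") auto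
  finally show ?thesis by (simp add: P_def algebra_simps)
qed

text \<open>With all derivatives on the test function only the values of \<open>V \<epsilon>\<close>
  and \<open>P \<epsilon>\<close> remain, and these converge uniformly as \<epsilon> tends to
  0.\<close>

lemma weak_transport:
  assumes \<epsilon>: "\<epsilon> > 0" and \<phi>: "\<phi> \<in> TG_smooth A"
  shows "- J (\<lambda>p. V \<epsilon> p * D_T \<phi> p) - J (\<lambda>p. V \<epsilon> p * (c (fst p) * D_X \<phi> p)) + q * J (\<lambda>p. V \<epsilon> p * \<phi> p) =
    J (\<lambda>p. P \<epsilon> p * \<phi> p)"
proof -
  note V = TG_V[OF \<epsilon>]
  have sV: "smooth_fun TG (V \<epsilon>)" and s\<phi>: "smooth_fun TG \<phi>" using V \<phi> by (auto simp: TG_smooth_def)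
  have css: "smooth_on UNIV c" using circle_c by (simp add: circle_smooth_def)
  have cc: "(\<lambda>p :: real \<times> 'g. c (fst p)) \<in> TG_smooth A" by (rule TG_smooth_time[OF circle_c])
  have "D_X (\<lambda>p. c (fst p) * \<phi> p) p = c (fst p) * D_X \<phi> p" for p
    using D_mult(1)[OF smooth_time[OF css] s\<phi>] by (simp add: D_time[OF css])
  then have 1: "J (\<lambda>p. V \<epsilon> p * (c (fst p) * D_X \<phi> p)) = - J (\<lambda>p. D_X (V \<epsilon>) p * (c (fst p) * \<phi> p))"
    using J_by_parts(1)[OF V TG_smooth_mult[OF cc \<phi>]] by simp
  have 2: "J (\<lambda>p. V \<epsilon> p * D_T \<phi> p) = - J (\<lambda>p. D_T (V \<epsilon>) p * \<phi> p)" by (rule J_by_parts(2)[OF V \<phi>])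
  have c1: "continuous_on UNIV (\<lambda>p. D_T (V \<epsilon>) p * \<phi> p)"
    and c2: "continuous_on UNIV (\<lambda>p. D_X (V \<epsilon>) p * (c (fst p) * \<phi> p))"
    and c3: "continuous_on UNIV (\<lambda>p. V \<epsilon> p * \<phi> p)"
    by (intro continuous_on_mult continuous_smooth smooth_D_T smooth_D_X sV s\<phi> TG_smooth_continuous[OF cc])+
  have "- J (\<lambda>p. V \<epsilon> p * D_T \<phi> p) - J (\<lambda>p. V \<epsilon> p * (c (fst p) * D_X \<phi> p)) + q * J (\<lambda>p. V \<epsilon> p * \<phi> p) =
      J (\<lambda>p. (D_T (V \<epsilon>) p * \<phi> p + D_X (V \<epsilon>) p * (c (fst p) * \<phi> p)) + q * (V \<epsilon> p * \<phi> p))"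
    unfolding J_add[OF continuous_on_add[OF c1 c2] continuous_on_mult_left[OF c3]] J_add[OF c1 c2] J_cmult[OF c3] 1 2
    by simp
  also have "(\<lambda>p. (D_T (V \<epsilon>) p * \<phi> p + D_X (V \<epsilon>) p * (c (fst p) * \<phi> p)) + q * (V \<epsilon> p * \<phi> p)) = (\<lambda>p. P \<epsilon> p * \<phi> p)"
    by (rule ext) (simp add: transport_V[OF \<epsilon>, symmetric] algebra_simps)
  finally show ?thesis .
qed

section \<open>Uniform convergence of the regularised solutions\<close>

lemma continuous_csqrt_shift: "\<epsilon> \<ge> 0 \<Longrightarrow> continuous_on UNIV (\<lambda>p. csqrt (complex_of_real \<epsilon> + Z p))"
  by (rule continuous_on_compose2[OF continuous_on_csqrt_right_half_plane])
    (use Re_Z_nonneg in \<open>auto intro!: continuous_intros smooth_fun_continuous[OF smooth_Z] simp: add_nonneg_nonneg\<close>)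

lemma continuous_W: "\<epsilon> \<ge> 0 \<Longrightarrow> continuous_on UNIV (W \<epsilon>)"
proof -
  assume "\<epsilon> \<ge> 0"
  then have "continuous_on (UNIV \<times> cbox (- R) R) (\<lambda>(p, s). csqrt (complex_of_real \<epsilon> + Z (p, s)))"
    using continuous_on_subset[OF continuous_csqrt_shift] by (auto simp: case_prod_beta')
  from integral_continuous_on_param[OF this] show ?thesis by (simp add: W_def[abs_def])
qed

lemma continuous_B: "\<epsilon> \<ge> 0 \<Longrightarrow> continuous_on UNIV (B \<epsilon>)"
  unfolding B_def[abs_def]
  by (intro continuous_on_diff continuous_on_compose2[OF continuous_csqrt_shift]) (auto intro!: continuous_intros)

lemma continuous_V: "\<epsilon> \<ge> 0 \<Longrightarrow> continuous_on UNIV (V \<epsilon>)"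
  unfolding V_def[abs_def]
  by (intro continuous_on_mult continuous_W TG_smooth_continuous[OF TG_smooth_time[OF E]])

lemma continuous_P: "\<epsilon> \<ge> 0 \<Longrightarrow> continuous_on UNIV (P \<epsilon>)"
  unfolding P_def[abs_def]
  by (intro continuous_on_add continuous_on_mult continuous_W continuous_B
      TG_smooth_continuous[OF TG_smooth_time[OF circle_E1]] TG_smooth_continuous[OF TG_smooth_time[OF circle_Ec]])

text \<open>Hoelder continuity of exponent 1/2 gives a rate that is uniform up to the zeros of
  \<open>Z\<close>, where the root is not Lipschitz.\<close>

lemma csqrt_shift_diff: "\<epsilon> \<ge> 0 \<Longrightarrow> cmod (csqrt (complex_of_real \<epsilon> + Z p) - csqrt (Z p)) \<le> sqrt \<epsilon>"
  using csqrt_hoelder[of "complex_of_real \<epsilon> + Z p" "Z p"] Re_Z_nonneg[of p]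
  by (simp add: real_le_rsqrt)

lemma W_diff: "\<epsilon> \<ge> 0 \<Longrightarrow> cmod (W \<epsilon> p - W 0 p) \<le> sqrt \<epsilon> * (2 * R)"
proof -
  assume \<epsilon>: "\<epsilon> \<ge> 0"
  have c: "continuous_on S (\<lambda>s. csqrt (complex_of_real e + Z (p, s)))" if "e \<ge> 0" for e S
    by (intro continuous_on_compose2[OF continuous_csqrt_shift[OF that]]) (auto intro!: continuous_intros)
  have i: "(\<lambda>s. csqrt (complex_of_real e + Z (p, s))) integrable_on {- R..R}" if "e \<ge> 0" for e
    by (rule integrable_continuous_real[OF c[OF that]])
  have "W \<epsilon> p - W 0 p = integral {- R..R} (\<lambda>s. csqrt (complex_of_real \<epsilon> + Z (p, s)) - csqrt (complex_of_real 0 + Z (p, s)))"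
    unfolding W_def using Henstock_Kurzweil_Integration.integral_diff[OF i[OF \<epsilon>] i[OF order_refl]] by simp
  also have "cmod \<dots> \<le> sqrt \<epsilon> * (R - (- R))"
    by (rule integral_bound) (use R_pos csqrt_shift_diff[OF \<epsilon>] in \<open>auto intro!: continuous_on_diff c c[of 0, simplified] \<epsilon>\<close>)
  finally show ?thesis by simp
qed

lemma B_diff: "\<epsilon> \<ge> 0 \<Longrightarrow> cmod (B \<epsilon> p - B 0 p) \<le> sqrt \<epsilon> * 2"
proof -
  assume "\<epsilon> \<ge> 0"
  note d = csqrt_shift_diff[OF this, of "(p, R)"] csqrt_shift_diff[OF this, of "(p, - R)"]
  have "B \<epsilon> p - B 0 p = (csqrt (complex_of_real \<epsilon> + Z (p, R)) - csqrt (Z (p, R))) -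
      (csqrt (complex_of_real \<epsilon> + Z (p, - R)) - csqrt (Z (p, - R)))"
    by (simp add: B_def)
  then have "cmod (B \<epsilon> p - B 0 p) \<le> cmod (csqrt (complex_of_real \<epsilon> + Z (p, R)) - csqrt (Z (p, R))) +
      cmod (csqrt (complex_of_real \<epsilon> + Z (p, - R)) - csqrt (Z (p, - R)))"
    by (simp only: norm_triangle_ineq4)
  then show ?thesis using d by linarith
qed

lemma uniform_limit_sqrt:
  fixes k :: "real \<Rightarrow> real \<times> 'g \<Rightarrow> complex"
  assumes "C \<ge> 0" "\<And>\<epsilon> p. \<epsilon> \<ge> 0 \<Longrightarrow> cmod (k \<epsilon> p - k 0 p) \<le> sqrt \<epsilon> * C"
  shows "uniform_limit S (\<lambda>n. k (1 / real (Suc n))) (k 0) sequentially"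
  unfolding uniform_limit_iff
proof (intro allI impI)
  fix e :: real assume e: "e > 0"
  have "(\<lambda>n. sqrt (1 / real (Suc n)) * C) \<longlonglongrightarrow> sqrt 0 * C"
    using LIMSEQ_inverse_real_of_nat by (intro tendsto_intros) (simp add: inverse_eq_divide)
  then have "\<forall>\<^sub>F n in sequentially. sqrt (1 / real (Suc n)) * C < e"
    using e by (intro order_tendstoD(2)) auto
  then show "\<forall>\<^sub>F n in sequentially. \<forall>p\<in>S. dist (k (1 / real (Suc n)) p) (k 0 p) < e"
  proof eventually_elim
    case (elim n)
    show ?case using assms(2)[of "1 / real (Suc n)"] elim by (auto simp: dist_norm intro: le_less_trans)
  qed
qed

lemma uniform_V: "uniform_limit S (\<lambda>n. V (1 / real (Suc n))) (V 0) sequentially"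
proof -
  obtain M where M: "M \<ge> 0" "\<And>t. norm (E t) \<le> M" using circle_smooth_bounded[OF E] by blast
  show ?thesis
  proof (rule uniform_limit_sqrt)
    show "M * (2 * R) \<ge> 0" using M R_pos by simp
    fix \<epsilon> :: real and p :: "real \<times> 'g" assume "\<epsilon> \<ge> 0"
    have "cmod (V \<epsilon> p - V 0 p) = cmod (E (fst p)) * cmod (W \<epsilon> p - W 0 p)"
      by (simp add: V_def norm_mult[symmetric] algebra_simps)
    also have "\<dots> \<le> M * (sqrt \<epsilon> * (2 * R))" by (intro mult_mono M W_diff \<open>\<epsilon> \<ge> 0\<close>) auto
    finally show "cmod (V \<epsilon> p - V 0 p) \<le> sqrt \<epsilon> * (M * (2 * R))" by (simp add: mult_ac)
  qed
qed

lemma uniform_P: "uniform_limit S (\<lambda>n. P (1 / real (Suc n))) (P 0) sequentially"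
proof -
  obtain M where M: "M \<ge> 0" "\<And>t. norm (E1 t) \<le> M" using circle_smooth_bounded[OF circle_E1] by blast
  obtain N where N: "N \<ge> 0" "\<And>t. norm (E t * c t) \<le> N" using circle_smooth_bounded[OF circle_Ec] by blast
  show ?thesis
  proof (rule uniform_limit_sqrt)
    show "M * (2 * R) + N * 2 \<ge> 0" using M N R_pos by simp
    fix \<epsilon> :: real and p :: "real \<times> 'g" assume \<epsilon>: "\<epsilon> \<ge> 0"
    have "P \<epsilon> p - P 0 p = E1 (fst p) * (W \<epsilon> p - W 0 p) + (E (fst p) * c (fst p)) * (B \<epsilon> p - B 0 p)"
      by (simp add: P_def algebra_simps)
    then have "cmod (P \<epsilon> p - P 0 p) \<le> cmod (E1 (fst p)) * cmod (W \<epsilon> p - W 0 p) + cmod (E (fst p) * c (fst p)) * cmod (B \<epsilon> p - B 0 p)"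
      using norm_triangle_ineq by (metis norm_mult)
    also have "\<dots> \<le> M * (sqrt \<epsilon> * (2 * R)) + N * (sqrt \<epsilon> * 2)"
      by (intro add_mono mult_mono M N W_diff B_diff \<epsilon>) auto
    finally show "cmod (P \<epsilon> p - P 0 p) \<le> sqrt \<epsilon> * (M * (2 * R) + N * 2)" by (simp add: algebra_simps)
  qed
qed

definition u\<^sub>0 :: "'g functional" where "u\<^sub>0 = (\<lambda>\<phi>. J (\<lambda>p. V 0 p * \<phi> p))"

lemma u0_distribution: "u\<^sub>0 \<in> distributions A"
  unfolding u\<^sub>0_def by (rule J_distribution[OF continuous_V]) simp

lemma L_u0:
  assumes \<phi>: "\<phi> \<in> TG_smooth A"
  shows "L_op G A X a0 b q u\<^sub>0 \<phi> = J (\<lambda>p. P 0 p * \<phi> p)"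
proof -
  define e where "e n = 1 / real (Suc n)" for n
  have e: "e n > 0" for n by (simp add: e_def)
  have s\<phi>: "smooth_fun TG \<phi>" using \<phi> by (simp add: TG_smooth_def)
  have cs: "continuous_on UNIV (\<lambda>p :: real \<times> 'g. c (fst p))"
    by (rule TG_smooth_continuous[OF TG_smooth_time[OF circle_c]])
  have l: "(\<lambda>n. J (\<lambda>p. V (e n) p * \<psi> p)) \<longlonglongrightarrow> J (\<lambda>p. V 0 p * \<psi> p)" if "continuous_on UNIV \<psi>" for \<psi>
    unfolding e_def by (rule J_tendsto[OF continuous_V continuous_V that uniform_V]) auto
  have "(\<lambda>n. - J (\<lambda>p. V (e n) p * D_T \<phi> p) - J (\<lambda>p. V (e n) p * (c (fst p) * D_X \<phi> p)) + q * J (\<lambda>p. V (e n) p * \<phi> p))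
      \<longlonglongrightarrow> - J (\<lambda>p. V 0 p * D_T \<phi> p) - J (\<lambda>p. V 0 p * (c (fst p) * D_X \<phi> p)) + q * J (\<lambda>p. V 0 p * \<phi> p)"
    by (intro tendsto_intros l continuous_on_mult cs continuous_smooth smooth_D_T smooth_D_X s\<phi>)
  moreover have "(\<lambda>n. J (\<lambda>p. P (e n) p * \<phi> p)) \<longlonglongrightarrow> J (\<lambda>p. P 0 p * \<phi> p)"
    unfolding e_def by (rule J_tendsto[OF continuous_P continuous_P continuous_smooth[OF s\<phi>] uniform_P]) auto
  ultimately have "- J (\<lambda>p. V 0 p * D_T \<phi> p) - J (\<lambda>p. V 0 p * (c (fst p) * D_X \<phi> p)) + q * J (\<lambda>p. V 0 p * \<phi> p) =
      J (\<lambda>p. P 0 p * \<phi> p)"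
    unfolding weak_transport[OF e \<phi>] by (rule LIMSEQ_unique)
  then show ?thesis
    unfolding u\<^sub>0_def by (subst L_op_J[OF \<phi>, of c]) (auto simp: c_def)
qed

text \<open>On the slice t = \<open>t\<^sub>0\<close> and along \<gamma>, division by the nonzero
  \<open>E t\<^sub>0\<close> leaves exactly the singular integral, whereas \<open>g\<close> is
  differentiable along the flow.\<close>

lemma V0_not_smooth:
  assumes g: "g \<in> TG_smooth A" and eq: "\<And>x. V 0 (t\<^sub>0, x) = g (t\<^sub>0, x)"
  shows False
proof -
  define F where "F v = f (\<gamma> v)" for v
  define w where "w r = W 0 (t\<^sub>0, \<gamma> r)" for r
  have F: "smooth_on UNIV F"
    using smooth_fun_pullback[OF smooth_atlas_euclidean atlas \<gamma>(1) f(1)]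
    by (simp add: F_def[abs_def] smooth_fun_def smooth_map_euclidean_iff)
  have "((\<lambda>s. f (\<gamma> s)) has_real_derivative X f) (at 0)"
    using flow f(1) unfolding one_parameter_subgroup_def by blast
  then have F': "(F has_real_derivative 1) (at 0)" by (simp add: F_def[abs_def] f(3))
  have w: "w r = integral {- R..R} (\<lambda>s. csqrt (Complex (\<kappa> * s\<^sup>2) (F (r + s) - s)))" for r
  proof -
    have "Z ((t\<^sub>0, \<gamma> r), s) = Complex (\<kappa> * s\<^sup>2) (F (r + s) - s)" for s
      by (simp add: Z_def zeta_def wpt_def at_t0 F_def \<gamma>(2) complex_eq_iff power2_eq_square)
    then show ?thesis by (simp add: w_def W_def)
  qed
  have "((\<lambda>s. g (t\<^sub>0, \<one> \<otimes> \<gamma> s)) has_vector_derivative D_X g (t\<^sub>0, \<one>)) (at 0)"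
    by (rule D_X_derivative) (use g in \<open>simp add: TG_smooth_def\<close>)
  from has_vector_derivative_mult_right[OF this, of "inverse (E t\<^sub>0)"]
  have "((\<lambda>s. inverse (E t\<^sub>0) * g (t\<^sub>0, \<gamma> s)) has_vector_derivative inverse (E t\<^sub>0) * D_X g (t\<^sub>0, \<one>)) (at 0)"
    by simp
  moreover have "inverse (E t\<^sub>0) * g (t\<^sub>0, \<gamma> s) = w s" for s
    using at_t0(3) by (simp add: eq[symmetric] V_def w_def)
  ultimately have d: "(w has_vector_derivative inverse (E t\<^sub>0) * D_X g (t\<^sub>0, \<one>)) (at 0)" by simp
  show False
    by (rule singular_integral_not_differentiable[OF F _ F' \<kappa>(1) R_pos w d]) (simp add: F_def \<gamma>(3) f(2))
qed

text \<open>A smooth density g would have to equal the continuous function \<open>V 0\<close>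
  pointwise, against \<open>V0_not_smooth\<close>.\<close>

lemma u0_not_smooth: "\<not> is_smooth_distribution A \<mu> u\<^sub>0"
proof
  assume "is_smooth_distribution A \<mu> u\<^sub>0"
  then obtain g where g: "g \<in> TG_smooth A" and u: "\<And>\<phi>. \<phi> \<in> TG_smooth A \<Longrightarrow> u\<^sub>0 \<phi> = J (\<lambda>p. g p * \<phi> p)"
    unfolding is_smooth_distribution_def J_def by blast
  have cg: "continuous_on UNIV g" by (rule TG_smooth_continuous[OF g])
  have cV: "continuous_on UNIV (V 0)" by (rule continuous_V) simp
  have cd: "continuous_on UNIV (\<lambda>p. V 0 p - g p)" by (intro continuous_on_diff cV cg)
  \<comment> \<open>One would test with the conjugate of \<open>V 0 - g\<close>, but that is not
    known to be smooth; the regularised solutions give admissible test functions converging to it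
    uniformly.\<close>
  define k where "k n p = cnj (V (1 / real (Suc n)) p - g p)" for n p
  have kTG: "k n \<in> TG_smooth A" for n
    unfolding k_def[abs_def] by (intro TG_smooth_cnj TG_smooth_diff TG_V g) simp
  have J0: "J (\<lambda>p. k n p * (V 0 p - g p)) = 0" for n
  proof -
    have c: "continuous_on UNIV (\<lambda>p. V 0 p * k n p)" "continuous_on UNIV (\<lambda>p. g p * k n p)"
      by (intro continuous_on_mult cV cg TG_smooth_continuous[OF kTG])+
    show ?thesis using u[OF kTG, of n] J_diff[OF c] by (simp add: u\<^sub>0_def algebra_simps)
  qed
  have lim: "(\<lambda>n. J (\<lambda>p. k n p * (V 0 p - g p))) \<longlonglongrightarrow> J (\<lambda>p. cnj (V 0 p - g p) * (V 0 p - g p))"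
  proof (rule J_tendsto[OF TG_smooth_continuous[OF kTG] _ cd])
    show "continuous_on UNIV (\<lambda>p. cnj (V 0 p - g p))" by (intro continuous_intros cV cg)
    have "dist (k n p) (cnj (V 0 p - g p)) = dist (V (1 / real (Suc n)) p) (V 0 p)" for n p
      by (simp add: k_def dist_norm complex_cnj_diff[symmetric] del: complex_cnj_diff)
    then show "uniform_limit period_cell k (\<lambda>p. cnj (V 0 p - g p)) sequentially"
      using uniform_V[of period_cell] unfolding uniform_limit_iff by simp
  qed
  have "J (\<lambda>p. cnj (V 0 p - g p) * (V 0 p - g p)) = 0"
    using lim unfolding J0 LIMSEQ_const_iff by (rule sym)
  moreover have "(\<lambda>p. cnj (V 0 p - g p) * (V 0 p - g p)) = (\<lambda>p. (V 0 p - g p) * cnj (V 0 p - g p))"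
    by (rule ext) (rule mult.commute)
  ultimately have "J (\<lambda>p. (V 0 p - g p) * cnj (V 0 p - g p)) = 0" by (simp only:)
  note z = J_definite[OF cd this]
  \<comment> \<open>The pairing sees only [0, 2 pi], and \<open>t\<^sub>0\<close> may lie outside;
    periodicity of both functions transfers the equality.\<close>
  obtain n where n: "0 \<le> t\<^sub>0 - 2 * pi * of_int n" "t\<^sub>0 - 2 * pi * of_int n < 0 + 2 * pi"
    by (rule periodize_point[of 0 t\<^sub>0])
  have "V 0 (t\<^sub>0, x) = g (t\<^sub>0, x)" for x
  proof -
    have "V 0 (t\<^sub>0 - 2 * pi * of_int n, x) - g (t\<^sub>0 - 2 * pi * of_int n, x) = 0"
      using z[of "t\<^sub>0 - 2 * pi * of_int n" x] n by simp
    moreover have "V 0 (t\<^sub>0 - 2 * pi * of_int n, x) = V 0 (t\<^sub>0, x)"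
      by (rule periodic_int[of "\<lambda>t. V 0 (t, x)"]) (use E in \<open>simp add: V_def W_def Z_periodic circle_smooth_def\<close>)
    moreover have "g (t\<^sub>0 - 2 * pi * of_int n, x) = g (t\<^sub>0, x)"
      by (rule periodic_int[of "\<lambda>t. g (t, x)"]) (use g in \<open>simp add: TG_smooth_def\<close>)
    ultimately show ?thesis by simp
  qed
  then show False by (rule V0_not_smooth[OF g])
qed

lemma not_globally_hypoelliptic: "\<not> globally_hypoelliptic A \<mu> (L_op G A X a0 b q)"
proof
  assume "globally_hypoelliptic A \<mu> (L_op G A X a0 b q)"
  moreover have "is_smooth_distribution A \<mu> (L_op G A X a0 b q u\<^sub>0)"
    unfolding is_smooth_distribution_def using TG_P0 L_u0 unfolding J_def by blast
  ultimately show False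
    using u0_distribution u0_not_smooth unfolding globally_hypoelliptic_def by blast
qed

end

theorem theorem4p2:
  fixes G :: "('g::t2_space, 'x) monoid_scheme"
    and A :: "('g, 'e::euclidean_space) chart set"
    and \<mu> :: "'g measure"
    and X :: "('g \<Rightarrow> real) \<Rightarrow> real"
    and a0 :: real and b :: "real \<Rightarrow> real" and q :: complex
  assumes "lie_group G A" and "compact (UNIV :: 'g set)"
    and "haar_measure G \<mu>"
    and "X \<in> lie_algebra G A" and "X \<noteq> (\<lambda>f. 0)"
    and "circle_smooth b" and "\<exists>t. b t \<noteq> 0"
    and "globally_hypoelliptic A \<mu> (L_op G A X a0 b q)"
  shows "(\<forall>t. b t \<ge> 0) \<or> (\<forall>t. b t \<le> 0)"
proof (rule ccontr)
  assume "\<not> ?thesis"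
  then obtain s\<^sub>1 s\<^sub>2 where s: "b s\<^sub>1 < 0" "b s\<^sub>2 > 0" by (auto simp: not_le)
  interpret lie_group G A by fact
  have X: "derivation_at A \<one>\<^bsub>G\<^esub> X" by (rule lie_algebra_derivation) fact
  obtain \<gamma> where \<gamma>: "one_parameter_subgroup G A X \<gamma>" by (rule ex_one_parameter_subgroup[OF X])
  \<comment> \<open>Elements of the Lie algebra vanish on nonsmooth functions, so this
    \<open>h\<close> is smooth; an affine change of it yields the normalised
    \<open>f\<close>.\<close>
  obtain h where h: "X h \<noteq> 0" using assms(5) by auto
  then have hs: "smooth_fun A h" using assms(4) unfolding lie_algebra_def by blast
  define f where "f x = (1 / X h) * h x + (- (h \<one>\<^bsub>G\<^esub> / X h))" for x
  have m: "smooth_fun A (\<lambda>x. (1 / X h) * h x)" by (intro smooth_fun_mult smooth_fun_const atlas hs)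
  have f: "smooth_fun A f" unfolding f_def by (intro smooth_fun_add m smooth_fun_const atlas)
  have "X f = X (\<lambda>x. (1 / X h) * h x) + X (\<lambda>x. - (h \<one>\<^bsub>G\<^esub> / X h))"
    unfolding f_def by (rule derivation_atD(1)[OF X m smooth_fun_const[OF atlas]])
  also have "\<dots> = 1"
    unfolding derivation_const[OF atlas X] derivation_atD(2)[OF X hs hs] using h by simp
  finally have Xf: "X f = 1" .
  obtain \<alpha> \<beta> E t\<^sub>0 \<delta> where d: "circle_smooth \<alpha>" "circle_smooth \<beta>" "circle_smooth E" "\<delta> > 0" "\<And>t. \<beta> t \<ge> 0"
    "\<beta> t\<^sub>0 = 0" "\<alpha> t\<^sub>0 = 0" "E t\<^sub>0 \<noteq> 0"
    "\<And>t. E t \<noteq> 0 \<Longrightarrow> (\<alpha> has_vector_derivative a0) (at t)"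
    "\<And>t. E t \<noteq> 0 \<Longrightarrow> (\<beta> has_vector_derivative b t) (at t)"
    "\<And>t. vector_derivative E (at t) + q * E t \<noteq> 0 \<Longrightarrow> \<delta> \<le> \<beta> t"
    by (rule cutoff_data[OF assms(6) s, of a0 q]) blast
  obtain M where M: "M \<ge> 0" "\<And>t. norm (\<alpha> t) \<le> M" using circle_smooth_bounded[OF d(1)] by blast
  obtain N where N: "N \<ge> 0" "\<And>t. norm (\<beta> t) \<le> N" using circle_smooth_bounded[OF d(2)] by blast
  \<comment> \<open>The summand 1 covers the case N = 0.\<close>
  define \<kappa> where "\<kappa> = 1 / (2 * (N + 1))"
  have \<kappa>: "\<kappa> > 0" using N(1) by (simp add: \<kappa>_def)
  have \<kappa>\<beta>: "\<kappa> * \<beta> t \<le> 1 / 2" for t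
  proof -
    have "\<beta> t \<le> N + 1" using N(2)[of t] by simp
    then have "\<kappa> * \<beta> t \<le> \<kappa> * (N + 1)" using \<kappa> by (intro mult_left_mono) auto
    also have "\<dots> = 1 / 2" using N(1) by (simp add: \<kappa>_def)
    finally show ?thesis .
  qed
  interpret singular_solution G A \<mu> X \<gamma> f \<alpha> \<beta> b E a0 t\<^sub>0 \<delta> \<kappa> "M + 1" q
  proof unfold_locales
    show "\<bar>\<alpha> t\<bar> + 1 \<le> M + 1" for t using M(2)[of t] by simp
    show "f \<one>\<^bsub>G\<^esub> = 0" by (simp add: f_def)
  qed (fact assms \<gamma> f Xf d \<kappa> \<kappa>\<beta>)+
  show False using not_globally_hypoelliptic assms(8) by blast
qed

end
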